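(* Let $\varphi$ and $\psi$ be automorphisms of $B_N$. Then $[C_\psi^{\ast}, C_\varphi]=C_\psi^{\ast} C_\varphi- C_\varphi C_\psi^{\ast}$ is compact on the Dirichlet space $\mathcal{D}(B_N)$ if and only if $\varphi\circ\psi=\psi\circ\varphi$.
   Context: The Dirichlet space $\mathcal{D}(B_N)$ consists of holomorphic $f=\sum_\alpha c_\alpha z^\alpha$ on $B_N$ with $\|f\|_{\mathcal D}^2=|f(0)|^2+\sum_\alpha|c_\alpha|^2|\alpha|\frac{\alpha!}{|\alpha|!}<\infty$ (multi-index notation $|\alpha|=\sum\alpha_i$, $\alpha!=\prod\alpha_i!$). $C_\varphi f=f\circ\varphi$ and $C_\psi^\ast$ denotes the adjoint of $C_\psi$ in $\mathcal{D}(B_N)$. Automorphisms are biholomorphic self-maps of $B_N$. *)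

theory Defs
  imports "HOL-Analysis.Analysis"
begin

abbreviation ballN :: "(complex ^ 'n) set" where
  "ballN \<equiv> ball 0 1"

definition mono_pow :: "nat ^ 'n \<Rightarrow> complex ^ 'n \<Rightarrow> complex" where
  "mono_pow \<alpha> z = (\<Prod>i\<in>UNIV. (z $ i) ^ (\<alpha> $ i))"

definition mi_abs :: "nat ^ 'n \<Rightarrow> nat" where
  "mi_abs \<alpha> = (\<Sum>i\<in>UNIV. \<alpha> $ i)"

definition mi_fact :: "nat ^ 'n \<Rightarrow> real" where
  "mi_fact \<alpha> = (\<Prod>i\<in>UNIV. fact (\<alpha> $ i))"

definition dweight :: "nat ^ 'n \<Rightarrow> real" where
  "dweight \<alpha> = real (mi_abs \<alpha>) * mi_fact \<alpha> / fact (mi_abs \<alpha>)"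

definition holo_fun :: "(complex ^ 'n) set \<Rightarrow> (complex ^ 'n \<Rightarrow> complex) \<Rightarrow> bool" where
  "holo_fun S f \<longleftrightarrow> (\<forall>z\<in>S. \<exists>L. (f has_derivative L) (at z) \<and>
                               (\<forall>(c::complex) v. L (c *s v) = c * L v))"

definition holo_map :: "(complex ^ 'n) set \<Rightarrow> (complex ^ 'n \<Rightarrow> complex ^ 'm) \<Rightarrow> bool" where
  "holo_map S F \<longleftrightarrow> (\<forall>i. holo_fun S (\<lambda>z. F z $ i))"

definition ball_aut :: "(complex ^ 'n \<Rightarrow> complex ^ 'n) \<Rightarrow> bool" where
  "ball_aut \<phi> \<longleftrightarrow> bij_betw \<phi> ballN ballN \<and> holo_map ballN \<phi> \<and>
                   holo_map ballN (inv_into ballN \<phi>)"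

definition dcoeff :: "(complex ^ 'n \<Rightarrow> complex) \<Rightarrow> nat ^ 'n \<Rightarrow> complex" where
  "dcoeff f = (SOME c. \<forall>z\<in>ballN. ((\<lambda>\<alpha>. c \<alpha> * mono_pow \<alpha> z) has_sum f z) UNIV)"

text \<open>The Dirichlet space D(B_N); functions are only relevant on B_N.\<close>
definition dir_space :: "(complex ^ 'n \<Rightarrow> complex) set" where
  "dir_space = {f. holo_fun ballN f \<and>
      (\<lambda>\<alpha>. (cmod (dcoeff f \<alpha>))\<^sup>2 * dweight \<alpha>) summable_on UNIV}"

definition dinner :: "(complex ^ 'n \<Rightarrow> complex) \<Rightarrow> (complex ^ 'n \<Rightarrow> complex) \<Rightarrow> complex" where
  "dinner f g = f 0 * cnj (g 0) +
     infsum (\<lambda>\<alpha>. dcoeff f \<alpha> * cnj (dcoeff g \<alpha>) * complex_of_real (dweight \<alpha>)) UNIV"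

definition dnorm :: "(complex ^ 'n \<Rightarrow> complex) \<Rightarrow> real" where
  "dnorm f = sqrt (Re (dinner f f))"

definition comp_op :: "(complex ^ 'n \<Rightarrow> complex ^ 'n) \<Rightarrow> (complex ^ 'n \<Rightarrow> complex) \<Rightarrow> (complex ^ 'n \<Rightarrow> complex)" where
  "comp_op \<phi> f = f \<circ> \<phi>"

definition dadj :: "((complex ^ 'n \<Rightarrow> complex) \<Rightarrow> (complex ^ 'n \<Rightarrow> complex)) \<Rightarrow>
                   (complex ^ 'n \<Rightarrow> complex) \<Rightarrow> (complex ^ 'n \<Rightarrow> complex)" where
  "dadj T = (SOME S. (\<forall>g\<in>dir_space. S g \<in> dir_space) \<and>
                     (\<forall>f\<in>dir_space. \<forall>g\<in>dir_space. dinner (T f) g = dinner f (S g)))"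

definition dcompact :: "((complex ^ 'n \<Rightarrow> complex) \<Rightarrow> (complex ^ 'n \<Rightarrow> complex)) \<Rightarrow> bool" where
  "dcompact T \<longleftrightarrow> (\<forall>f\<in>dir_space. T f \<in> dir_space) \<and>
     (\<forall>u::nat \<Rightarrow> complex ^ 'n \<Rightarrow> complex. (\<forall>n. u n \<in> dir_space) \<longrightarrow> bounded (range (\<lambda>n. dnorm (u n))) \<longrightarrow>
        (\<exists>(r::nat \<Rightarrow> nat) g. strict_mono r \<and> g \<in> dir_space \<and>
               (\<lambda>n. dnorm (T (u (r n)) - g)) \<longlonglongrightarrow> 0))"

end

theory Submission
  imports Defs "HOL-Complex_Analysis.Complex_Analysis"
begin

text \<open>
  The reproducing kernel of the seminorm is \<open>- log (1 - \<langle>z,w\<rangle>)\<close>. Every automorphism is a linear isometry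
  composed with a Moebius involution, so it changes this kernel only by functions of one variable;
  hence composition with an automorphism is unitary modulo constants, and the adjoint of \<open>C\<^sub>\<psi>\<close> differs from
  composition with \<open>\<psi>\<^sup>-\<^sup>1\<close> by an operator of finite rank. The commutator is therefore a finite rank
  perturbation of \<open>C\<^sub>\<sigma> - C\<^sub>\<tau>\<close> with \<open>\<sigma> = \<phi> \<circ> \<psi>\<^sup>-\<^sup>1\<close> and \<open>\<tau> = \<psi>\<^sup>-\<^sup>1 \<circ> \<phi>\<close>, which vanishes if the maps commute.
  Otherwise \<open>\<sigma>\<close> and \<open>\<tau>\<close> differ at some boundary point \<open>\<zeta>\<close>. With \<open>v \<rightarrow> \<zeta>\<close>, the image of the normalised kernel
  at \<open>\<sigma> v\<close> has value at \<open>v\<close> of the order of the norm of the kernel at \<open>v\<close>, because the kernel at \<open>\<sigma> v\<close>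
  stays bounded at \<open>\<tau> v\<close>. A fixed function of the space grows strictly slower than that, so no
  subsequence of the images converges.
\<close>

text \<open>\<open>dcoeff\<close> and \<open>dadj\<close> are picked by \<open>SOME\<close>, and all
  functions are total although only their values on the ball count. Nothing about
  \<open>dcoeff\<close> can be used before every function holomorphic on the ball is known to have
  exactly one monomial expansion there, which is proved by expanding in one variable after another;
  nothing about \<open>dadj\<close> before an explicit adjoint exists, which the kernel then
  determines on the ball. The weight |\<alpha>| \<alpha>! / |\<alpha>|! is the one for which the
  multinomial theorem sums the kernel to the logarithmic series. Boundedness of composition is read
  off from the transformation of the kernel by comparing coefficients twice; no change of variables
  in an integral enters. At the boundary everything rests on equality in Cauchy-Schwarz: unit
  vectors with <x,y> = 1 coincide, so distinct boundary images keep \<open>kern\<close> bounded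
  while \<open>kern w w\<close> blows up. Compactness gives norm convergence to some g, and the
  bound of point evaluation by 1 + sqrt (\<open>kq\<close>) turns this into a clash of growth rates
  at a single point.\<close>

no_notation fps_nth (infixl "$" 75)

subsection \<open>Power series in several variables\<close>

definition vupd :: "'a ^ 'n \<Rightarrow> 'n \<Rightarrow> 'a \<Rightarrow> 'a ^ 'n" where
  "vupd x i y = (\<chi> j. if j = i then y else x $ j)"

lemma vupd_nth [simp]: "vupd x i y $ j = (if j = i then y else x $ j)"
  by (simp add: vupd_def)

lemma vupd_same [simp]: "vupd x i (x $ i) = x"
  by (simp add: vec_eq_iff)

lemma vupd_vupd_same [simp]: "vupd (vupd x i s) i t = vupd x i t"
  by (simp add: vec_eq_iff)

lemma vupd_commute: "i \<noteq> j \<Longrightarrow> vupd (vupd x i s) j t = vupd (vupd x j t) i s"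
  by (simp add: vec_eq_iff)

text \<open>The dimension is a type, so it cannot be induced on. Induction over the number of
  variables runs instead over finite sets of coordinates, with \<open>supp_in I\<close> holding the
  multi-indices of the variables treated so far.\<close>

definition supp_in :: "'n set \<Rightarrow> (nat ^ 'n) set" where
  "supp_in I = {\<alpha>. \<forall>i. i \<notin> I \<longrightarrow> \<alpha> $ i = 0}"

lemma supp_in_empty [simp]: "supp_in {} = {0}"
  by (auto simp: supp_in_def vec_eq_iff)

lemma supp_in_UNIV [simp]: "supp_in UNIV = UNIV"
  by (auto simp: supp_in_def)

text \<open>Splitting off the exponent of the new variable turns a sum over
  \<open>supp_in (insert i I)\<close> into a double sum, which is the induction step of the
  expansion and of its uniqueness.\<close>

lemma bij_betw_supp_insert:
  assumes "i \<notin> I"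
  shows "bij_betw (\<lambda>(\<alpha>, k). vupd \<alpha> i k) (supp_in I \<times> UNIV) (supp_in (insert i I))"
  by (rule bij_betwI[where g = "\<lambda>\<alpha>. (vupd \<alpha> i 0, \<alpha> $ i)"])
     (use assms in \<open>auto simp: supp_in_def vec_eq_iff\<close>)

lemma has_sum_supp_insert:
  assumes "i \<notin> I"
  shows "(F has_sum S) (supp_in (insert i I)) \<longleftrightarrow>
         ((\<lambda>(\<alpha>, k). F (vupd \<alpha> i k)) has_sum S) (supp_in I \<times> UNIV)"
  using has_sum_reindex_bij_betw[OF bij_betw_supp_insert[OF assms], of F S]
  by (simp add: case_prod_unfold)

lemma summable_on_supp_insert:
  assumes "i \<notin> I"
  shows "F summable_on (supp_in (insert i I)) \<longleftrightarrow>
         (\<lambda>(\<alpha>, k). F (vupd \<alpha> i k)) summable_on (supp_in I \<times> UNIV)"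
  using has_sum_supp_insert[OF assms] by (auto simp: summable_on_def)

text \<open>Kept general in \<open>x\<close>: it serves monomials, products of radii and the
  multinomial theorem alike.\<close>

lemma prod_power_vupd:
  fixes x :: "'n::finite \<Rightarrow> 'a::comm_monoid_mult"
  assumes "\<alpha> \<in> supp_in I" "i \<notin> I"
  shows "(\<Prod>j\<in>UNIV. x j ^ (vupd \<alpha> i k $ j)) = (\<Prod>j\<in>UNIV. x j ^ (\<alpha> $ j)) * x i ^ k"
proof -
  have "\<alpha> $ i = 0" using assms by (auto simp: supp_in_def)
  have "(\<Prod>j\<in>UNIV. x j ^ (vupd \<alpha> i k $ j)) = x i ^ k * (\<Prod>j\<in>UNIV - {i}. x j ^ (\<alpha> $ j))"
    by (subst prod.remove[of _ i]) auto
  also have "(\<Prod>j\<in>UNIV - {i}. x j ^ (\<alpha> $ j)) = (\<Prod>j\<in>UNIV. x j ^ (\<alpha> $ j))"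
    by (subst prod.remove[of UNIV i]) (use \<open>\<alpha> $ i = 0\<close> in auto)
  finally show ?thesis by (simp add: mult.commute)
qed

lemma mono_pow_vupd:
  assumes "\<alpha> \<in> supp_in I" "i \<notin> I"
  shows "mono_pow (vupd \<alpha> i k) z = mono_pow \<alpha> z * (z $ i) ^ k"
  unfolding mono_pow_def by (rule prod_power_vupd[OF assms])

lemma norm_mono_pow: "cmod (mono_pow \<alpha> z) = (\<Prod>i\<in>UNIV. cmod (z $ i) ^ (\<alpha> $ i))"
  by (simp add: mono_pow_def norm_power prod_norm flip: prod_norm)

lemma mono_pow_0_left [simp]: "mono_pow 0 z = 1"
  by (simp add: mono_pow_def)

lemma mono_pow_zero_right: "mono_pow \<alpha> 0 = (if \<alpha> = 0 then 1 else 0)"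
  by (auto simp: mono_pow_def vec_eq_iff)

lemma summable_geometric_supp:
  fixes x :: "'n::finite \<Rightarrow> real"
  assumes "\<And>i. 0 \<le> x i" "\<And>i. x i < 1" "finite I"
  shows "(\<lambda>\<alpha>. \<Prod>i\<in>UNIV. x i ^ (\<alpha> $ i)) summable_on (supp_in I)"
  using assms(3)
proof (induction I rule: finite_induct)
  case empty
  then show ?case by simp
next
  case (insert i I)
  have "(\<lambda>(\<alpha>,k). (\<Prod>j\<in>UNIV. x j ^ (\<alpha> $ j)) * x i ^ k) summable_on (supp_in I \<times> UNIV)"
  proof (rule summable_on_SigmaI)
    have g: "(\<lambda>k. x i ^ k) summable_on UNIV"
      using assms(1,2)[of i] by (intro norm_summable_imp_summable_on) (auto intro!: summable_geometric)
    show "((\<lambda>k. case (\<alpha>, k) of (\<alpha>,k) \<Rightarrow> (\<Prod>j\<in>UNIV. x j ^ (\<alpha> $ j)) * x i ^ k) has_sum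
           (\<Prod>j\<in>UNIV. x j ^ (\<alpha> $ j)) * (\<Sum>\<^sub>\<infinity>k. x i ^ k)) UNIV" for \<alpha>
      using g by (auto intro!: has_sum_cmult_right)
    show "(\<lambda>\<alpha>. (\<Prod>j\<in>UNIV. x j ^ (\<alpha> $ j)) * (\<Sum>\<^sub>\<infinity>k. x i ^ k)) summable_on supp_in I"
      using insert.IH by (rule summable_on_cmult_left)
  qed (use assms in \<open>auto intro!: mult_nonneg_nonneg prod_nonneg\<close>)
  then show ?case
    unfolding summable_on_supp_insert[OF insert.hyps(2)]
    by (rule summable_on_cong[THEN iffD1, rotated]) 
       (use prod_power_vupd[OF _ insert.hyps(2), of _ x] in auto)
qed

lemma summable_geometric_multi:
  fixes x :: "'n::finite \<Rightarrow> real"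
  assumes "\<And>i. 0 \<le> x i" "\<And>i. x i < 1"
  shows "(\<lambda>\<alpha>. \<Prod>i\<in>UNIV. x i ^ (\<alpha> $ i)) summable_on UNIV"
  using summable_geometric_supp[of x UNIV] assms by simp

text \<open>The Cauchy inequality wants continuity up to the circle, which is available only for
  radii r < R; the bound at R follows by letting r tend to R from below.\<close>

lemma taylor_coeff_bound:
  assumes "h holomorphic_on ball 0 R" "\<And>t. t \<in> ball 0 R \<Longrightarrow> cmod (h t) \<le> M" "R > 0"
  shows "cmod ((deriv ^^ k) h 0 / fact k) * R ^ k \<le> M"
proof (rule tendsto_upperbound)
  let ?a = "cmod ((deriv ^^ k) h 0 / fact k)"
  show "((\<lambda>r. ?a * r ^ k) \<longlongrightarrow> ?a * R ^ k) (at_left R)"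
    by (intro tendsto_intros)
  have "eventually (\<lambda>r. r \<in> {0<..<R}) (at_left R)"
    using assms(3) by (rule eventually_at_left_real)
  then show "\<forall>\<^sub>F r in at_left R. ?a * r ^ k \<le> M"
  proof eventually_elim
    case (elim r)
    have "norm ((deriv ^^ k) h 0) \<le> (fact k) * M / r ^ k"
    proof (rule Cauchy_inequality)
      show "h holomorphic_on ball 0 r"
        using assms(1) elim by (auto elim!: holomorphic_on_subset)
      have "h holomorphic_on cball 0 r"
        using assms(1) elim by (auto elim!: holomorphic_on_subset)
      then show "continuous_on (cball 0 r) h" by (rule holomorphic_on_imp_continuous_on)
    qed (use elim assms(2) in auto)
    then show ?case using elim by (simp add: norm_divide field_simps)
  qed
qed auto

text \<open>Termwise Cauchy estimates leave a geometric tail with ratio \<open>cmod t / R\<close>;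
  its sum costs the factor 2 because that ratio is at most 1/2.\<close>

lemma taylor_remainder_bound:
  assumes h: "h holomorphic_on ball 0 R" and M: "\<And>t. t \<in> ball 0 R \<Longrightarrow> cmod (h t) \<le> M" and R: "R > 0"
    and t: "cmod t \<le> R / 2"
  shows "cmod (h t - (\<Sum>m<k. (deriv ^^ m) h 0 / fact m * t ^ m)) \<le> 2 * M * (cmod t / R) ^ k"
proof -
  define a where "a m = (deriv ^^ m) h 0 / fact m" for m
  define x where "x = cmod t / R"
  have x: "0 \<le> x" "x \<le> 1/2" using t R by (auto simp: x_def field_simps)
  have ts: "(\<lambda>m. a m * t ^ m) sums h t"
    using holomorphic_power_series[OF h, of t] t R by (simp add: a_def)
  have b: "cmod (a m * t ^ m) \<le> M * x ^ m" for m
  proof -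
    have "cmod (a m * t ^ m) = (cmod (a m) * R ^ m) * x ^ m"
      using R by (simp add: x_def norm_mult norm_power power_divide)
    also have "\<dots> \<le> M * x ^ m"
      using taylor_coeff_bound[OF h M R, of m] x by (intro mult_right_mono) (auto simp: a_def)
    finally show ?thesis .
  qed
  have tail: "(\<lambda>m. a (m + k) * t ^ (m + k)) sums (h t - (\<Sum>m<k. a m * t ^ m))"
    using sums_iff_shift'[of "\<lambda>m. a m * t ^ m" k] ts by (simp add: sums_iff_shift)
  have gs: "(\<lambda>m. M * x ^ (m + k)) sums (M * x ^ k * (1 / (1 - x)))"
    using sums_mult[OF geometric_sums[of x], of "M * x ^ k"] x by (simp add: power_add mult_ac)
  have "cmod (h t - (\<Sum>m<k. a m * t ^ m)) \<le> M * x ^ k * (1 / (1 - x))"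
    using norm_suminf_le[OF b[of "_ + k"] sums_summable[OF gs]] tail gs
    by (simp add: sums_iff)
  also have "\<dots> \<le> M * x ^ k * 2"
  proof (intro mult_left_mono)
    show "1 / (1 - x) \<le> 2" using x by (simp add: field_simps)
    have "0 \<le> M" using M[of 0] R norm_ge_zero[of "h 0"] by (simp del: norm_ge_zero)
    then show "0 \<le> M * x ^ k" using x by auto
  qed
  finally show ?thesis by (simp add: a_def x_def mult_ac)
qed

section \<open>Separately holomorphic functions on polydiscs\<close>

definition polyd :: "('n \<Rightarrow> real) \<Rightarrow> (complex ^ 'n) set" where
  "polyd R = {z. \<forall>i. cmod (z $ i) < R i}"

lemma polyd_radius_pos: "z \<in> polyd R \<Longrightarrow> R i > 0"
  unfolding polyd_def using le_less_trans[OF norm_ge_zero] by blast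

text \<open>The uniform bound M makes Taylor remainders in one variable uniform in the others, so
  that the class is stable under taking coefficients.\<close>

definition sep_holo :: "('n \<Rightarrow> real) \<Rightarrow> real \<Rightarrow> (complex ^ 'n \<Rightarrow> complex) \<Rightarrow> bool" where
  "sep_holo R M f \<longleftrightarrow> (\<forall>z\<in>polyd R. cmod (f z) \<le> M \<and>
      (\<forall>i. (\<lambda>t. f (vupd z i t)) holomorphic_on ball 0 (R i)))"

text \<open>The Taylor coefficient stays a function of the whole vector, though constant in
  coordinate i, so that further variables can be expanded without changing the type.\<close>

definition coeff_in :: "'n \<Rightarrow> nat \<Rightarrow> (complex ^ 'n \<Rightarrow> complex) \<Rightarrow> complex ^ 'n \<Rightarrow> complex" where
  "coeff_in i k f z = (deriv ^^ k) (\<lambda>t. f (vupd z i t)) 0 / fact k"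

lemma coeff_in_vupd [simp]: "coeff_in i k f (vupd z i t) = coeff_in i k f z"
  by (simp add: coeff_in_def)

lemma vupd_in_polyd: "z \<in> polyd R \<Longrightarrow> cmod t < R i \<Longrightarrow> vupd z i t \<in> polyd R"
  by (auto simp: polyd_def)

lemma sep_holo_coeff_in_bound:
  assumes "sep_holo R M f" "z \<in> polyd R"
  shows "cmod (coeff_in i k f z) * R i ^ k \<le> M"
  unfolding coeff_in_def
proof (rule taylor_coeff_bound)
  show "R i > 0" using assms(2) by (rule polyd_radius_pos)
  show "cmod (f (vupd z i t)) \<le> M" if "t \<in> ball 0 (R i)" for t
    using assms vupd_in_polyd[OF assms(2), of t i] that by (auto simp: sep_holo_def)
qed (use assms in \<open>auto simp: sep_holo_def\<close>)

lemma sep_holo_coeff_in_sums: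
  assumes "sep_holo R M f" "z \<in> polyd R"
  shows "(\<lambda>k. coeff_in i k f z * (z $ i) ^ k) sums f z"
proof -
  have "(\<lambda>k. (deriv ^^ k) (\<lambda>t. f (vupd z i t)) 0 / fact k * (z $ i - 0) ^ k) sums f (vupd z i (z $ i))"
    by (rule holomorphic_power_series[where r = "R i"]) (use assms in \<open>auto simp: sep_holo_def polyd_def\<close>)
  then show ?thesis by (simp add: coeff_in_def)
qed

text \<open>Holomorphy in a remaining variable: the Cauchy estimate bounds the Taylor remainder uniformly, so
  the coefficient is a uniform limit of quotients that are holomorphic by the induction hypothesis.\<close>

lemma sep_holo_coeff_in:
  assumes f: "sep_holo R M f"
  shows "sep_holo R (M / R i ^ k) (coeff_in i k f)"
proof (induction k rule: less_induct)
  case (less k)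
  show ?case unfolding sep_holo_def
  proof (intro ballI conjI allI)
    fix z assume z: "z \<in> polyd R"
    have Rpos: "R j > 0" for j
      using z by (rule polyd_radius_pos)
    show "cmod (coeff_in i k f z) \<le> M / R i ^ k"
      using sep_holo_coeff_in_bound[OF f z, of i k] Rpos[of i] by (simp add: field_simps)
    fix j
    show "(\<lambda>s. coeff_in i k f (vupd z j s)) holomorphic_on ball 0 (R j)"
    proof (cases "j = i")
      case True
      then show ?thesis by simp
    next
      case False
      \<comment> \<open>A positive null sequence; it stays below R i / 2 because the remainder
        estimate holds only there.\<close>
      define t where "t n = R i / 2 / of_nat (Suc n)" for n :: nat
      have t: "t n > 0" "t n \<le> R i / 2" for n
        using Rpos[of i] by (auto simp: t_def field_simps)
      define q where "q n s = (f (vupd (vupd z j s) i (of_real (t n))) -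
          (\<Sum>m<k. coeff_in i m f (vupd z j s) * of_real (t n) ^ m)) / of_real (t n) ^ k" for n s
      have zj: "vupd z j s \<in> polyd R" if "s \<in> ball 0 (R j)" for s
        using vupd_in_polyd[OF z] that by auto
      \<comment> \<open>The remainder after k + 1 terms is of order t^(k+1); division by t^k leaves
        one factor \<open>t n\<close>.\<close>
      have est: "cmod (q n s - coeff_in i k f (vupd z j s)) \<le> 2 * M / R i ^ Suc k * t n"
        if "s \<in> ball 0 (R j)" for n s
      proof -
        let ?T = "complex_of_real (t n)" and ?z = "vupd z j s"
        have "cmod (f (vupd ?z i ?T) - (\<Sum>m<Suc k. coeff_in i m f ?z * ?T ^ m)) \<le> 2 * M * (cmod ?T / R i) ^ Suc k"
          unfolding coeff_in_def
        proof (rule taylor_remainder_bound)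
          show "cmod (f (vupd ?z i u)) \<le> M" if "u \<in> ball 0 (R i)" for u
            using f vupd_in_polyd[OF zj[OF \<open>s \<in> _\<close>], of u i] that by (auto simp: sep_holo_def)
        qed (use f zj[OF that] Rpos t[of n] in \<open>auto simp: sep_holo_def\<close>)
        moreover have "q n s - coeff_in i k f ?z = (f (vupd ?z i ?T) - (\<Sum>m<Suc k. coeff_in i m f ?z * ?T ^ m)) / ?T ^ k"
          using t(1)[of n] by (simp add: q_def field_simps)
        ultimately have "cmod (q n s - coeff_in i k f ?z) \<le> 2 * M * (cmod ?T / R i) ^ Suc k / t n ^ k"
          using t(1)[of n] less_imp_le[OF t(1)[of n]] by (auto simp only: norm_divide norm_power norm_of_real abs_of_pos intro!: divide_right_mono zero_le_power)
        also have "\<dots> = 2 * M / R i ^ Suc k * t n"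
          using t(1)[of n] Rpos[of i] by (simp add: field_simps)
        finally show ?thesis .
      qed
      have lim0: "(\<lambda>n. 2 * M / R i ^ Suc k * t n) \<longlonglongrightarrow> 0"
      proof -
        have "(\<lambda>n. 2 * M / R i ^ Suc k * (R i / 2 * inverse (real (Suc n)))) \<longlonglongrightarrow> 2 * M / R i ^ Suc k * (R i / 2 * 0)"
          by (intro tendsto_mult tendsto_const LIMSEQ_inverse_real_of_nat)
        moreover have "t n = R i / 2 * inverse (real (Suc n))" for n by (simp only: t_def divide_inverse)
        ultimately show ?thesis by (simp only: mult_zero_right)
      qed
      have ul: "uniform_limit (ball 0 (R j)) q (\<lambda>s. coeff_in i k f (vupd z j s)) sequentially"
      proof (rule uniform_limitI)
        fix e :: real assume "e > 0"
        from lim0 this have "\<forall>\<^sub>F n in sequentially. 2 * M / R i ^ Suc k * t n < e"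
          by (rule order_tendstoD)
        then show "\<forall>\<^sub>F n in sequentially. \<forall>s\<in>ball 0 (R j). dist (q n s) (coeff_in i k f (vupd z j s)) < e"
          unfolding dist_norm by eventually_elim (blast intro: le_less_trans est)
      qed
      show ?thesis
      proof (rule holomorphic_uniform_sequence)
        show "q n holomorphic_on ball 0 (R j)" for n
        proof -
          have "vupd z i (of_real (t n)) \<in> polyd R"
            using vupd_in_polyd[OF z, of "of_real (t n)" i] t[of n] Rpos[of i] by auto
          then have "(\<lambda>s. f (vupd (vupd z i (of_real (t n))) j s)) holomorphic_on ball 0 (R j)"
            using f by (auto simp: sep_holo_def)
          moreover have "(\<lambda>s. coeff_in i m f (vupd z j s)) holomorphic_on ball 0 (R j)" if "m < k" for m
            using less.IH[OF that] z by (auto simp: sep_holo_def)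
          ultimately show ?thesis
            unfolding q_def vupd_commute[OF False] using t(1)[of n]
            by (intro holomorphic_intros) auto
        qed
        show "\<exists>d>0. cball x d \<subseteq> ball 0 (R j) \<and> uniform_limit (cball x d) q (\<lambda>s. coeff_in i k f (vupd z j s)) sequentially"
          if "x \<in> ball 0 (R j)" for x
          using open_contains_cball[of "ball (0::complex) (R j)"] that uniform_limit_on_subset[OF ul] by (meson open_ball)
      qed auto
    qed
  qed
qed

text \<open>After expansion in the variables of I the coefficients still depend on the others.
  Carrying their bound and their independence of the variables of I through the induction allows the
  next variable to be expanded.\<close>

lemma sep_holo_expand_supp:
  fixes f :: "complex ^ 'n \<Rightarrow> complex"
  assumes f: "sep_holo R M f" and "finite I"
  shows "\<exists>c. (\<forall>\<alpha>\<in>supp_in I. sep_holo R (M / (\<Prod>i\<in>UNIV. R i ^ (\<alpha> $ i))) (c \<alpha>) \<and>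
                 (\<forall>z i t. i \<in> I \<longrightarrow> c \<alpha> (vupd z i t) = c \<alpha> z)) \<and>
             (\<forall>z\<in>polyd R. ((\<lambda>\<alpha>. c \<alpha> z * mono_pow \<alpha> z) has_sum f z) (supp_in I))"
  using assms(2)
proof (induction I rule: finite_induct)
  case empty
  show ?case
    by (rule exI[of _ "\<lambda>_. f"]) (use f in \<open>auto simp: has_sum_finite_iff\<close>)
next
  case (insert i I)
  then obtain c where
    c1: "\<And>\<alpha>. \<alpha> \<in> supp_in I \<Longrightarrow> sep_holo R (M / (\<Prod>i\<in>UNIV. R i ^ (\<alpha> $ i))) (c \<alpha>)" and
    c2: "\<And>\<alpha> z i t. \<alpha> \<in> supp_in I \<Longrightarrow> i \<in> I \<Longrightarrow> c \<alpha> (vupd z i t) = c \<alpha> z" and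
    c3: "\<And>z. z \<in> polyd R \<Longrightarrow> ((\<lambda>\<alpha>. c \<alpha> z * mono_pow \<alpha> z) has_sum f z) (supp_in I)"
    by blast
  \<comment> \<open>The exponents outside i select the old coefficient function, the exponent of i
    selects its Taylor coefficient.\<close>
  define c' where "c' \<alpha> = coeff_in i (\<alpha> $ i) (c (vupd \<alpha> i 0))" for \<alpha>
  have c': "c' (vupd \<alpha> i k) = coeff_in i k (c \<alpha>)" if "\<alpha> \<in> supp_in I" for \<alpha> k
  proof -
    have "\<alpha> $ i = 0" using that insert.hyps by (auto simp: supp_in_def)
    then have "vupd \<alpha> i 0 = \<alpha>" by (metis vupd_same)
    then show ?thesis by (simp add: c'_def)
  qed
  have ex: "\<exists>\<beta> k. \<beta> \<in> supp_in I \<and> \<alpha> = vupd \<beta> i k" if "\<alpha> \<in> supp_in (insert i I)" for \<alpha>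
  proof -
    have "\<alpha> \<in> (\<lambda>(\<beta>, k). vupd \<beta> i k) ` (supp_in I \<times> UNIV)"
      using bij_betw_supp_insert[OF insert.hyps(2)] that unfolding bij_betw_def by metis
    then show ?thesis by auto
  qed
  show ?case
  proof (intro exI[of _ c'] conjI ballI allI impI)
    fix \<alpha> assume "\<alpha> \<in> supp_in (insert i I)"
    then obtain \<beta> k where \<beta>: "\<beta> \<in> supp_in I" "\<alpha> = vupd \<beta> i k" using ex by blast
    show "sep_holo R (M / (\<Prod>i\<in>UNIV. R i ^ (\<alpha> $ i))) (c' \<alpha>)"
      using sep_holo_coeff_in[OF c1[OF \<beta>(1)], of i k]
      unfolding \<beta>(2) c'[OF \<beta>(1)] prod_power_vupd[OF \<beta>(1) insert.hyps(2)]
      by (simp add: field_simps)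
    fix z j t assume j: "j \<in> insert i I"
    show "c' \<alpha> (vupd z j t) = c' \<alpha> z"
    proof (cases "j = i")
      case True
      then show ?thesis unfolding \<beta>(2) c'[OF \<beta>(1)] by simp
    next
      case False
      then show ?thesis unfolding \<beta>(2) c'[OF \<beta>(1)] coeff_in_def vupd_commute[OF False]
        using c2[OF \<beta>(1)] j by simp
    qed
  next
    fix z assume z: "z \<in> polyd R"
    have Rpos: "R j > 0" for j
      using z by (rule polyd_radius_pos)
    have bnd: "cmod (c' \<alpha> z * mono_pow \<alpha> z) \<le> M * (\<Prod>j\<in>UNIV. (cmod (z $ j) / R j) ^ (\<alpha> $ j))"
      if \<alpha>: "\<alpha> \<in> supp_in (insert i I)" for \<alpha>
    proof -
      obtain \<beta> k where \<beta>: "\<beta> \<in> supp_in I" "\<alpha> = vupd \<beta> i k" using ex[OF \<alpha>] by blast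
      have "cmod (c' \<alpha> z) \<le> M / (\<Prod>j\<in>UNIV. R j ^ (\<alpha> $ j))"
        using sep_holo_coeff_in[OF c1[OF \<beta>(1)], of i k] z
        unfolding \<beta>(2) c'[OF \<beta>(1)] prod_power_vupd[OF \<beta>(1) insert.hyps(2)]
        by (simp add: sep_holo_def field_simps)
      then have "cmod (c' \<alpha> z * mono_pow \<alpha> z) \<le> M / (\<Prod>j\<in>UNIV. R j ^ (\<alpha> $ j)) * (\<Prod>j\<in>UNIV. cmod (z $ j) ^ (\<alpha> $ j))"
        unfolding norm_mult norm_mono_pow by (intro mult_right_mono prod_nonneg) auto
      then show ?thesis by (simp add: prod_dividef power_divide)
    qed
    have "(\<lambda>\<alpha>. M * (\<Prod>j\<in>UNIV. (cmod (z $ j) / R j) ^ (\<alpha> $ j))) summable_on supp_in (insert i I)"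
      using insert.hyps(1) z Rpos
      by (intro summable_on_cmult_right summable_geometric_supp) (auto simp: polyd_def less_imp_le)
    from Infinite_Sum.abs_summable_on_comparison_test'[OF this bnd]
    have "(\<lambda>\<alpha>. c' \<alpha> z * mono_pow \<alpha> z) summable_on supp_in (insert i I)"
      by (rule abs_summable_summable)
    then have sm: "(\<lambda>(\<alpha>,k). c' (vupd \<alpha> i k) z * mono_pow (vupd \<alpha> i k) z) summable_on supp_in I \<times> UNIV"
      unfolding summable_on_supp_insert[OF insert.hyps(2)] .
    show "((\<lambda>\<alpha>. c' \<alpha> z * mono_pow \<alpha> z) has_sum f z) (supp_in (insert i I))"
      unfolding has_sum_supp_insert[OF insert.hyps(2)]
    proof (rule has_sum_SigmaI[OF _ c3[OF z] sm])
      fix \<alpha> assume \<alpha>: "\<alpha> \<in> supp_in I"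
      \<comment> \<open>A convergent series need not be an unordered sum; summability of the row is
        inherited from the double family, and only then do the two values agree.\<close>
      have "(\<lambda>k. c' (vupd \<alpha> i k) z * mono_pow (vupd \<alpha> i k) z) summable_on UNIV"
        using summable_on_SigmaD1[OF sm \<alpha>] by simp
      moreover have "(\<lambda>k. c' (vupd \<alpha> i k) z * mono_pow (vupd \<alpha> i k) z) sums (c \<alpha> z * mono_pow \<alpha> z)"
        using sums_mult2[OF sep_holo_coeff_in_sums[OF c1[OF \<alpha>] z, of i], of "mono_pow \<alpha> z"]
        unfolding c'[OF \<alpha>] mono_pow_vupd[OF \<alpha> insert.hyps(2)] by (simp add: mult_ac)
      ultimately have "((\<lambda>k. c' (vupd \<alpha> i k) z * mono_pow (vupd \<alpha> i k) z) has_sum c \<alpha> z * mono_pow \<alpha> z) UNIV"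
        by (metis (lifting) has_sum_imp_sums[OF has_sum_infsum] has_sum_infsum sums_unique2)
      then show "((\<lambda>k. case (\<alpha>, k) of (\<alpha>, k) \<Rightarrow> c' (vupd \<alpha> i k) z * mono_pow (vupd \<alpha> i k) z) has_sum c \<alpha> z * mono_pow \<alpha> z) UNIV"
        by simp
    qed
  qed
qed

lemma vec_invariant_const:
  fixes g :: "'a::zero ^ 'n::finite \<Rightarrow> 'b"
  assumes "\<And>z i t. g (vupd z i t) = g z"
  shows "g z = g 0"
proof -
  have "g (\<chi> j. if j \<in> J then 0 else z $ j) = g z" if "finite J" for J :: "'n set"
    using that
  proof (induction J)
    case empty
    then show ?case by simp
  next
    case (insert i J)
    have "(\<chi> j. if j \<in> insert i J then 0 else z $ j) = vupd (\<chi> j. if j \<in> J then 0 else z $ j) i 0"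
      by (auto simp: vec_eq_iff)
    then show ?case unfolding insert.IH[symmetric] by (simp only: assms)
  qed
  from this[of UNIV] have "g (\<chi> j. 0) = g z" by simp
  then show ?thesis by (simp only: zero_vec_def)
qed

lemma sep_holo_expand:
  fixes f :: "complex ^ 'n \<Rightarrow> complex"
  assumes f: "sep_holo R M f" and R: "\<And>i. R i > 0"
  shows "\<exists>c. (\<forall>\<alpha>. cmod (c \<alpha>) * (\<Prod>i\<in>UNIV. R i ^ (\<alpha> $ i)) \<le> M) \<and>
    (\<forall>z\<in>polyd R. ((\<lambda>\<alpha>. c \<alpha> * mono_pow \<alpha> z) has_sum f z) UNIV)"
proof -
  obtain c where c: "\<forall>\<alpha>. sep_holo R (M / (\<Prod>i\<in>UNIV. R i ^ (\<alpha> $ i))) (c \<alpha>) \<and> (\<forall>z i t. c \<alpha> (vupd z i t) = c \<alpha> z)"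
    "\<forall>z\<in>polyd R. ((\<lambda>\<alpha>. c \<alpha> z * mono_pow \<alpha> z) has_sum f z) UNIV"
    using sep_holo_expand_supp[OF f finite[of UNIV]] by auto
  have c0: "c \<alpha> z = c \<alpha> 0" for \<alpha> z
    by (rule vec_invariant_const) (use c(1) in blast)
  have 0: "0 \<in> polyd R" using R by (auto simp: polyd_def)
  have "cmod (c \<alpha> 0) * (\<Prod>i\<in>UNIV. R i ^ (\<alpha> $ i)) \<le> M" for \<alpha>
  proof -
    have "(\<Prod>i\<in>UNIV. R i ^ (\<alpha> $ i)) > 0" by (intro prod_pos) (use R in auto)
    moreover have "cmod (c \<alpha> 0) \<le> M / (\<Prod>i\<in>UNIV. R i ^ (\<alpha> $ i))"
      using c(1) 0 unfolding sep_holo_def by blast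
    ultimately show ?thesis by (simp add: field_simps)
  qed
  moreover have "((\<lambda>\<alpha>. c \<alpha> 0 * mono_pow \<alpha> z) has_sum f z) UNIV" if "z \<in> polyd R" for z
    using c(2) that by (subst c0[symmetric, of _ z]) blast
  ultimately show ?thesis by (intro exI[of _ "\<lambda>\<alpha>. c \<alpha> 0"]) blast
qed

section \<open>Uniqueness of monomial expansions\<close>

lemma norm_le_sum_nth: "norm (z :: 'a::real_normed_vector ^ 'n::finite) \<le> (\<Sum>i\<in>UNIV. norm (z $ i))"
  unfolding norm_vec_def by (rule L2_set_le_sum) simp

text \<open>A non-zero coefficient of positive index would make the zero function non-zero on a
  punctured disc; index 0 is read off at t = 0.\<close>

lemma powser_zero_coeff:
  fixes g :: "nat \<Rightarrow> complex"
  assumes "\<delta> > 0" and s: "\<And>t. cmod t < \<delta> \<Longrightarrow> (\<lambda>k. g k * t ^ k) sums 0"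
  shows "g k = 0"
proof (rule ccontr)
  assume nz: "g k \<noteq> 0"
  show False
  proof (cases "k = 0")
    case True
    have "(\<lambda>k. g k * 0 ^ k) sums g 0" by (rule powser_sums_zero)
    with s[of 0] assms(1) nz True show False by (auto dest: sums_unique2)
  next
    case False
    obtain r where "0 < r" and r: "\<And>z::complex. z \<in> cball 0 r - {0} \<Longrightarrow> (0::complex) \<noteq> 0"
      by (rule powser_0_nonzero[of \<delta> 0 g "\<lambda>_. 0" k]) (use assms nz False in auto)
    from r[of "of_real r"] \<open>0 < r\<close> show False by simp
  qed
qed

text \<open>Grouped by the exponent of the new variable t, the sum becomes a power series in t that
  vanishes near 0, so each of its coefficients is 0; these are series in the remaining variables,
  covered by the induction hypothesis.\<close>

lemma mono_series_unique_supp: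
  fixes c :: "nat ^ 'n::finite \<Rightarrow> complex"
  assumes "finite I" "\<delta> > 0"
    and "\<And>z. (\<And>i. cmod (z $ i) < \<delta>) \<Longrightarrow> ((\<lambda>\<alpha>. c \<alpha> * mono_pow \<alpha> z) has_sum 0) (supp_in I)"
    and "\<alpha> \<in> supp_in I"
  shows "c \<alpha> = 0"
  using assms(1,3,4)
proof (induction I arbitrary: c \<alpha> rule: finite_induct)
  case empty
  from empty.prems(1)[of 0] empty.prems(2) \<open>\<delta> > 0\<close> show ?case by (simp add: has_sum_finite_iff)
next
  case (insert i I)
  have "\<alpha> \<in> (\<lambda>(\<beta>, k). vupd \<beta> i k) ` (supp_in I \<times> UNIV)"
    using bij_betw_supp_insert[OF insert.hyps(2)] insert.prems(2) unfolding bij_betw_def by metis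
  then obtain \<beta> k where \<beta>: "\<beta> \<in> supp_in I" "\<alpha> = vupd \<beta> i k" by auto
  have "c (vupd \<beta> i k) = 0"
  proof (rule insert.IH[OF _ \<beta>(1), of "\<lambda>\<beta>. c (vupd \<beta> i k)"])
    fix z :: "complex ^ 'n" assume z: "\<And>j. cmod (z $ j) < \<delta>"
    define F where "F t \<beta> k = c (vupd \<beta> i k) * mono_pow \<beta> z * t ^ k" for t \<beta> k
    have F: "((\<lambda>(k,\<beta>). F t \<beta> k) has_sum 0) (UNIV \<times> supp_in I)" if "cmod t < \<delta>" for t
    proof -
      have "((\<lambda>\<alpha>. c \<alpha> * mono_pow \<alpha> (vupd z i t)) has_sum 0) (supp_in (insert i I))"
        by (rule insert.prems) (use z that in auto)
      then have "((\<lambda>(\<beta>,k). c (vupd \<beta> i k) * mono_pow (vupd \<beta> i k) (vupd z i t)) has_sum 0) (supp_in I \<times> UNIV)"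
        unfolding has_sum_supp_insert[OF insert.hyps(2)] .
      also have "?this \<longleftrightarrow> ((\<lambda>(\<beta>,k). F t \<beta> k) has_sum 0) (supp_in I \<times> UNIV)"
      proof (rule has_sum_cong, clarify)
        fix \<gamma> k assume \<gamma>: "\<gamma> \<in> supp_in I"
        then have "\<gamma> $ i = 0" using insert.hyps by (auto simp: supp_in_def)
        then have "mono_pow \<gamma> (vupd z i t) = mono_pow \<gamma> z"
          unfolding mono_pow_def by (intro prod.cong) auto
        then show "c (vupd \<gamma> i k) * mono_pow (vupd \<gamma> i k) (vupd z i t) = F t \<gamma> k"
          using mono_pow_vupd[OF \<gamma> insert.hyps(2)] by (simp add: F_def)
      qed
      finally show ?thesis by (subst (asm) has_sum_swap) (simp add: case_prod_unfold)
    qed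
    define g where "g k = (\<Sum>\<^sub>\<infinity>\<beta>\<in>supp_in I. c (vupd \<beta> i k) * mono_pow \<beta> z)" for k
    have g: "((\<lambda>\<beta>. c (vupd \<beta> i k) * mono_pow \<beta> z) has_sum g k) (supp_in I)" for k
    proof -
      \<comment> \<open>For one fixed non-zero t, dividing a row of the summable double family by
        t^k makes the row of coefficients summable.\<close>
      let ?t = "complex_of_real (\<delta> / 2)"
      have "(\<lambda>(k,\<beta>). F ?t \<beta> k) summable_on (UNIV \<times> supp_in I)"
        using F[of ?t] \<open>\<delta> > 0\<close> by (auto simp: summable_on_def simp flip: of_real_divide)
      from summable_on_SigmaD1[OF this, of k] have "(\<lambda>\<beta>. F ?t \<beta> k) summable_on supp_in I" by simp
      then have "(\<lambda>\<beta>. F ?t \<beta> k / ?t ^ k) summable_on supp_in I"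
        unfolding divide_inverse by (rule summable_on_cmult_left)
      then have "(\<lambda>\<beta>. c (vupd \<beta> i k) * mono_pow \<beta> z) summable_on supp_in I"
        using \<open>\<delta> > 0\<close> by (simp add: F_def)
      then show ?thesis unfolding g_def by (rule has_sum_infsum)
    qed
    have "g k = 0"
    proof (rule powser_zero_coeff[OF \<open>\<delta> > 0\<close>])
      fix t assume t: "cmod t < \<delta>"
      have "((\<lambda>k. g k * t ^ k) has_sum 0) UNIV"
        by (rule has_sum_SigmaD[OF F[OF t]]) (use g in \<open>auto simp: F_def intro!: has_sum_cmult_left\<close>)
      then show "(\<lambda>k. g k * t ^ k) sums 0" by (rule has_sum_imp_sums)
    qed
    then show "((\<lambda>\<beta>. c (vupd \<beta> i k) * mono_pow \<beta> z) has_sum 0) (supp_in I)"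
      using g[of k] by simp
  qed
  then show ?case by (simp add: \<beta>(2))
qed

lemma mono_series_unique:
  fixes c d :: "nat ^ 'n::finite \<Rightarrow> complex"
  assumes "\<delta> > 0"
    and c: "\<And>z. norm z < \<delta> \<Longrightarrow> ((\<lambda>\<alpha>. c \<alpha> * mono_pow \<alpha> z) has_sum f z) UNIV"
    and d: "\<And>z. norm z < \<delta> \<Longrightarrow> ((\<lambda>\<alpha>. d \<alpha> * mono_pow \<alpha> z) has_sum f z) UNIV"
  shows "c = d"
proof
  fix \<alpha>
  \<comment> \<open>The polydisc of this radius lies in the ball of radius \<delta>, the norm being
    at most the sum of the moduli of the coordinates.\<close>
  let ?\<epsilon> = "\<delta> / real CARD('n)"
  have "c \<alpha> - d \<alpha> = 0"
  proof (rule mono_series_unique_supp[of UNIV ?\<epsilon>])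
    fix z :: "complex ^ 'n" assume z: "\<And>i. cmod (z $ i) < ?\<epsilon>"
    have "norm z \<le> (\<Sum>i\<in>UNIV. cmod (z $ i))" by (rule norm_le_sum_nth)
    also have "\<dots> < (\<Sum>i\<in>(UNIV::'n set). ?\<epsilon>)" by (rule sum_strict_mono) (use z in auto)
    finally have "norm z < \<delta>" by simp
    then show "((\<lambda>\<alpha>. (c \<alpha> - d \<alpha>) * mono_pow \<alpha> z) has_sum 0) (supp_in UNIV)"
      using has_sum_add[OF c[of z] has_sum_uminusI[OF d[of z]]] by (auto simp: algebra_simps)
  qed (use assms(1) in auto)
  then show "c \<alpha> = d \<alpha>" by simp
qed

subsection \<open>Holomorphic functions on the ball\<close>

text \<open>Complex homogeneity of the derivative turns differentiability along a complex line into
  a complex derivative, which opens the way to one-variable theory.\<close>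

lemma holo_fun_slice:
  assumes "holo_fun S f" "open T" "\<And>t. t \<in> T \<Longrightarrow> z + t *s v \<in> S"
  shows "(\<lambda>t. f (z + t *s v)) holomorphic_on T"
  unfolding holomorphic_on_def
proof
  fix t assume t: "t \<in> T"
  then obtain L where L: "(f has_derivative L) (at (z + t *s v))" "\<And>c v. L (c *s v) = c * L v"
    using assms unfolding holo_fun_def by blast
  have bl: "bounded_linear (\<lambda>t. t *s v)"
    by (rule linear_conv_bounded_linear[THEN iffD1]) (auto intro!: linearI simp: vec_eq_iff algebra_simps)
  have "((\<lambda>t. z + t *s v) has_derivative (\<lambda>t. t *s v)) (at t)"
    using bounded_linear_imp_has_derivative[OF bl] by (auto intro!: derivative_eq_intros)
  from has_derivative_compose[OF this L(1)]
  have "((\<lambda>t. f (z + t *s v)) has_field_derivative L v) (at t)"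
    by (simp add: L(2) has_field_derivative_def mult_commute_abs)
  then show "(\<lambda>t. f (z + t *s v)) field_differentiable at t within T"
    using field_differentiable_at_within field_differentiable_def by blast
qed

lemma holo_fun_continuous_on: "holo_fun S f \<Longrightarrow> continuous_on S f"
  unfolding holo_fun_def
  by (meson continuous_at_imp_continuous_on has_derivative_continuous)

lemma holo_fun_sep_holo:
  assumes f: "holo_fun ballN f" and r: "norm (\<chi> i. R i) \<le> r" "r < 1" and R: "\<And>i. R i > 0"
    and M: "\<And>z. norm z \<le> r \<Longrightarrow> cmod (f z) \<le> M"
  shows "sep_holo R M f"
proof -
  have le: "norm z \<le> r" if "z \<in> polyd R" for z
  proof -
    have "norm z \<le> norm (\<chi> i. R i)"
      by (rule norm_le_componentwise_cart) (use that R in \<open>auto simp: polyd_def less_imp_le abs_of_pos\<close>)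
    with r show ?thesis by simp
  qed
  show ?thesis unfolding sep_holo_def
  proof (intro ballI conjI allI)
    fix z i assume z: "z \<in> polyd R"
    show "cmod (f z) \<le> M" using M le z by blast
    have eq: "vupd z i t = vupd z i 0 + t *s axis i 1" for t :: complex
      by (auto simp: vec_eq_iff axis_def)
    have "(\<lambda>t. f (vupd z i 0 + t *s axis i 1)) holomorphic_on ball 0 (R i)"
    proof (rule holo_fun_slice[OF f])
      fix t :: complex assume "t \<in> ball 0 (R i)"
      then have "norm (vupd z i t) \<le> r" using le vupd_in_polyd[OF z, of t i] by auto
      then show "vupd z i 0 + t *s axis i 1 \<in> ballN" using r by (simp flip: eq)
    qed auto
    then show "(\<lambda>t. f (vupd z i t)) holomorphic_on ball 0 (R i)" by (simp only: eq[symmetric])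
  qed
qed

lemma holo_fun_bounded_cball:
  assumes "holo_fun ballN f" "r < 1"
  obtains M where "\<And>z. norm z \<le> r \<Longrightarrow> cmod (f z) \<le> M"
proof -
  have "continuous_on (cball 0 r) f"
    by (rule continuous_on_subset[OF holo_fun_continuous_on[OF assms(1)]]) (use assms(2) in auto)
  then have "bounded (f ` cball 0 r)"
    by (intro compact_imp_bounded compact_continuous_image) auto
  then obtain M where "\<forall>x\<in>f ` cball 0 r. cmod x \<le> M" by (auto simp: bounded_iff)
  then show ?thesis by (intro that[of M]) auto
qed

lemma small_polyradius:
  obtains \<rho> where "\<rho> > 0" "norm (\<chi> (i::'n::finite). (\<rho>::real)) \<le> 1/2"
proof
  show "1 / (2 * real CARD('n)) > 0" by simp
  have "norm (\<chi> (i::'n). 1 / (2 * real CARD('n))) \<le> (\<Sum>i\<in>(UNIV::'n set). 1 / (2 * real CARD('n)))"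
    by (rule order_trans[OF norm_le_l1_cart]) simp
  then show "norm (\<chi> (i::'n). 1 / (2 * real CARD('n))) \<le> 1/2" by simp
qed

text \<open>Every point of the ball lies in a polydisc inside the ball, and the expansions on two
  polydiscs agree near 0, hence have the same coefficients. Those of one small polydisc therefore
  serve the whole ball.\<close>

lemma holo_fun_expand:
  fixes f :: "complex ^ 'n \<Rightarrow> complex"
  assumes f: "holo_fun ballN f"
  shows "\<exists>c. \<forall>z\<in>ballN. ((\<lambda>\<alpha>. c \<alpha> * mono_pow \<alpha> z) has_sum f z) UNIV"
proof -
  have ex: "\<exists>c. \<forall>z\<in>polyd R. ((\<lambda>\<alpha>. c \<alpha> * mono_pow \<alpha> z) has_sum f z) UNIV"
    if R: "norm (\<chi> i. R i) < 1" "\<And>i. R i > 0" for R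
  proof -
    obtain M where "\<And>z. norm z \<le> norm (\<chi> i. R i) \<Longrightarrow> cmod (f z) \<le> M"
      by (rule holo_fun_bounded_cball[OF f R(1)]) blast
    then have "sep_holo R M f" using holo_fun_sep_holo[OF f order_refl R(1)] R by blast
    then show ?thesis using sep_holo_expand[of R M f] R(2) by blast
  qed
  obtain \<rho> :: real where \<rho>: "\<rho> > 0" "norm (\<chi> (i::'n). \<rho>) \<le> 1/2" by (rule small_polyradius)
  then obtain c where c: "\<And>z. z \<in> polyd (\<lambda>_. \<rho>) \<Longrightarrow> ((\<lambda>\<alpha>. c \<alpha> * mono_pow \<alpha> z) has_sum f z) UNIV"
    using ex[of "\<lambda>_. \<rho>"] by auto
  show ?thesis
  proof (intro exI[of _ c] ballI)
    fix z :: "complex ^ 'n" assume z: "z \<in> ballN"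
    \<comment> \<open>Enlarging every coordinate by this amount raises the norm by at most half the
      distance to the sphere.\<close>
    define \<epsilon> where "\<epsilon> = (1 - norm z) / (2 * real CARD('n))"
    have \<epsilon>: "\<epsilon> > 0" using z by (simp add: \<epsilon>_def)
    define R where "R i = cmod (z $ i) + \<epsilon>" for i
    have "norm (\<chi> i. R i) \<le> norm (\<chi> i. cmod (z $ i)) + norm (\<chi> (i::'n). \<epsilon>)"
      unfolding R_def by (rule order_trans[OF _ norm_triangle_ineq]) (simp add: plus_vec_def)
    also have "norm (\<chi> i. cmod (z $ i)) = norm z" by (simp add: norm_vec_def)
    also have "norm (\<chi> (i::'n). \<epsilon>) \<le> (\<Sum>i\<in>(UNIV::'n set). \<epsilon>)"
      by (rule order_trans[OF norm_le_l1_cart]) (use \<epsilon> in simp)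
    also have "\<dots> = (1 - norm z) / 2" by (simp add: \<epsilon>_def)
    finally have "norm (\<chi> i. R i) < 1" using z by (simp add: field_simps)
    moreover have "R i > 0" for i using \<epsilon> by (auto simp: R_def add_nonneg_pos)
    ultimately obtain d where d: "\<And>z. z \<in> polyd R \<Longrightarrow> ((\<lambda>\<alpha>. d \<alpha> * mono_pow \<alpha> z) has_sum f z) UNIV"
      using ex by blast
    have "c = d"
    proof (rule mono_series_unique[of "min \<rho> \<epsilon>"])
      fix w :: "complex ^ 'n" assume w: "norm w < min \<rho> \<epsilon>"
      have lt: "cmod (w $ i) < min \<rho> \<epsilon>" for i using Finite_Cartesian_Product.norm_nth_le[of w i] w by linarith
      have "w \<in> polyd R"
        unfolding polyd_def R_def
      proof (intro CollectI allI)
        fix i show "cmod (w $ i) < cmod (z $ i) + \<epsilon>" using lt[of i] norm_ge_zero[of "z $ i"] by linarith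
      qed
      then show "((\<lambda>\<alpha>. d \<alpha> * mono_pow \<alpha> w) has_sum f w) UNIV" by (rule d)
      show "((\<lambda>\<alpha>. c \<alpha> * mono_pow \<alpha> w) has_sum f w) UNIV" using lt by (intro c) (auto simp: polyd_def)
    qed (use \<rho> \<epsilon> in auto)
    moreover have "z \<in> polyd R" using \<epsilon> by (auto simp: polyd_def R_def)
    ultimately show "((\<lambda>\<alpha>. c \<alpha> * mono_pow \<alpha> z) has_sum f z) UNIV" using d by blast
  qed
qed

lemma dcoeff_has_sum:
  assumes "holo_fun ballN f" "z \<in> ballN"
  shows "((\<lambda>\<alpha>. dcoeff f \<alpha> * mono_pow \<alpha> z) has_sum f z) UNIV"
  using someI_ex[OF holo_fun_expand[OF assms(1)]] assms(2) unfolding dcoeff_def by blast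

text \<open>Convergence near 0 is enough, which matters later when double series can be interchanged
  only there.\<close>

lemma dcoeff_unique:
  assumes "holo_fun ballN f" "\<delta> > 0"
    and "\<And>z. z \<in> ballN \<Longrightarrow> norm z < \<delta> \<Longrightarrow> ((\<lambda>\<alpha>. c \<alpha> * mono_pow \<alpha> z) has_sum f z) UNIV"
  shows "dcoeff f = c"
  by (rule mono_series_unique[of "min \<delta> 1"]) (use assms dcoeff_has_sum[OF assms(1)] in auto)

lemma dcoeff_cong:
  assumes "\<And>z. z \<in> ballN \<Longrightarrow> f z = g z"
  shows "dcoeff f = dcoeff g"
  unfolding dcoeff_def using assms by (metis (no_types, lifting))

lemma dcoeff_bound:
  fixes f :: "complex ^ 'n \<Rightarrow> complex"
  assumes f: "holo_fun ballN f" and r: "norm (\<chi> i. R i) \<le> r" "r < 1" and R: "\<And>i. R i > 0"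
    and M: "\<And>z. norm z \<le> r \<Longrightarrow> cmod (f z) \<le> M"
  shows "cmod (dcoeff f \<alpha>) * (\<Prod>i\<in>UNIV. R i ^ (\<alpha> $ i)) \<le> M"
proof -
  obtain c where c: "\<And>\<alpha>. cmod (c \<alpha>) * (\<Prod>i\<in>UNIV. R i ^ (\<alpha> $ i)) \<le> M"
    "\<And>z. z \<in> polyd R \<Longrightarrow> ((\<lambda>\<alpha>. c \<alpha> * mono_pow \<alpha> z) has_sum f z) UNIV"
    using sep_holo_expand[OF holo_fun_sep_holo[OF assms] R] by blast
  have fR: "Min (range R) > 0" using R by simp
  have "dcoeff f = c"
  proof (rule dcoeff_unique[OF f fR])
    fix z :: "complex ^ 'n" assume z: "norm z < Min (range R)"
    have "cmod (z $ i) < R i" for i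
      using Finite_Cartesian_Product.norm_nth_le[of z i] z Min_le[of "range R" "R i"] by (auto intro: le_less_trans)
    then show "((\<lambda>\<alpha>. c \<alpha> * mono_pow \<alpha> z) has_sum f z) UNIV" by (intro c) (auto simp: polyd_def)
  qed
  with c(1) show ?thesis by simp
qed

subsection \<open>Closure properties of holomorphic functions\<close>

lemma holo_funI:
  assumes "\<And>z. z \<in> S \<Longrightarrow> (f has_derivative L z) (at z)" "\<And>z c v. z \<in> S \<Longrightarrow> L z (c *s v) = c * L z v"
  shows "holo_fun S f"
  using assms unfolding holo_fun_def by blast

lemma holo_funE:
  assumes "holo_fun S f"
  obtains L where "\<And>z. z \<in> S \<Longrightarrow> (f has_derivative L z) (at z)"
    "\<And>z c v. z \<in> S \<Longrightarrow> L z (c *s v) = c * L z v"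
  using assms unfolding holo_fun_def by metis

lemma holo_fun_const [simp]: "holo_fun S (\<lambda>z. c)"
  by (rule holo_funI[where L = "\<lambda>_ _. 0"]) auto

lemma holo_fun_add:
  assumes "holo_fun S f" "holo_fun S g"
  shows "holo_fun S (\<lambda>z. f z + g z)"
proof -
  obtain L where L: "\<And>z. z \<in> S \<Longrightarrow> (f has_derivative L z) (at z)" "\<And>z c v. z \<in> S \<Longrightarrow> L z (c *s v) = c * L z v"
    using assms(1) by (rule holo_funE) blast
  obtain K where K: "\<And>z. z \<in> S \<Longrightarrow> (g has_derivative K z) (at z)" "\<And>z c v. z \<in> S \<Longrightarrow> K z (c *s v) = c * K z v"
    using assms(2) by (rule holo_funE) blast
  show ?thesis
    by (rule holo_funI[where L = "\<lambda>z v. L z v + K z v"]) (rule has_derivative_add[OF L(1) K(1)], auto simp: L(2) K(2) algebra_simps)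
qed

lemma holo_fun_mult:
  assumes "holo_fun S f" "holo_fun S g"
  shows "holo_fun S (\<lambda>z. f z * g z)"
proof -
  obtain L where L: "\<And>z. z \<in> S \<Longrightarrow> (f has_derivative L z) (at z)" "\<And>z c v. z \<in> S \<Longrightarrow> L z (c *s v) = c * L z v"
    using assms(1) by (rule holo_funE) blast
  obtain K where K: "\<And>z. z \<in> S \<Longrightarrow> (g has_derivative K z) (at z)" "\<And>z c v. z \<in> S \<Longrightarrow> K z (c *s v) = c * K z v"
    using assms(2) by (rule holo_funE) blast
  show ?thesis
    by (rule holo_funI[where L = "\<lambda>z v. f z * K z v + L z v * g z"])
       (rule has_derivative_mult[OF L(1) K(1)], auto simp: L(2) K(2) algebra_simps)
qed

lemma holo_fun_uminus: "holo_fun S f \<Longrightarrow> holo_fun S (\<lambda>z. - f z)"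
  using holo_fun_mult[OF holo_fun_const[of S "-1"], of f] by simp

lemma holo_fun_diff: "holo_fun S f \<Longrightarrow> holo_fun S g \<Longrightarrow> holo_fun S (\<lambda>z. f z - g z)"
  using holo_fun_add[OF _ holo_fun_uminus, of S f g] by simp

lemma holo_fun_comp_field:
  assumes "holo_fun S f" "\<And>z. z \<in> S \<Longrightarrow> g field_differentiable at (f z)"
  shows "holo_fun S (\<lambda>z. g (f z))"
proof -
  obtain L where L: "\<And>z. z \<in> S \<Longrightarrow> (f has_derivative L z) (at z)" "\<And>z c v. z \<in> S \<Longrightarrow> L z (c *s v) = c * L z v"
    using assms(1) by (rule holo_funE) blast
  obtain d where d: "\<And>z. z \<in> S \<Longrightarrow> (g has_field_derivative d z) (at (f z))"
    using assms(2) unfolding field_differentiable_def by metis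
  show ?thesis
  proof (rule holo_funI[where L = "\<lambda>z v. d z * L z v"])
    fix z assume z: "z \<in> S"
    show "((\<lambda>z. g (f z)) has_derivative (\<lambda>v. d z * L z v)) (at z)"
      using has_derivative_compose[OF L(1)[OF z], of g "(*) (d z)"] d[OF z] by (simp add: has_field_derivative_def)
  qed (simp add: L(2))
qed

lemma holo_fun_prod:
  assumes "finite A" "\<And>i. i \<in> A \<Longrightarrow> holo_fun S (f i)"
  shows "holo_fun S (\<lambda>z. \<Prod>i\<in>A. f i z)"
  using assms by (induction A rule: finite_induct) (auto intro!: holo_fun_mult)

lemma holo_fun_sum:
  assumes "finite A" "\<And>i. i \<in> A \<Longrightarrow> holo_fun S (f i)"
  shows "holo_fun S (\<lambda>z. \<Sum>i\<in>A. f i z)"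
  using assms by (induction A rule: finite_induct) (auto intro!: holo_fun_add)

lemma holo_fun_power: "holo_fun S f \<Longrightarrow> holo_fun S (\<lambda>z. f z ^ k)"
  by (induction k) (auto intro!: holo_fun_mult)

lemma holo_fun_nth: "holo_fun S (\<lambda>z. z $ i)"
  by (rule holo_funI[where L = "\<lambda>_ v. v $ i"])
     (auto intro!: bounded_linear_imp_has_derivative bounded_linear_vec_nth)

text \<open>\<open>holo_map\<close> speaks of components, so their derivatives are first assembled
  into one derivative of \<phi> before the chain rule applies.\<close>

lemma holo_fun_compose:
  fixes \<phi> :: "complex ^ 'n \<Rightarrow> complex ^ 'm"
  assumes "holo_map S \<phi>" "\<And>z. z \<in> S \<Longrightarrow> \<phi> z \<in> T" "holo_fun T f"
  shows "holo_fun S (\<lambda>z. f (\<phi> z))"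
proof -
  obtain L where L: "\<And>z. z \<in> T \<Longrightarrow> (f has_derivative L z) (at z)" "\<And>z c v. z \<in> T \<Longrightarrow> L z (c *s v) = c * L z v"
    using assms(3) by (rule holo_funE) blast
  have "\<forall>i. \<exists>K. \<forall>z\<in>S. ((\<lambda>z. \<phi> z $ i) has_derivative K z) (at z) \<and> (\<forall>c v. K z (c *s v) = c * K z v)"
    using assms(1) unfolding holo_map_def holo_fun_def by metis
  then obtain K where K: "\<And>z i. z \<in> S \<Longrightarrow> ((\<lambda>z. \<phi> z $ i) has_derivative K i z) (at z)"
    "\<And>z i c v. z \<in> S \<Longrightarrow> K i z (c *s v) = c * K i z v" by metis
  define D where "D z v = (\<chi> i. K i z v)" for z v
  have axis_sum: "(\<Sum>i\<in>UNIV. axis i (w $ i)) = w" for w :: "complex ^ 'm"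
    by (simp add: vec_eq_iff axis_def)
  have bl: "bounded_linear (\<lambda>c::complex. axis i c :: complex ^ 'm)" for i
    by (rule linear_conv_bounded_linear[THEN iffD1]) (auto intro!: linearI simp: vec_eq_iff axis_def)
  have D: "(\<phi> has_derivative D z) (at z)" if "z \<in> S" for z
  proof -
    have "((\<lambda>z. \<Sum>i\<in>UNIV. axis i (\<phi> z $ i)) has_derivative (\<lambda>v. \<Sum>i\<in>UNIV. axis i (D z v $ i))) (at z)"
      unfolding D_def vec_lambda_beta
      by (intro has_derivative_sum bounded_linear.has_derivative[OF bl] K that)
    then show ?thesis by (simp add: axis_sum)
  qed
  show ?thesis
  proof (rule holo_funI[where L = "\<lambda>z v. L (\<phi> z) (D z v)"])
    fix z assume z: "z \<in> S"
    show "((\<lambda>z. f (\<phi> z)) has_derivative (\<lambda>v. L (\<phi> z) (D z v))) (at z)"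
      by (rule has_derivative_compose[OF D[OF z] L(1)[OF assms(2)[OF z]]])
    fix c v
    have "D z (c *s v) = c *s D z v" by (simp add: D_def K(2)[OF z] vec_eq_iff)
    then show "L (\<phi> z) (D z (c *s v)) = c * L (\<phi> z) (D z v)" using L(2) assms(2)[OF z] by simp
  qed
qed

lemma holo_fun_mono_pow: "holo_fun S (mono_pow \<alpha>)"
  unfolding mono_pow_def[abs_def] by (intro holo_fun_prod holo_fun_power holo_fun_nth) simp

subsection \<open>The Hermitian inner product\<close>

definition cinner :: "complex ^ 'n \<Rightarrow> complex ^ 'n \<Rightarrow> complex" where
  "cinner z w = (\<Sum>i\<in>UNIV. z $ i * cnj (w $ i))"

lemma cinner_add_left: "cinner (x + y) w = cinner x w + cinner y w"
  and cinner_diff_left: "cinner (x - y) w = cinner x w - cinner y w"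
  and cinner_scale_left [simp]: "cinner (c *s x) w = c * cinner x w"
  and cinner_add_right: "cinner w (x + y) = cinner w x + cinner w y"
  and cinner_diff_right: "cinner w (x - y) = cinner w x - cinner w y"
  and cinner_scale_right [simp]: "cinner w (c *s x) = cnj c * cinner w x"
  by (simp_all add: cinner_def algebra_simps sum.distrib sum_subtractf sum_distrib_left)

lemma cinner_zero [simp]: "cinner 0 w = 0" "cinner w 0 = 0"
  by (simp_all add: cinner_def)

lemma cnj_cinner: "cnj (cinner z w) = cinner w z"
  by (simp add: cinner_def mult.commute)

lemma cinner_self: "cinner z z = of_real ((norm z)\<^sup>2)"
  by (simp add: cinner_def norm_vec_def L2_set_def sum_nonneg complex_norm_square flip: of_real_power)

lemma cinner_abs_le: "(\<Sum>i\<in>UNIV. cmod (z $ i) * cmod (w $ i)) \<le> norm z * norm w"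
  using L2_set_mult_ineq[of "\<lambda>i. cmod (z $ i)" "\<lambda>i. cmod (w $ i)" UNIV] by (simp add: norm_vec_def)

lemma norm_cinner_le: "cmod (cinner z w) \<le> norm z * norm w"
proof -
  have "cmod (cinner z w) \<le> (\<Sum>i\<in>UNIV. cmod (z $ i * cnj (w $ i)))" unfolding cinner_def by (rule norm_sum)
  also have "\<dots> \<le> norm z * norm w" using cinner_abs_le[of z w] by (simp add: norm_mult)
  finally show ?thesis .
qed

lemma norm_cinner_less_1:
  assumes "norm z < 1" "norm w \<le> 1" shows "cmod (cinner z w) < 1"
proof -
  have "norm z * norm w \<le> norm z * 1" using assms by (intro mult_left_mono) auto
  with norm_cinner_le[of z w] assms show ?thesis by linarith
qed

lemma holo_fun_cinner: "holo_fun S (\<lambda>z. cinner z w)"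
  unfolding cinner_def by (intro holo_fun_sum holo_fun_mult holo_fun_nth holo_fun_const) simp

subsection \<open>The multinomial theorem\<close>

lemma mi_abs_0 [simp]: "mi_abs 0 = 0" and mi_fact_0 [simp]: "mi_fact 0 = 1"
  by (simp_all add: mi_abs_def mi_fact_def)

lemma mi_abs_eq_0_iff [simp]: "mi_abs \<alpha> = 0 \<longleftrightarrow> \<alpha> = 0"
  by (auto simp: mi_abs_def vec_eq_iff)

lemma mi_fact_pos: "mi_fact \<alpha> > 0"
  unfolding mi_fact_def by (intro prod_pos) auto

lemma finite_mi_abs: "finite {\<alpha> :: nat ^ 'n::finite. mi_abs \<alpha> = k}"
proof -
  have "inj_on vec_nth {\<alpha> :: nat ^ 'n. mi_abs \<alpha> = k}" by (rule inj_onI) (simp only: vec_nth_inject)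
  moreover have "vec_nth ` {\<alpha> :: nat ^ 'n. mi_abs \<alpha> = k} \<subseteq> PiE UNIV (\<lambda>_. {..k})"
    by (auto simp: mi_abs_def intro: member_le_sum)
  then have "finite (vec_nth ` {\<alpha> :: nat ^ 'n. mi_abs \<alpha> = k})"
    by (rule finite_subset) (auto intro: finite_PiE)
  ultimately show ?thesis by (rule finite_imageD[rotated])
qed

lemma mi_abs_vupd:
  assumes "\<beta> \<in> supp_in I" "i \<notin> I" shows "mi_abs (vupd \<beta> i m) = mi_abs \<beta> + m"
proof -
  have "\<beta> $ i = 0" using assms by (auto simp: supp_in_def)
  then have "(\<Sum>j\<in>UNIV - {i}. \<beta> $ j) = mi_abs \<beta>"
    unfolding mi_abs_def by (subst (2) sum.remove[of _ i]) auto
  moreover have "mi_abs (vupd \<beta> i m) = m + (\<Sum>j\<in>UNIV - {i}. \<beta> $ j)"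
    unfolding mi_abs_def by (subst sum.remove[of _ i]) auto
  ultimately show ?thesis by simp
qed

lemma mi_fact_vupd:
  assumes "\<beta> \<in> supp_in I" "i \<notin> I" shows "mi_fact (vupd \<beta> i m) = mi_fact \<beta> * fact m"
proof -
  have "\<beta> $ i = 0" using assms by (auto simp: supp_in_def)
  then have "(\<Prod>j\<in>UNIV - {i}. fact (\<beta> $ j)) = mi_fact \<beta>"
    unfolding mi_fact_def by (subst (2) prod.remove[of _ i]) auto
  moreover have "mi_fact (vupd \<beta> i m) = fact m * (\<Prod>j\<in>UNIV - {i}. fact (\<beta> $ j))"
    unfolding mi_fact_def by (subst prod.remove[of _ i]) auto
  ultimately show ?thesis by simp
qed

text \<open>Induction over the variables: the binomial theorem splits off \<open>x i\<close>, whose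
  power m becomes the new exponent. The field is arbitrary because the real case bounds
  \<open>efun\<close> and the complex case sums the kernel.\<close>

lemma multinomial_supp:
  fixes x :: "'n::finite \<Rightarrow> 'a::real_normed_field"
  assumes "finite I"
  shows "(\<Sum>i\<in>I. x i) ^ k = (\<Sum>\<alpha> | \<alpha> \<in> supp_in I \<and> mi_abs \<alpha> = k.
            of_real (fact k / mi_fact \<alpha>) * (\<Prod>i\<in>UNIV. x i ^ (\<alpha> $ i)))"
  using assms
proof (induction I arbitrary: k rule: finite_induct)
  case empty
  have "{\<alpha> :: nat ^ 'n. \<alpha> = 0 \<and> mi_abs \<alpha> = k} = (if k = 0 then {0} else {})" by auto
  then show ?case by (simp add: power_0_left)
next
  case (insert i I)
  define T where "T \<alpha> = of_real (fact k / mi_fact \<alpha>) * (\<Prod>i\<in>UNIV. x i ^ (\<alpha> $ i))" for \<alpha>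
  have fin: "finite {\<beta> \<in> supp_in I. mi_abs \<beta> = m}" for m
    by (rule finite_subset[OF _ finite_mi_abs[of m]]) auto
  have "(\<Sum>i\<in>insert i I. x i) ^ k = (x i + (\<Sum>i\<in>I. x i)) ^ k" using insert.hyps by simp
  also have "\<dots> = (\<Sum>m\<le>k. of_nat (k choose m) * x i ^ m * (\<Sum>i\<in>I. x i) ^ (k - m))"
    by (rule binomial_ring)
  also have "\<dots> = (\<Sum>m\<le>k. \<Sum>\<beta> | \<beta> \<in> supp_in I \<and> mi_abs \<beta> = k - m. T (vupd \<beta> i m))"
  proof (rule sum.cong[OF refl])
    fix m assume m: "m \<in> {..k}"
    have "of_nat (k choose m) * x i ^ m * (of_real (fact (k - m) / mi_fact \<beta>) * (\<Prod>i\<in>UNIV. x i ^ (\<beta> $ i))) = T (vupd \<beta> i m)"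
      if "\<beta> \<in> supp_in I" for \<beta>
    proof -
      have "real (k choose m) * (fact (k - m) / mi_fact \<beta>) = fact k / (mi_fact \<beta> * fact m)"
        using m binomial_fact[of m k, where 'a = real] mi_fact_pos[of \<beta>] by (simp add: field_simps)
      then have "of_nat (k choose m) * of_real (fact (k - m) / mi_fact \<beta>) = (of_real (fact k / (mi_fact \<beta> * fact m)) :: 'a)"
        by (metis of_real_mult of_real_of_nat_eq)
      moreover have "of_nat (k choose m) * x i ^ m * (of_real (fact (k - m) / mi_fact \<beta>) * (\<Prod>i\<in>UNIV. x i ^ (\<beta> $ i)))
        = (of_nat (k choose m) * of_real (fact (k - m) / mi_fact \<beta>)) * ((\<Prod>i\<in>UNIV. x i ^ (\<beta> $ i)) * x i ^ m)"
        by (simp only: mult_ac)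
      ultimately show ?thesis
        unfolding T_def mi_fact_vupd[OF that insert.hyps(2)] prod_power_vupd[OF that insert.hyps(2)] by simp
    qed
    then show "of_nat (k choose m) * x i ^ m * (\<Sum>i\<in>I. x i) ^ (k - m) =
        (\<Sum>\<beta> | \<beta> \<in> supp_in I \<and> mi_abs \<beta> = k - m. T (vupd \<beta> i m))"
      unfolding insert.IH sum_distrib_left by (intro sum.cong refl) blast
  qed
  also have "\<dots> = (\<Sum>(m,\<beta>)\<in>Sigma {..k} (\<lambda>m. {\<beta> \<in> supp_in I. mi_abs \<beta> = k - m}). T (vupd \<beta> i m))"
    by (rule sum.Sigma) (use fin in auto)
  also have "\<dots> = (\<Sum>\<alpha> | \<alpha> \<in> supp_in (insert i I) \<and> mi_abs \<alpha> = k. T \<alpha>)"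
  proof (rule sum.reindex_bij_witness[where j = "\<lambda>(m,\<beta>). vupd \<beta> i m" and i = "\<lambda>\<alpha>. (\<alpha> $ i, vupd \<alpha> i 0)"])
    fix a assume "a \<in> Sigma {..k} (\<lambda>m. {\<beta> \<in> supp_in I. mi_abs \<beta> = k - m})"
    then obtain m \<beta> where a: "a = (m, \<beta>)" "m \<le> k" "\<beta> \<in> supp_in I" "mi_abs \<beta> = k - m" by auto
    have "\<beta> $ i = 0" using a insert.hyps by (auto simp: supp_in_def)
    then show "(\<lambda>\<alpha>. (\<alpha> $ i, vupd \<alpha> i 0)) ((\<lambda>(m,\<beta>). vupd \<beta> i m) a) = a"
      using a vupd_same[of \<beta> i] by simp
    show "(\<lambda>(m,\<beta>). vupd \<beta> i m) a \<in> {\<alpha> \<in> supp_in (insert i I). mi_abs \<alpha> = k}"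
      using a mi_abs_vupd[OF a(3) insert.hyps(2)] by (auto simp: supp_in_def)
  next
    fix \<alpha> assume \<alpha>: "\<alpha> \<in> {\<alpha> \<in> supp_in (insert i I). mi_abs \<alpha> = k}"
    have s: "vupd \<alpha> i 0 \<in> supp_in I" using \<alpha> by (auto simp: supp_in_def)
    have "mi_abs \<alpha> = mi_abs (vupd \<alpha> i 0) + \<alpha> $ i"
      using mi_abs_vupd[OF s insert.hyps(2), of "\<alpha> $ i"] by simp
    then show "(\<alpha> $ i, vupd \<alpha> i 0) \<in> Sigma {..k} (\<lambda>m. {\<beta> \<in> supp_in I. mi_abs \<beta> = k - m})"
      using \<alpha> s by auto
  qed auto
  finally show ?case unfolding T_def .
qed

lemma multinomial:
  fixes x :: "'n::finite \<Rightarrow> 'a::real_normed_field"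
  shows "(\<Sum>i\<in>UNIV. x i) ^ k = (\<Sum>\<alpha> | mi_abs \<alpha> = k. of_real (fact k / mi_fact \<alpha>) * (\<Prod>i\<in>UNIV. x i ^ (\<alpha> $ i)))"
  using multinomial_supp[of UNIV x k] by simp

subsection \<open>Normalised monomials and the kernel\<close>

lemma dweight_0 [simp]: "dweight 0 = 0"
  by (simp add: dweight_def)

lemma dweight_pos: "\<alpha> \<noteq> 0 \<Longrightarrow> dweight \<alpha> > 0"
  using mi_fact_pos[of \<alpha>] mi_abs_eq_0_iff[of \<alpha>] unfolding dweight_def by (simp del: mi_abs_eq_0_iff)

lemma dweight_nonneg: "dweight \<alpha> \<ge> 0"
  using dweight_pos[of \<alpha>] by (cases "\<alpha> = 0") auto

text \<open>The normalised monomials are orthonormal for the seminorm. Since \<open>dweight 0 = 0\<close> and division by zero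
  yields zero, the constant monomial is sent to \<open>0\<close>, so sums over all multi-indices silently skip constants.\<close>

definition efun :: "nat ^ 'n \<Rightarrow> complex ^ 'n \<Rightarrow> complex" where
  "efun \<alpha> z = mono_pow \<alpha> z / of_real (sqrt (dweight \<alpha>))"

lemma efun_0 [simp]: "efun 0 z = 0"
  by (simp add: efun_def)

lemma efun_zero_right [simp]: "efun \<alpha> 0 = 0"
  by (cases "\<alpha> = 0") (auto simp: efun_def mono_pow_zero_right)

lemma holo_fun_efun: "holo_fun S (efun \<alpha>)"
  unfolding efun_def[abs_def] divide_inverse by (intro holo_fun_mult holo_fun_mono_pow holo_fun_const)

text \<open>Up to the factor 1 / |\<alpha>| these are the terms of the multinomial expansion of
  <z,w>^|\<alpha>|. At \<alpha> = 0 both sides are 0 through division by zero.\<close>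

lemma efun_mult_cnj: 
  "efun \<alpha> z * cnj (efun \<alpha> w) = of_real (fact (mi_abs \<alpha>) / mi_fact \<alpha>) * (\<Prod>i\<in>UNIV. (z $ i * cnj (w $ i)) ^ (\<alpha> $ i)) / of_nat (mi_abs \<alpha>)"
proof -
  have "complex_of_real (sqrt (dweight \<alpha>)) * of_real (sqrt (dweight \<alpha>)) = of_real (dweight \<alpha>)"
    by (metis dweight_nonneg of_real_mult real_sqrt_mult_self abs_of_nonneg)
  then have "efun \<alpha> z * cnj (efun \<alpha> w) = mono_pow \<alpha> z * cnj (mono_pow \<alpha> w) / of_real (dweight \<alpha>)"
    by (simp add: efun_def)
  also have "mono_pow \<alpha> z * cnj (mono_pow \<alpha> w) = (\<Prod>i\<in>UNIV. (z $ i * cnj (w $ i)) ^ (\<alpha> $ i))"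
    by (simp add: mono_pow_def power_mult_distrib prod.distrib)
  finally show ?thesis by (simp add: dweight_def mult_ac)
qed

lemma prod_const_power: "(\<Prod>i\<in>UNIV. (r::'a::comm_monoid_mult) ^ (\<alpha> $ i)) = r ^ mi_abs \<alpha>"
  by (simp add: mi_abs_def power_sum)

text \<open>With k = |\<alpha>|, the squared modulus is a single non-negative term of the
  multinomial expansion of |z|^(2k), divided by k \<ge> 1.\<close>

lemma norm_efun_le: "cmod (efun \<alpha> z) \<le> norm z ^ mi_abs \<alpha>"
proof (cases "\<alpha> = 0")
  case False
  let ?k = "mi_abs \<alpha>"
  let ?t = "\<lambda>\<alpha>. (fact ?k / mi_fact \<alpha>) * (\<Prod>i\<in>UNIV. ((cmod (z $ i))\<^sup>2) ^ (\<alpha> $ i))"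
  have k: "real ?k \<ge> 1" using False mi_abs_eq_0_iff[of \<alpha>] by (simp add: Suc_le_eq del: mi_abs_eq_0_iff)
  have t0: "?t \<beta> \<ge> 0" for \<beta>
    using mi_fact_pos[of \<beta>] by (intro mult_nonneg_nonneg prod_nonneg) auto
  have "of_real ((cmod (efun \<alpha> z))\<^sup>2) = efun \<alpha> z * cnj (efun \<alpha> z)" by (rule complex_norm_square)
  also have "\<dots> = of_real (?t \<alpha> / real ?k)"
    by (subst efun_mult_cnj) (simp add: flip: complex_norm_square)
  finally have "(cmod (efun \<alpha> z))\<^sup>2 = ?t \<alpha> / real ?k" by (simp only: of_real_eq_iff)
  also have "\<dots> \<le> ?t \<alpha> / 1" using k t0[of \<alpha>] by (intro divide_left_mono) auto
  also have "\<dots> \<le> (\<Sum>\<beta> | mi_abs \<beta> = ?k. ?t \<beta>)"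
    unfolding div_by_1 by (rule member_le_sum) (use t0 finite_mi_abs in auto)
  also have "\<dots> = (\<Sum>i\<in>UNIV. (cmod (z $ i))\<^sup>2) ^ ?k" using multinomial[of "\<lambda>i. (cmod (z $ i))\<^sup>2" ?k] by simp
  also have "\<dots> = ((norm z)\<^sup>2) ^ ?k" by (simp add: norm_vec_def L2_set_def sum_nonneg)
  also have "\<dots> = (norm z ^ ?k)\<^sup>2" by (simp add: power_mult[symmetric] mult.commute)
  finally show ?thesis by (rule power2_le_imp_le) auto
qed auto

lemma norm_efun_le_1: "norm z \<le> 1 \<Longrightarrow> cmod (efun \<alpha> z) \<le> 1"
  using norm_efun_le[of \<alpha> z] power_le_one[of "norm z" "mi_abs \<alpha>"] by simp

lemma summable_power_mi_abs:
  assumes "0 \<le> r" "r < (1::real)"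
  shows "(\<lambda>\<alpha> :: nat ^ 'n::finite. r ^ mi_abs \<alpha>) summable_on UNIV"
  using summable_geometric_multi[of "\<lambda>_. r"] assms by (simp add: prod_const_power)

definition kern :: "complex ^ 'n \<Rightarrow> complex ^ 'n \<Rightarrow> complex" where
  "kern z w = - Ln (1 - cinner z w)"

text \<open>Degree by degree, the multinomial theorem turns the terms of degree k into <z,w>^k / k,
  and these add up to the logarithmic series. Degree 0 contributes 0 on both sides.\<close>

lemma kern_has_sum:
  fixes z w :: "complex ^ 'n"
  assumes z: "norm z < 1" and w: "norm w < 1"
  shows "((\<lambda>\<alpha>. efun \<alpha> z * cnj (efun \<alpha> w)) has_sum kern z w) UNIV"
proof -
  let ?q = "cinner z w" and ?A = "\<lambda>k. {\<alpha> :: nat ^ 'n. mi_abs \<alpha> = k}"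
  have q: "cmod ?q < 1" by (rule norm_cinner_less_1) (use z w in auto)
  have bij: "bij_betw (\<lambda>(k,\<alpha>). \<alpha>) (Sigma UNIV ?A) UNIV"
    by (rule bij_betwI[where g = "\<lambda>\<alpha>. (mi_abs \<alpha>, \<alpha>)"]) auto
  have sm: "(\<lambda>\<alpha>. efun \<alpha> z * cnj (efun \<alpha> w)) summable_on UNIV"
  proof (rule abs_summable_summable, rule Infinite_Sum.abs_summable_on_comparison_test')
    show "(\<lambda>\<alpha> :: nat ^ 'n. norm z ^ mi_abs \<alpha>) summable_on UNIV" using z by (intro summable_power_mi_abs) auto
    show "cmod (efun \<alpha> z * cnj (efun \<alpha> w)) \<le> norm z ^ mi_abs \<alpha>" for \<alpha>
      using mult_mono[OF norm_efun_le[of \<alpha> z] norm_efun_le_1[of w \<alpha>]] w by (simp add: norm_mult)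
  qed
  have "((\<lambda>(k,\<alpha>). efun \<alpha> z * cnj (efun \<alpha> w)) has_sum kern z w) (Sigma UNIV ?A)"
  proof (rule has_sum_SigmaI)
    show "((\<lambda>\<alpha>. case (k, \<alpha>) of (k, \<alpha>) \<Rightarrow> efun \<alpha> z * cnj (efun \<alpha> w)) has_sum (?q ^ k / of_nat k)) (?A k)" for k
    proof (rule has_sum_finiteI[OF finite_mi_abs])
      have "?q ^ k / of_nat k = (\<Sum>\<alpha>\<in>?A k. of_real (fact k / mi_fact \<alpha>) * (\<Prod>i\<in>UNIV. (z $ i * cnj (w $ i)) ^ (\<alpha> $ i))) / of_nat k"
        unfolding cinner_def multinomial ..
      also have "\<dots> = (\<Sum>\<alpha>\<in>?A k. efun \<alpha> z * cnj (efun \<alpha> w))"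
        unfolding sum_divide_distrib by (intro sum.cong refl) (auto simp: efun_mult_cnj)
      finally show "?q ^ k / of_nat k = (\<Sum>\<alpha>\<in>?A k. case (k, \<alpha>) of (k, \<alpha>) \<Rightarrow> efun \<alpha> z * cnj (efun \<alpha> w))" by simp
    qed
    show "((\<lambda>k. ?q ^ k / of_nat k) has_sum kern z w) UNIV"
    proof (rule norm_summable_imp_has_sum)
      have "(\<lambda>n. - ((- (- ?q)) ^ n) / of_nat n) sums ln (1 + (- ?q))" by (rule Ln_series') (use q in simp)
      from sums_minus[OF this] show "(\<lambda>k. ?q ^ k / of_nat k) sums kern z w" by (simp add: kern_def)
      show "summable (\<lambda>k. norm (?q ^ k / of_nat k))"
      proof (rule summable_comparison_test'[OF summable_geometric[of "cmod ?q"]])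
        show "norm (norm (?q ^ n / of_nat n)) \<le> cmod ?q ^ n" for n
        proof (cases "n = 0")
          case False
          then have "cmod ?q ^ n / real n \<le> cmod ?q ^ n / 1" by (intro divide_left_mono) auto
          then show ?thesis by (simp add: norm_divide norm_power)
        qed simp
      qed (use q in auto)
    qed
    show "(\<lambda>(k,\<alpha>). efun \<alpha> z * cnj (efun \<alpha> w)) summable_on Sigma UNIV ?A"
      using sm summable_on_reindex_bij_betw[OF bij, of "\<lambda>\<alpha>. efun \<alpha> z * cnj (efun \<alpha> w)"] by (simp add: case_prod_unfold)
  qed
  then show ?thesis
    using has_sum_reindex_bij_betw[OF bij, of "\<lambda>\<alpha>. efun \<alpha> z * cnj (efun \<alpha> w)"] by (simp add: case_prod_unfold)
qed

subsection \<open>Square-summable families\<close>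

definition l2 :: "('a \<Rightarrow> complex) \<Rightarrow> bool" where
  "l2 a \<longleftrightarrow> (\<lambda>x. (cmod (a x))\<^sup>2) summable_on UNIV"

definition l2norm :: "('a \<Rightarrow> complex) \<Rightarrow> real" where
  "l2norm a = sqrt (\<Sum>\<^sub>\<infinity>x. (cmod (a x))\<^sup>2)"

lemma l2norm_nonneg [simp]: "l2norm a \<ge> 0"
  by (simp add: l2norm_def infsum_nonneg)

lemma l2norm_square: "(l2norm a)\<^sup>2 = (\<Sum>\<^sub>\<infinity>x. (cmod (a x))\<^sup>2)"
  by (simp add: l2norm_def infsum_nonneg)

lemma l2_cnj [simp]: "l2 (\<lambda>x. cnj (a x)) \<longleftrightarrow> l2 a"
  by (simp add: l2_def)

lemma l2norm_cnj [simp]: "l2norm (\<lambda>x. cnj (a x)) = l2norm a"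
  by (simp add: l2norm_def)

lemma l2_partial_sum_le:
  assumes "l2 a" "finite F"
  shows "(\<Sum>x\<in>F. (cmod (a x))\<^sup>2) \<le> (l2norm a)\<^sup>2"
  unfolding l2norm_square by (rule finite_sum_le_infsum) (use assms in \<open>auto simp: l2_def\<close>)

lemma l2_mult_abs_summable:
  assumes "l2 a" "l2 b"
  shows "(\<lambda>x. norm (a x * b x)) summable_on UNIV"
proof (rule Infinite_Sum.abs_summable_on_comparison_test')
  show "(\<lambda>x. (cmod (a x))\<^sup>2 + (cmod (b x))\<^sup>2) summable_on UNIV"
    using assms unfolding l2_def by (intro summable_on_add)
  show "norm (a x * b x) \<le> (cmod (a x))\<^sup>2 + (cmod (b x))\<^sup>2" for x
  proof -
    have "2 * (cmod (a x) * cmod (b x)) \<le> (cmod (a x))\<^sup>2 + (cmod (b x))\<^sup>2"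
      using sum_squares_bound[of "cmod (a x)" "cmod (b x)"] by (simp add: mult_ac)
    moreover have "0 \<le> cmod (a x) * cmod (b x)" by simp
    ultimately show ?thesis by (simp only: norm_mult)
  qed
qed

lemma l2_mult_summable: "l2 a \<Longrightarrow> l2 b \<Longrightarrow> (\<lambda>x. a x * b x) summable_on UNIV"
  by (rule abs_summable_summable[OF l2_mult_abs_summable])

lemma l2_Cauchy_Schwarz_abs:
  assumes "l2 a" "l2 b"
  shows "(\<Sum>\<^sub>\<infinity>x. cmod (a x * b x)) \<le> l2norm a * l2norm b"
proof (rule infsum_le_finite_sums[OF l2_mult_abs_summable[OF assms]])
  fix F :: "'a set" assume F: "finite F"
  have "(\<Sum>x\<in>F. cmod (a x * b x)) \<le> L2_set (\<lambda>x. cmod (a x)) F * L2_set (\<lambda>x. cmod (b x)) F"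
    using L2_set_mult_ineq[of "\<lambda>x. cmod (a x)" "\<lambda>x. cmod (b x)" F] by (simp add: norm_mult)
  also have "\<dots> \<le> l2norm a * l2norm b"
    unfolding L2_set_def l2norm_def using l2_partial_sum_le[OF assms(1) F] l2_partial_sum_le[OF assms(2) F]
    by (intro mult_mono) (auto simp: l2norm_square infsum_nonneg sum_nonneg)
  finally show "(\<Sum>x\<in>F. cmod (a x * b x)) \<le> l2norm a * l2norm b" .
qed

lemma l2_Cauchy_Schwarz:
  assumes "l2 a" "l2 b"
  shows "cmod (\<Sum>\<^sub>\<infinity>x. a x * b x) \<le> l2norm a * l2norm b"
  using norm_infsum_bound[OF l2_mult_abs_summable[OF assms]] l2_Cauchy_Schwarz_abs[OF assms] by linarith

lemma norm_add_square_le: "(cmod (x + y))\<^sup>2 \<le> 2 * (cmod x)\<^sup>2 + 2 * (cmod y)\<^sup>2"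
proof -
  have "(cmod (x + y))\<^sup>2 \<le> (cmod x + cmod y)\<^sup>2" by (intro power_mono norm_triangle_ineq) auto
  also have "\<dots> \<le> 2 * (cmod x)\<^sup>2 + 2 * (cmod y)\<^sup>2"
    using sum_squares_bound[of "cmod x" "cmod y"] by (simp add: power2_sum)
  finally show ?thesis .
qed

text \<open>The factor 2 in place of the triangle inequality is harmless, since the bound is used
  only for null sequences.\<close>

lemma l2_add:
  assumes "l2 a" "l2 b"
  shows "l2 (\<lambda>x. a x + b x)" "(l2norm (\<lambda>x. a x + b x))\<^sup>2 \<le> 2 * (l2norm a)\<^sup>2 + 2 * (l2norm b)\<^sup>2"
proof -
  have s: "(\<lambda>x. 2 * (cmod (a x))\<^sup>2 + 2 * (cmod (b x))\<^sup>2) summable_on UNIV"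
    using assms unfolding l2_def by (intro summable_on_add summable_on_cmult_right)
  show l: "l2 (\<lambda>x. a x + b x)"
    unfolding l2_def by (rule summable_on_comparison_test[OF s norm_add_square_le]) auto
  have "(l2norm (\<lambda>x. a x + b x))\<^sup>2 \<le> (\<Sum>\<^sub>\<infinity>x. 2 * (cmod (a x))\<^sup>2 + 2 * (cmod (b x))\<^sup>2)"
    unfolding l2norm_square by (rule infsum_mono[OF _ s norm_add_square_le]) (use l in \<open>simp add: l2_def\<close>)
  also have "\<dots> = 2 * (l2norm a)\<^sup>2 + 2 * (l2norm b)\<^sup>2"
    unfolding l2norm_square using assms unfolding l2_def
    by (subst infsum_add) (auto intro!: summable_on_cmult_right simp: infsum_cmult_right)
  finally show "(l2norm (\<lambda>x. a x + b x))\<^sup>2 \<le> 2 * (l2norm a)\<^sup>2 + 2 * (l2norm b)\<^sup>2" .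
qed

lemma l2_cmult:
  assumes "l2 a"
  shows "l2 (\<lambda>x. c * a x)" "l2norm (\<lambda>x. c * a x) = cmod c * l2norm a"
  using assms unfolding l2_def l2norm_def
  by (auto simp: norm_mult power_mult_distrib infsum_cmult_right real_sqrt_mult intro!: summable_on_cmult_right)

lemma l2_zero [simp]: "l2 (\<lambda>x. 0)" "l2norm (\<lambda>x. 0) = 0"
  by (simp_all add: l2_def l2norm_def)

lemma infsum_self_cnj: "l2 a \<Longrightarrow> (\<Sum>\<^sub>\<infinity>x. a x * cnj (a x)) = of_real ((l2norm a)\<^sup>2)"
  unfolding l2norm_square l2_def complex_norm_square[symmetric]
  by (intro infsumI has_sum_of_real has_sum_infsum)

subsection \<open>The Dirichlet space as a space of square-summable coefficients\<close>

text \<open>Scaled so that the seminorm is the plain l2 norm and f minus its value at 0 is the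
  series of \<open>dc f \<alpha> * efun \<alpha>\<close>. The constant coefficient is wiped out
  since \<open>dweight 0 = 0\<close>.\<close>

definition dc :: "(complex ^ 'n \<Rightarrow> complex) \<Rightarrow> nat ^ 'n \<Rightarrow> complex" where
  "dc f \<alpha> = dcoeff f \<alpha> * of_real (sqrt (dweight \<alpha>))"

lemma dc_0 [simp]: "dc f 0 = 0"
  by (simp add: dc_def)

lemma holo_fun_cong_ball:
  assumes "\<And>z. z \<in> ballN \<Longrightarrow> f z = g z" "holo_fun ballN f"
  shows "holo_fun ballN g"
proof -
  obtain L where L: "\<And>z. z \<in> ballN \<Longrightarrow> (f has_derivative L z) (at z)" "\<And>z c v. z \<in> ballN \<Longrightarrow> L z (c *s v) = c * L z v"
    using assms(2) by (rule holo_funE) blast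
  show ?thesis
  proof (rule holo_funI[OF _ L(2)])
    show "(g has_derivative L z) (at z)" if "z \<in> ballN" for z
      using has_derivative_transform_within_open[OF L(1)[OF that] open_ball that] assms(1) by blast
  qed
qed

lemma dc_cong: "(\<And>z. z \<in> ballN \<Longrightarrow> f z = g z) \<Longrightarrow> dc f = dc g"
  unfolding dc_def[abs_def] using dcoeff_cong[of f g] by simp

lemma dir_space_iff: "f \<in> dir_space \<longleftrightarrow> holo_fun ballN f \<and> l2 (dc f)"
  by (simp add: dir_space_def l2_def dc_def norm_mult power_mult_distrib dweight_nonneg)

lemma dir_space_holo: "f \<in> dir_space \<Longrightarrow> holo_fun ballN f"
  and dir_space_l2: "f \<in> dir_space \<Longrightarrow> l2 (dc f)"
  by (simp_all add: dir_space_iff)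

lemma dinner_eq: "dinner f g = f 0 * cnj (g 0) + (\<Sum>\<^sub>\<infinity>\<alpha>. dc f \<alpha> * cnj (dc g \<alpha>))"
proof -
  have "complex_of_real (dweight \<alpha>) = of_real (sqrt (dweight \<alpha>)) * of_real (sqrt (dweight \<alpha>))" for \<alpha> :: "nat ^ 'a"
    by (metis dweight_nonneg of_real_mult real_sqrt_mult_self abs_of_nonneg)
  then have "dcoeff f \<alpha> * cnj (dcoeff g \<alpha>) * complex_of_real (dweight \<alpha>) = dc f \<alpha> * cnj (dc g \<alpha>)" for \<alpha>
    by (simp add: dc_def)
  then show ?thesis by (simp add: dinner_def)
qed

lemma dnorm_eq:
  assumes "f \<in> dir_space"
  shows "dnorm f = sqrt ((cmod (f 0))\<^sup>2 + (l2norm (dc f))\<^sup>2)"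
  unfolding dnorm_def dinner_eq infsum_self_cnj[OF dir_space_l2[OF assms]]
  by (simp flip: complex_norm_square of_real_power of_real_add)

lemma dnorm_square: "f \<in> dir_space \<Longrightarrow> (dnorm f)\<^sup>2 = (cmod (f 0))\<^sup>2 + (l2norm (dc f))\<^sup>2"
  by (simp add: dnorm_eq)

lemma dnorm_nonneg: "f \<in> dir_space \<Longrightarrow> dnorm f \<ge> 0"
  by (simp add: dnorm_eq)

lemma dnorm_cong:
  assumes "\<And>z. z \<in> ballN \<Longrightarrow> f z = g z"
  shows "dnorm f = dnorm g"
proof -
  have "dc f = dc g" "f 0 = g 0" by (rule dc_cong[OF assms]) (simp_all add: assms)
  then show ?thesis by (simp add: dnorm_def dinner_eq)
qed

lemma dc_times_efun: "dc f \<alpha> * efun \<alpha> z = (if \<alpha> = 0 then 0 else dcoeff f \<alpha> * mono_pow \<alpha> z)"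
  using dweight_pos[of \<alpha>] by (auto simp: dc_def efun_def)

lemma has_sum_delta: "((\<lambda>x. if x = a then c else 0) has_sum (c :: complex)) UNIV"
  by (rule has_sum_finite_neutralI[of "{a}"]) auto

lemma dcoeff_0:
  fixes f :: "complex ^ 'a \<Rightarrow> complex"
  shows "holo_fun ballN f \<Longrightarrow> dcoeff f 0 = f 0"
proof -
  assume f: "holo_fun ballN f"
  have "((\<lambda>\<alpha>. dcoeff f \<alpha> * mono_pow \<alpha> 0) has_sum f 0) UNIV" by (rule dcoeff_has_sum[OF f]) simp
  moreover have "(\<lambda>\<alpha>. dcoeff f \<alpha> * mono_pow \<alpha> 0) = (\<lambda>\<alpha>. if \<alpha> = 0 then dcoeff f 0 else 0)"
    by (auto simp: mono_pow_zero_right)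
  ultimately have "((\<lambda>\<alpha> :: nat ^ 'a. if \<alpha> = 0 then dcoeff f 0 else 0) has_sum f 0) UNIV" by simp
  from has_sum_unique[OF has_sum_delta this] show ?thesis .
qed

lemma dc_has_sum:
  assumes f: "holo_fun ballN f" and z: "norm z < 1"
  shows "((\<lambda>\<alpha>. dc f \<alpha> * efun \<alpha> z) has_sum (f z - f 0)) UNIV"
proof -
  have "((\<lambda>\<alpha>. dcoeff f \<alpha> * mono_pow \<alpha> z + - (if \<alpha> = 0 then dcoeff f 0 else 0)) has_sum (f z + - dcoeff f 0)) UNIV"
    by (intro has_sum_add has_sum_uminusI dcoeff_has_sum[OF f] has_sum_delta) (use z in simp)
  moreover have "(\<lambda>\<alpha>. dcoeff f \<alpha> * mono_pow \<alpha> z + - (if \<alpha> = 0 then dcoeff f 0 else 0)) = (\<lambda>\<alpha>. dc f \<alpha> * efun \<alpha> z)"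
    by (auto simp: dc_times_efun)
  ultimately show ?thesis by (simp add: dcoeff_0[OF f])
qed

text \<open>\<open>b 0 = 0\<close> pins the one coefficient that the series cannot see, as
  \<open>efun 0\<close> vanishes identically.\<close>

lemma dc_unique:
  fixes f :: "complex ^ 'a \<Rightarrow> complex"
  assumes f: "holo_fun ballN f" and b: "b 0 = 0" and "\<delta> > 0"
    and s: "\<And>z. norm z < 1 \<Longrightarrow> norm z < \<delta> \<Longrightarrow> ((\<lambda>\<alpha>. b \<alpha> * efun \<alpha> z) has_sum (f z - f 0)) UNIV"
  shows "dc f = b"
proof -
  define c where "c \<alpha> = (if \<alpha> = 0 then f 0 else b \<alpha> / of_real (sqrt (dweight \<alpha>)))" for \<alpha>
  have "dcoeff f = c"
  proof (rule dcoeff_unique[OF f \<open>\<delta> > 0\<close>])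
    fix z :: "complex ^ 'a" assume z: "z \<in> ballN" "norm z < \<delta>"
    have "((\<lambda>\<alpha>. b \<alpha> * efun \<alpha> z + (if \<alpha> = 0 then f 0 else 0)) has_sum (f z - f 0 + f 0)) UNIV"
      by (intro has_sum_add s has_sum_delta) (use z in auto)
    moreover have "(\<lambda>\<alpha>. b \<alpha> * efun \<alpha> z + (if \<alpha> = 0 then f 0 else 0)) = (\<lambda>\<alpha>. c \<alpha> * mono_pow \<alpha> z)"
      by (auto simp: c_def efun_def b)
    ultimately show "((\<lambda>\<alpha>. c \<alpha> * mono_pow \<alpha> z) has_sum f z) UNIV" by simp
  qed
  moreover have "dweight \<alpha> \<noteq> 0" if "\<alpha> \<noteq> 0" for \<alpha> :: "nat ^ 'a"
    using dweight_pos[OF that] by simp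
  ultimately show ?thesis using b by (auto simp: dc_def c_def fun_eq_iff)
qed

lemma holo_fun_lin:
  "holo_fun S f \<Longrightarrow> holo_fun S g \<Longrightarrow> holo_fun S (\<lambda>z. a * f z + b * g z)"
  by (intro holo_fun_add holo_fun_mult holo_fun_const)

lemma dc_lin:
  assumes f: "holo_fun ballN f" and g: "holo_fun ballN g"
  shows "dc (\<lambda>z. a * f z + b * g z) = (\<lambda>\<alpha>. a * dc f \<alpha> + b * dc g \<alpha>)"
proof (rule dc_unique[OF holo_fun_lin[OF f g] _ zero_less_one])
  fix z :: "complex ^ 'a" assume z: "norm z < 1"
  have "((\<lambda>\<alpha>. a * (dc f \<alpha> * efun \<alpha> z) + b * (dc g \<alpha> * efun \<alpha> z)) has_sum (a * (f z - f 0) + b * (g z - g 0))) UNIV"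
    by (intro has_sum_add has_sum_cmult_right dc_has_sum f g z)
  then show "((\<lambda>\<alpha>. (a * dc f \<alpha> + b * dc g \<alpha>) * efun \<alpha> z) has_sum (a * f z + b * g z - (a * f 0 + b * g 0))) UNIV"
    by (simp add: algebra_simps)
qed simp

lemma dc_const [simp]: "dc (\<lambda>z. c) = (\<lambda>\<alpha>. 0)"
  by (rule dc_unique[OF holo_fun_const _ zero_less_one]) auto

lemma dir_space_const [simp]: "(\<lambda>z. c) \<in> dir_space"
  by (simp add: dir_space_iff)

lemma dir_space_lin: "f \<in> dir_space \<Longrightarrow> g \<in> dir_space \<Longrightarrow> (\<lambda>z. a * f z + b * g z) \<in> dir_space"
  by (simp add: dir_space_iff dc_lin holo_fun_lin l2_add l2_cmult)

lemma dir_space_diff: "f \<in> dir_space \<Longrightarrow> g \<in> dir_space \<Longrightarrow> f - g \<in> dir_space"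
  using dir_space_lin[of f g 1 "-1"] by (simp add: fun_diff_def)

lemma dnorm_lin_le:
  assumes "f \<in> dir_space" "g \<in> dir_space"
  shows "(dnorm (\<lambda>z. a * f z + b * g z))\<^sup>2 \<le> 2 * (cmod a * dnorm f)\<^sup>2 + 2 * (cmod b * dnorm g)\<^sup>2"
proof -
  have "(cmod (a * f 0 + b * g 0))\<^sup>2 \<le> 2 * (cmod (a * f 0))\<^sup>2 + 2 * (cmod (b * g 0))\<^sup>2"
    by (rule norm_add_square_le)
  moreover have "(l2norm (\<lambda>\<alpha>. a * dc f \<alpha> + b * dc g \<alpha>))\<^sup>2 \<le> 2 * (l2norm (\<lambda>\<alpha>. a * dc f \<alpha>))\<^sup>2 + 2 * (l2norm (\<lambda>\<alpha>. b * dc g \<alpha>))\<^sup>2"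
    using assms by (intro l2_add l2_cmult) (auto simp: dir_space_iff)
  ultimately show ?thesis
    using assms by (simp add: dnorm_square dir_space_lin dc_lin dir_space_holo l2_cmult dir_space_l2 
        norm_mult power_mult_distrib algebra_simps)
qed

lemma Re_one_minus_pos: "cmod q < 1 \<Longrightarrow> Re (1 - q) > 0"
  using complex_Re_le_cmod[of q] by simp

lemma holo_fun_kern:
  assumes "norm w < 1" shows "holo_fun ballN (\<lambda>z. kern z w)"
  unfolding kern_def
proof (rule holo_fun_uminus, rule holo_fun_comp_field[where g = Ln])
  show "holo_fun ballN (\<lambda>z. 1 - cinner z w)"
    by (intro holo_fun_diff holo_fun_const holo_fun_cinner)
  fix z :: "complex ^ 'a" assume "z \<in> ballN"
  then have "Re (1 - cinner z w) > 0" using assms by (intro Re_one_minus_pos norm_cinner_less_1) auto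
  then have "1 - cinner z w \<notin> \<real>\<^sub>\<le>\<^sub>0" by (auto simp: complex_nonpos_Reals_iff)
  then show "Ln field_differentiable at (1 - cinner z w)" by (rule field_differentiable_at_Ln)
qed

lemma kern_zero [simp]: "kern 0 w = 0" "kern w 0 = 0"
  by (simp_all add: kern_def)

lemma dc_kern:
  assumes "norm w < 1" shows "dc (\<lambda>z. kern z w) = (\<lambda>\<alpha>. cnj (efun \<alpha> w))"
  by (rule dc_unique[OF holo_fun_kern[OF assms] _ zero_less_one])
     (use kern_has_sum[OF _ assms] in \<open>simp_all add: mult.commute\<close>)

text \<open>The value \<open>kern w w\<close> as a real number, that is, the squared seminorm of the
  kernel at w; it measures the approach to the sphere.\<close>

definition kq :: "complex ^ 'n \<Rightarrow> real" where
  "kq w = - ln (1 - (norm w)\<^sup>2)"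

lemma kern_self:
  assumes "norm w < 1" shows "kern w w = of_real (kq w)"
proof -
  have "(norm w)\<^sup>2 < 1" using assms by (simp add: power_less_one_iff abs_square_less_1)
  moreover have "1 - cinner w w = of_real (1 - (norm w)\<^sup>2)" by (simp add: cinner_self)
  ultimately show ?thesis by (simp add: kern_def kq_def Ln_of_real del: of_real_diff of_real_power)
qed

lemma efun_l2:
  assumes "norm w < 1"
  shows "l2 (\<lambda>\<alpha>. efun \<alpha> w)" "(l2norm (\<lambda>\<alpha>. efun \<alpha> w))\<^sup>2 = kq w"
proof -
  have "((\<lambda>\<alpha>. complex_of_real ((cmod (efun \<alpha> w))\<^sup>2)) has_sum of_real (kq w)) UNIV"
    using kern_has_sum[OF assms assms] by (simp only: kern_self[OF assms] complex_norm_square)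
  then have *: "((\<lambda>\<alpha>. (cmod (efun \<alpha> w))\<^sup>2) has_sum kq w) UNIV" by (simp only: has_sum_of_real_iff)
  show "l2 (\<lambda>\<alpha>. efun \<alpha> w)" using * by (auto simp: l2_def summable_on_def)
  show "(l2norm (\<lambda>\<alpha>. efun \<alpha> w))\<^sup>2 = kq w" unfolding l2norm_square by (rule infsumI[OF *])
qed

lemma kq_nonneg: "norm w < 1 \<Longrightarrow> kq w \<ge> 0"
  using efun_l2(2)[of w] zero_le_power2[of "l2norm (\<lambda>\<alpha>. efun \<alpha> w)"] by simp

lemma kern_dir_space: "norm w < 1 \<Longrightarrow> (\<lambda>z. kern z w) \<in> dir_space"
  by (simp add: dir_space_iff holo_fun_kern dc_kern efun_l2)

lemma dir_space_eval:
  assumes "f \<in> dir_space" "norm w < 1"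
  shows "f w - f 0 = (\<Sum>\<^sub>\<infinity>\<alpha>. dc f \<alpha> * efun \<alpha> w)"
  using dc_has_sum[OF dir_space_holo[OF assms(1)] assms(2)] by (simp add: infsumI)

lemma dir_space_eval_bound:
  assumes "f \<in> dir_space" "norm w < 1"
  shows "cmod (f w - f 0) \<le> l2norm (dc f) * sqrt (kq w)"
proof -
  have "cmod (f w - f 0) \<le> l2norm (dc f) * l2norm (\<lambda>\<alpha>. efun \<alpha> w)"
    unfolding dir_space_eval[OF assms] by (rule l2_Cauchy_Schwarz[OF dir_space_l2[OF assms(1)] efun_l2(1)[OF assms(2)]])
  also have "l2norm (\<lambda>\<alpha>. efun \<alpha> w) = sqrt (kq w)" 
    using efun_l2(2)[OF assms(2)] by (metis l2norm_nonneg real_sqrt_unique)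
  finally show ?thesis .
qed

subsection \<open>Moebius involutions\<close>

text \<open>In the usual notation this is \<open>(a - P z - s Q z) / (1 - \<langle>z,a\<rangle>)\<close> with \<open>s = sqrt (1 - |a|\<^sup>2)\<close>, where
  \<open>P\<close> projects onto the line of \<open>a\<close> and \<open>Q = 1 - P\<close>. Writing \<open>P z + s Q z = s z + (1 - s) P z\<close> and
  \<open>(1 - s) / |a|\<^sup>2 = 1 / (1 + s)\<close> avoids a case distinction at \<open>a = 0\<close>.\<close>

definition moeb :: "complex ^ 'n \<Rightarrow> complex ^ 'n \<Rightarrow> complex ^ 'n" where
  "moeb a z = (1 / (1 - cinner z a)) *s
     (a - of_real (sqrt (1 - (norm a)\<^sup>2)) *s z - (cinner z a / (1 + of_real (sqrt (1 - (norm a)\<^sup>2)))) *s a)"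

lemma one_minus_norm_square_pos: "norm a < 1 \<Longrightarrow> 1 - (norm a)\<^sup>2 > 0"
  by (simp add: power_less_one_iff abs_square_less_1)

lemma one_minus_cinner_nonzero: "norm z \<le> 1 \<Longrightarrow> norm w < 1 \<Longrightarrow> 1 - cinner z w \<noteq> 0"
  using norm_cinner_less_1[of w z] cnj_cinner[of w z] complex_mod_cnj[of "cinner w z"] by auto

text \<open>Naming s and 1 / (1 + s) together with their polynomial relations keeps the square root
  out of the identities below, so that \<open>algebra\<close> can decide them.\<close>

lemma moeb_radius:
  assumes "norm a < 1"
  obtains S p where "S = complex_of_real (sqrt (1 - (norm a)\<^sup>2))" "p = 1 / (1 + S)" "p * (1 + S) = 1" "cnj S = S" "cnj p = p"
    "S \<noteq> 0" "cinner a a = 1 - S\<^sup>2" "S\<^sup>2 = of_real (1 - (norm a)\<^sup>2)"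
proof -
  define s where "s = sqrt (1 - (norm a)\<^sup>2)"
  have s: "s > 0" "s\<^sup>2 = 1 - (norm a)\<^sup>2" using one_minus_norm_square_pos[OF assms] by (auto simp: s_def)
  have ne: "1 + complex_of_real s \<noteq> 0" using s(1) by (metis add_pos_pos less_irrefl of_real_1 of_real_add of_real_eq_0_iff zero_less_one)
  have s2: "(complex_of_real s)\<^sup>2 = of_real (1 - (norm a)\<^sup>2)" using s(2) by (metis of_real_power)
  show ?thesis
    by (rule that[of "complex_of_real s" "1 / (1 + complex_of_real s)"])
       (use s ne s2 in \<open>auto simp: s_def cinner_self\<close>)
qed

text \<open>With x = <z,a> and y = <a,w>, the two numerators pair to (1 - x)(1 - y) - S^2 (1 -
  <z,w>). Allowing norm 1 lets the same identity show that the sphere is preserved.\<close>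

lemma moeb_cinner:
  assumes a: "norm a < 1" and z: "norm z \<le> 1" and w: "norm w \<le> 1"
  shows "1 - cinner (moeb a z) (moeb a w) =
    of_real (1 - (norm a)\<^sup>2) * (1 - cinner z w) / ((1 - cinner z a) * (1 - cinner a w))"
proof -
  obtain S p where S: "S = complex_of_real (sqrt (1 - (norm a)\<^sup>2))" "p = 1 / (1 + S)" "p * (1 + S) = 1" "cnj S = S" "cnj p = p"
    "S \<noteq> 0" "cinner a a = 1 - S\<^sup>2" "S\<^sup>2 = of_real (1 - (norm a)\<^sup>2)" by (rule moeb_radius[OF a])
  define x y where "x = cinner z a" and "y = cinner a w"
  have ne: "1 - x \<noteq> 0" "1 - y \<noteq> 0"
    using one_minus_cinner_nonzero[OF z a] one_minus_cinner_nonzero[OF w a] cnj_cinner[of w a]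
    by (auto simp: x_def y_def)
  have mz: "moeb a z = (1 / (1 - x)) *s (a - S *s z - (x * p) *s a)"
    unfolding moeb_def x_def S(1,2) by simp
  have mw: "moeb a w = (1 / (1 - cnj y)) *s (a - S *s w - (cnj y * p) *s a)"
    unfolding moeb_def y_def S(1,2) cnj_cinner by simp
  have num: "cinner (a - S *s z - (x * p) *s a) (a - S *s w - (cnj y * p) *s a) = (1 - x) * (1 - y) - S\<^sup>2 * (1 - cinner z w)"
  proof -
    have "cinner (a - S *s z - (x * p) *s a) (a - S *s w - (cnj y * p) *s a) =
      (1 - S\<^sup>2) - S * y - (1 - S\<^sup>2) * (y * p) - S * (x - S * cinner z w - x * (y * p))
       - x * p * ((1 - S\<^sup>2) - S * y - (1 - S\<^sup>2) * (y * p))"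
      by (simp add: cinner_diff_left cinner_diff_right S(4,5,7) flip: x_def y_def) (simp add: algebra_simps)
    also have "\<dots> = (1 - x) * (1 - y) - S\<^sup>2 * (1 - cinner z w)"
      using S(3) by algebra
    finally show ?thesis .
  qed
  have "1 - 1 / d * (1 / e * (d * e - B)) = B / (d * e)" if "d \<noteq> 0" "e \<noteq> 0" for d e B :: complex
    using that by (simp add: field_simps)
  from this[OF ne] show ?thesis
    unfolding mz mw cinner_scale_left cinner_scale_right num S(8)[symmetric] x_def[symmetric] y_def[symmetric]
    by (simp add: mult.commute)
qed

lemma norm_moeb:
  assumes "norm a < 1" "norm z \<le> 1"
  shows "1 - (norm (moeb a z))\<^sup>2 = (1 - (norm a)\<^sup>2) * (1 - (norm z)\<^sup>2) / (cmod (1 - cinner z a))\<^sup>2"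
proof -
  have "(1 - cinner z a) * (1 - cinner a z) = of_real ((cmod (1 - cinner z a))\<^sup>2)"
    by (simp only: complex_norm_square complex_cnj_diff complex_cnj_one cnj_cinner)
  with moeb_cinner[OF assms assms(2)]
  have "complex_of_real (1 - (norm (moeb a z))\<^sup>2) = of_real ((1 - (norm a)\<^sup>2) * (1 - (norm z)\<^sup>2) / (cmod (1 - cinner z a))\<^sup>2)"
    by (simp only: cinner_self of_real_diff of_real_1 of_real_mult of_real_divide)
  then show ?thesis by (simp only: of_real_eq_iff)
qed

lemma norm_moeb_less_1:
  assumes "norm a < 1" "norm z < 1" shows "norm (moeb a z) < 1"
proof -
  have "1 - (norm (moeb a z))\<^sup>2 > 0"
    using one_minus_norm_square_pos[OF assms(1)] one_minus_norm_square_pos[OF assms(2)] one_minus_cinner_nonzero[of z a] assms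
    by (subst norm_moeb) auto
  then show ?thesis using abs_square_less_1[of "norm (moeb a z)"] by simp
qed

lemma norm_moeb_eq_1:
  assumes "norm a < 1" "norm z = 1" shows "norm (moeb a z) = 1"
  using norm_moeb[of a z] assms power2_eq_1_iff[of "norm (moeb a z)"] norm_ge_zero[of "moeb a z"] by auto

text \<open>Pairing \<open>moeb a z\<close> with a gives the new denominator S^2 / (1 - x); after
  that the identity is checked coordinate by coordinate.\<close>

lemma moeb_moeb:
  assumes a: "norm a < 1" and z: "norm z \<le> 1"
  shows "moeb a (moeb a z) = z"
proof -
  obtain S p where S: "S = complex_of_real (sqrt (1 - (norm a)\<^sup>2))" "p = 1 / (1 + S)" "p * (1 + S) = 1" "cnj S = S" "cnj p = p"
    "S \<noteq> 0" "cinner a a = 1 - S\<^sup>2" "S\<^sup>2 = of_real (1 - (norm a)\<^sup>2)" by (rule moeb_radius[OF a])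
  define x where "x = cinner z a"
  have ne: "1 - x \<noteq> 0" using one_minus_cinner_nonzero[OF z a] by (simp add: x_def)
  have m: "moeb a u = (1 / (1 - cinner u a)) *s (a - S *s u - (cinner u a * p) *s a)" for u
    unfolding moeb_def S(1,2) by simp
  have c: "cinner (moeb a z) a = (1 - S\<^sup>2 - x) / (1 - x)"
  proof -
    have "cinner (a - S *s z - (x * p) *s a) a = (1 - S\<^sup>2) - S * x - x * p * (1 - S\<^sup>2)"
      by (simp add: cinner_diff_left S(7) flip: x_def)
    also have "\<dots> = 1 - S\<^sup>2 - x" using S(3) by algebra
    finally show ?thesis unfolding m[of z] x_def[symmetric] cinner_scale_left by simp
  qed
  then have d: "1 - cinner (moeb a z) a = S\<^sup>2 / (1 - x)" using ne by (simp add: field_simps)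
  show ?thesis
  proof (simp only: vec_eq_iff, intro allI)
    fix i
    have "moeb a (moeb a z) $ i = (1 - x) / S\<^sup>2 * (a $ i - S * (moeb a z $ i) - (1 - S\<^sup>2 - x) / (1 - x) * p * a $ i)"
    proof -
      have "moeb a (moeb a z) = (1 / (S\<^sup>2 / (1 - x))) *s (a - S *s moeb a z - ((1 - S\<^sup>2 - x) / (1 - x) * p) *s a)"
        by (subst m, subst d, subst c, rule refl)
      then show ?thesis by (simp only: vector_smult_component vector_minus_component) simp
    qed
    also have "moeb a z $ i = (a $ i - S * z $ i - x * p * a $ i) / (1 - x)"
      by (subst m) (simp add: diff_divide_distrib flip: x_def)
    also have "(1 - x) / S\<^sup>2 * (a $ i - S * ((a $ i - S * z $ i - x * p * a $ i) / (1 - x)) - (1 - S\<^sup>2 - x) / (1 - x) * p * a $ i)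
        = ((1 - x) * a $ i - S * (a $ i - S * z $ i - x * p * a $ i) - (1 - S\<^sup>2 - x) * p * a $ i) / S\<^sup>2"
      using ne S(6) by (simp add: divide_simps)
    also have "(1 - x) * a $ i - S * (a $ i - S * z $ i - x * p * a $ i) - (1 - S\<^sup>2 - x) * p * a $ i = S\<^sup>2 * z $ i"
      using S(3) by algebra
    finally show "moeb a (moeb a z) $ i = z $ i" using S(6) by simp
  qed
qed

lemma moeb_zero [simp]: "moeb a 0 = a"
  by (simp add: moeb_def)

lemma moeb_self:
  assumes "norm a < 1" shows "moeb a a = 0"
  using moeb_moeb[OF assms, of 0] by simp

lemma holo_map_moeb:
  fixes a :: "complex ^ 'n"
  assumes "norm a < 1" shows "holo_map ballN (moeb a)"
  unfolding holo_map_def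
proof
  fix i
  let ?s = "complex_of_real (sqrt (1 - (norm a)\<^sup>2))"
  have 1: "holo_fun ballN (\<lambda>z :: complex ^ 'n. 1 / (1 - cinner z a))"
  proof (rule holo_fun_comp_field[where g = "\<lambda>t. 1 / t"])
    show "holo_fun ballN (\<lambda>z. 1 - cinner z a)" by (intro holo_fun_diff holo_fun_const holo_fun_cinner)
    fix z :: "complex ^ 'n" assume "z \<in> ballN"
    then have "1 - cinner z a \<noteq> 0" using assms by (intro one_minus_cinner_nonzero) auto
    then show "(\<lambda>t. 1 / t) field_differentiable at (1 - cinner z a)"
      by (intro field_differentiable_divide field_differentiable_const field_differentiable_ident) auto
  qed
  have 2: "holo_fun ballN (\<lambda>z. a $ i - ?s * z $ i - cinner z a * (1 / (1 + ?s)) * a $ i)"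
    by (intro holo_fun_diff holo_fun_mult holo_fun_const holo_fun_nth holo_fun_cinner)
  show "holo_fun ballN (\<lambda>z. moeb a z $ i)"
  proof -
    have "(\<lambda>z. moeb a z $ i) = (\<lambda>z. 1 / (1 - cinner z a) * (a $ i - ?s * z $ i - cinner z a * (1 / (1 + ?s)) * a $ i))"
      by (simp add: moeb_def diff_divide_distrib mult.commute)
    with holo_fun_mult[OF 1 2] show ?thesis by (simp only:)
  qed
qed

lemma continuous_on_moeb:
  fixes a :: "complex ^ 'n"
  assumes "norm a < 1" shows "continuous_on (cball 0 1) (moeb a)"
proof -
  have c: "continuous_on (cball 0 1) (\<lambda>z :: complex ^ 'n. cinner z a)" unfolding cinner_def by (intro continuous_intros)
  have ne: "\<forall>z\<in>cball 0 1. 1 - cinner z a \<noteq> 0" using one_minus_cinner_nonzero[of _ a] assms by auto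
  obtain S p where "S = complex_of_real (sqrt (1 - (norm a)\<^sup>2))" "p * (1 + S) = 1" by (rule moeb_radius[OF assms])
  then have "1 + complex_of_real (sqrt (1 - (norm a)\<^sup>2)) \<noteq> 0" by (metis mult_zero_right zero_neq_one)
  then show ?thesis
    unfolding moeb_def vector_scalar_mult_def using c ne
    by (auto intro!: continuous_intros)
qed

subsection \<open>Automorphisms of the ball\<close>

definition cisom :: "(complex ^ 'n \<Rightarrow> complex ^ 'n) \<Rightarrow> bool" where
  "cisom U \<longleftrightarrow> (\<forall>x y. U (x + y) = U x + U y) \<and> (\<forall>c x. U (c *s x) = c *s U x) \<and> (\<forall>x. norm (U x) = norm x)"

lemma Re_cinner: "2 * Re (cinner x y) = (norm (x + y))\<^sup>2 - (norm x)\<^sup>2 - (norm y)\<^sup>2"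
proof -
  have n: "(norm u)\<^sup>2 = Re (cinner u u)" for u :: "complex ^ 'n" by (simp add: cinner_self)
  have "Re (cinner y x) = Re (cinner x y)" using cnj_cinner[of x y] by (metis cnj.simps(1))
  then show ?thesis unfolding n by (simp add: cinner_add_left cinner_add_right)
qed

text \<open>Polarisation: norms determine the real part, and replacing y by i y gives the imaginary
  part.\<close>

lemma cisom_cinner:
  assumes "cisom U" shows "cinner (U x) (U y) = cinner x y"
proof -
  have U: "\<And>x y. U (x + y) = U x + U y" "\<And>c x. U (c *s x) = c *s U x" "\<And>x. norm (U x) = norm x"
    using assms by (auto simp: cisom_def)
  have re: "Re (cinner (U x) (U y)) = Re (cinner x y)" for x y
    using Re_cinner[of "U x" "U y"] Re_cinner[of x y] by (simp add: U(3) flip: U(1))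
  have "Im (cinner (U x) (U y)) = Im (cinner x y)"
    using re[of x "\<i> *s y"] by (simp add: U(2))
  with re show ?thesis by (simp add: complex_eq_iff)
qed

section \<open>The Schwarz lemma in the ball and the form of an automorphism\<close>

lemma norm_scale_vec [simp]: "norm (c *s (x :: complex ^ 'n)) = cmod c * norm x"
  by (simp add: norm_vec_def norm_mult L2_set_right_distrib)

lemma holo_map_slice_cinner:
  assumes "holo_map ballN F" "norm u \<le> 1"
  shows "(\<lambda>t. cinner (F (t *s u)) v) holomorphic_on ball 0 1"
proof -
  have f: "holo_fun ballN (\<lambda>z. cinner (F z) v)"
    unfolding cinner_def using assms(1) by (intro holo_fun_sum holo_fun_mult holo_fun_const) (auto simp: holo_map_def)
  have "norm (t *s u) < 1" if "cmod t < 1" for t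
    using mult_left_mono[OF assms(2), of "cmod t"] that by simp
  then show ?thesis using holo_fun_slice[OF f, of "ball 0 1" 0 u] by simp
qed

text \<open>The one-variable Schwarz lemma applied to g t = <F (t u), v>, where u and v are the unit
  vectors of z and F z. Equality at t = |z| forces g to be a rotation, and its positive value there
  makes it the identity.\<close>

lemma ball_Schwarz:
  fixes F :: "complex ^ 'n \<Rightarrow> complex ^ 'n"
  assumes F: "holo_map ballN F" "\<And>z. norm z < 1 \<Longrightarrow> norm (F z) < 1" "F 0 = 0" and z: "norm z < 1"
  shows "norm (F z) \<le> norm z"
    and "norm (F z) = norm z \<Longrightarrow> z \<noteq> 0 \<Longrightarrow> cmod t < 1 \<Longrightarrow>
          cinner (F (t *s ((1 / norm z) *s z))) ((1 / norm z) *s F z) = t"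
proof -
  have *: "norm (F z) \<le> norm z \<and> (norm (F z) = norm z \<longrightarrow> 
      (\<forall>t. cmod t < 1 \<longrightarrow> cinner (F (t *s ((1 / norm z) *s z))) ((1 / norm z) *s F z) = t))" if "z \<noteq> 0" "F z \<noteq> 0"
  proof -
    define u v where "u = (1 / norm z) *s z" and "v = (1 / norm (F z)) *s F z"
    have uv: "norm u = 1" "norm v = 1" "of_real (norm z) *s u = z" using that by (auto simp: u_def v_def norm_divide vec_eq_iff)
    define g where "g t = cinner (F (t *s u)) v" for t
    have g: "g holomorphic_on ball 0 1" unfolding g_def using holo_map_slice_cinner[OF F(1)] uv by simp
    have g0: "g 0 = 0" by (simp add: g_def F(3))
    have g1: "cmod (g t) < 1" if "cmod t < 1" for t
      unfolding g_def by (rule norm_cinner_less_1) (use uv that F(2) in auto)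
    have gz: "g (of_real (norm z)) = of_real (norm (F z))"
      using that by (simp add: g_def uv v_def cinner_self power2_eq_square)
    have "cmod (g (of_real (norm z))) \<le> cmod (of_real (norm z))"
      by (rule Schwarz_Lemma(1)[OF g g0 g1]) (use z in auto)
    then have 1: "norm (F z) \<le> norm z" by (simp add: gz)
    have 2: "g t = t" if eq: "norm (F z) = norm z" and t: "cmod t < 1" for t
    proof -
      have "\<exists>\<alpha>. (\<forall>z. norm z < 1 \<longrightarrow> g z = \<alpha> * z) \<and> norm \<alpha> = 1"
      proof (rule Schwarz_Lemma(3)[OF g g0 g1, where \<xi> = 0])
        show "(\<exists>w. cmod w < 1 \<and> w \<noteq> 0 \<and> cmod (g w) = cmod w) \<or> cmod (deriv g 0) = 1"
          by (intro disjI1 exI[of _ "of_real (norm z)"]) (use gz eq z \<open>z \<noteq> 0\<close> in auto)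
      qed auto
      then obtain \<alpha> where \<alpha>: "\<And>t. cmod t < 1 \<Longrightarrow> g t = \<alpha> * t" by blast
      from \<alpha>[of "of_real (norm z)"] gz eq z \<open>z \<noteq> 0\<close> have "\<alpha> = 1" by simp
      with \<alpha>[OF t] show ?thesis by simp
    qed
    show ?thesis
    proof (intro conjI impI allI)
      fix t assume e: "norm (F z) = norm z" and t: "cmod t < 1"
      show "cinner (F (t *s ((1 / norm z) *s z))) ((1 / norm z) *s F z) = t"
        using 2[OF e t] unfolding g_def u_def v_def e .
    qed (rule 1)
  qed
  show "norm (F z) \<le> norm z" using * F(3) by (cases "z = 0"; cases "F z = 0") auto
  show "cinner (F (t *s ((1 / norm z) *s z))) ((1 / norm z) *s F z) = t"
    if "norm (F z) = norm z" "z \<noteq> 0" "cmod t < 1"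
  proof -
    have "F z \<noteq> 0" using that by (metis norm_eq_zero)
    with *[OF that(2)] that show ?thesis by blast
  qed
qed

text \<open>With v the unit vector of F z, the Schwarz lemma gives <F (c z), v> = t, while |F (c z)|
  = |t|. This is equality in Cauchy-Schwarz, so F (c z) = t v.\<close>

lemma norm_preserving_homogeneous:
  fixes F :: "complex ^ 'n \<Rightarrow> complex ^ 'n"
  assumes F: "holo_map ballN F" "F 0 = 0" "\<And>z. norm z < 1 \<Longrightarrow> norm (F z) = norm z"
    and z: "norm z < 1" and cz: "norm (c *s z) < 1"
  shows "F (c *s z) = c *s F z"
proof (cases "z = 0")
  case True
  then show ?thesis by (simp add: F(2))
next
  case False
  define t where "t = c * norm z"
  define v where "v = (1 / norm z) *s F z"
  have t: "cmod t < 1" using cz by (simp add: t_def norm_mult)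
  have e: "t *s ((1 / norm z) *s z) = c *s z" using False by (simp add: t_def)
  have in1: "cinner (F (c *s z)) v = t"
    using ball_Schwarz(2)[OF F(1) _ F(2) z _ False t] F(3) z unfolding e v_def by simp
  have nv: "norm v = 1" using False F(3)[OF z] by (simp add: v_def norm_divide)
  have nF: "norm (F (c *s z)) = cmod t" using F(3)[OF cz] by (simp add: t_def norm_mult)
  have "cinner (F (c *s z) - t *s v) (F (c *s z) - t *s v) = 0"
  proof -
    have "cinner v (F (c *s z)) = cnj t" using in1 cnj_cinner by metis
    moreover have "cinner (F (c *s z)) (F (c *s z)) = t * cnj t" "cinner v v = 1"
      by (simp_all only: cinner_self nF nv complex_norm_square) simp_all
    ultimately show ?thesis
      by (simp only: cinner_diff_left cinner_diff_right cinner_scale_left cinner_scale_right in1) simp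
  qed
  then have "F (c *s z) = t *s v" by (simp add: cinner_self)
  also have "\<dots> = c *s F z" using False by (simp add: t_def v_def)
  finally show ?thesis .
qed

text \<open>A homogeneous map agrees with its derivative at 0, and that derivative is complex
  linear.\<close>

lemma norm_preserving_cisom:
  fixes F :: "complex ^ 'n \<Rightarrow> complex ^ 'n"
  assumes F: "holo_map ballN F" "F 0 = 0" "\<And>z. norm z < 1 \<Longrightarrow> norm (F z) = norm z"
  obtains U where "cisom U" "\<And>z. norm z < 1 \<Longrightarrow> F z = U z"
proof -
  have "\<forall>i. \<exists>L. ((\<lambda>z. F z $ i) has_derivative L) (at 0) \<and> (\<forall>c v. L (c *s v) = c * L v)"
    using F(1) unfolding holo_map_def holo_fun_def by (metis centre_in_ball zero_less_one)
  then obtain L where L: "\<And>i. ((\<lambda>z. F z $ i) has_derivative L i) (at 0)" "\<And>i c v. L i (c *s v) = c * L i v"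
    by metis
  define U where "U z = (\<chi> i. L i z)" for z
  have FU: "F z = U z" if z: "norm z < 1" for z
  proof (simp only: vec_eq_iff, intro allI)
    fix i
    have "((\<lambda>t::real. t *\<^sub>R z) has_derivative (\<lambda>t. t *\<^sub>R z)) (at 0)"
      by (auto intro!: derivative_eq_intros)
    from has_derivative_compose[OF this, of "\<lambda>z. F z $ i" "L i"] L(1)[of i]
    have h: "((\<lambda>t::real. F (t *\<^sub>R z) $ i) has_derivative (\<lambda>t. L i (t *\<^sub>R z))) (at 0)" by simp
    have h': "F (t *\<^sub>R z) $ i = t *\<^sub>R (F z $ i)" if "t \<in> ball 0 1" for t
    proof -
      have eq: "t *\<^sub>R w = complex_of_real t *s w" for w :: "complex ^ 'n"
        by (simp add: vec_eq_iff scaleR_conv_of_real[where 'a = complex])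
      have "norm (t *\<^sub>R z) \<le> norm z" using that mult_right_mono[of "\<bar>t\<bar>" 1 "norm z"] by simp
      then have "norm (complex_of_real t *s z) < 1" using z unfolding eq[symmetric] by simp
      from norm_preserving_homogeneous[OF F z this] show ?thesis
        unfolding eq by (simp add: scaleR_conv_of_real)
    qed
    have "((\<lambda>t::real. t *\<^sub>R (F z $ i)) has_derivative (\<lambda>t. L i (t *\<^sub>R z))) (at 0)"
      by (rule has_derivative_transform_within_open[OF h open_ball[of 0 1]]) (simp, rule h')
    moreover have "((\<lambda>t::real. t *\<^sub>R (F z $ i)) has_derivative (\<lambda>t. t *\<^sub>R (F z $ i))) (at 0)"
      by (auto intro!: derivative_eq_intros)
    ultimately have "(\<lambda>t. L i (t *\<^sub>R z)) = (\<lambda>t. t *\<^sub>R (F z $ i))" by (rule has_derivative_unique)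
    from fun_cong[OF this, of 1] show "F z $ i = U z $ i" by (simp add: U_def)
  qed
  have Uc: "U (c *s x) = c *s U x" for c x by (simp add: U_def L(2) vec_eq_iff)
  have Un: "norm (U x) = norm x" for x
  proof -
    \<comment> \<open>Scales x into the ball, where U agrees with F; homogeneity carries the norm
      back to x.\<close>
    define r where "r = 1 / (1 + norm x)"
    have r: "r > 0" "r * norm x < 1" by (auto simp: r_def add_pos_nonneg field_simps)
    have "norm (complex_of_real r *s x) < 1" using r by simp
    from F(3)[OF this] FU[OF this] r show ?thesis by (simp add: Uc)
  qed
  have "U (x + y) = U x + U y" for x y
    using has_derivative_linear[OF L(1)] by (simp add: U_def vec_eq_iff linear_add)
  with Uc Un have "cisom U" by (simp add: cisom_def)
  with FU show ?thesis using that by blast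
qed

lemma ball_aut_inv:
  assumes "ball_aut \<phi>"
  shows "norm z < 1 \<Longrightarrow> norm (\<phi> z) < 1" "norm z < 1 \<Longrightarrow> norm (inv_into ballN \<phi> z) < 1"
    "norm z < 1 \<Longrightarrow> inv_into ballN \<phi> (\<phi> z) = z" "norm z < 1 \<Longrightarrow> \<phi> (inv_into ballN \<phi> z) = z"
    "holo_map ballN \<phi>" "holo_map ballN (inv_into ballN \<phi>)"
proof -
  have b: "bij_betw \<phi> ballN ballN" using assms by (simp add: ball_aut_def)
  show "norm z < 1 \<Longrightarrow> norm (\<phi> z) < 1" using bij_betwE[OF b] by auto
  show "norm z < 1 \<Longrightarrow> norm (inv_into ballN \<phi> z) < 1" using bij_betwE[OF bij_betw_inv_into[OF b]] by auto
  show "norm z < 1 \<Longrightarrow> inv_into ballN \<phi> (\<phi> z) = z" using bij_betw_inv_into_left[OF b] by auto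
  show "norm z < 1 \<Longrightarrow> \<phi> (inv_into ballN \<phi> z) = z" using bij_betw_inv_into_right[OF b] by auto
qed (use assms in \<open>auto simp: ball_aut_def\<close>)

lemma holo_map_compose:
  assumes "holo_map S \<phi>" "\<And>z. z \<in> S \<Longrightarrow> \<phi> z \<in> T" "holo_map T \<psi>"
  shows "holo_map S (\<lambda>z. \<psi> (\<phi> z))"
  unfolding holo_map_def
proof
  fix i show "holo_fun S (\<lambda>z. \<psi> (\<phi> z) $ i)"
    using holo_fun_compose[OF assms(1,2), of "\<lambda>w. \<psi> w $ i"] assms(3) by (simp add: holo_map_def)
qed

text \<open>Precomposition with the involution at a makes \<phi> fix 0; the Schwarz lemma for the
  result and for its inverse forces norms to be preserved.\<close>

lemma ball_aut_form:
  fixes \<phi> :: "complex ^ 'n \<Rightarrow> complex ^ 'n"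
  assumes \<phi>: "ball_aut \<phi>" and a: "a = inv_into ballN \<phi> 0"
  obtains U where "cisom U" "\<And>z. norm z < 1 \<Longrightarrow> \<phi> z = U (moeb a z)"
proof -
  note A = ball_aut_inv[OF \<phi>]
  have na: "norm a < 1" using A(2)[of 0] a by simp
  define F where "F z = \<phi> (moeb a z)" for z
  define G where "G z = moeb a (inv_into ballN \<phi> z)" for z
  have F: "holo_map ballN F" "F 0 = 0" "\<And>z. norm z < 1 \<Longrightarrow> norm (F z) < 1"
    unfolding F_def using A(4)[of 0] A(1) norm_moeb_less_1[OF na]
    by (auto simp: a intro: holo_map_compose[OF holo_map_moeb[OF na] _ A(5), unfolded a])
  have G: "holo_map ballN G" "G 0 = 0" "\<And>z. norm z < 1 \<Longrightarrow> norm (G z) < 1"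
    unfolding G_def using A(2) norm_moeb_less_1[OF na] moeb_self[OF na]
    by (auto simp: a[symmetric] intro: holo_map_compose[OF A(6) _ holo_map_moeb[OF na]])
  have GF: "G (F z) = z" if "norm z < 1" for z
    unfolding G_def F_def using A(3) that norm_moeb_less_1[OF na that] moeb_moeb[OF na] by simp
  have "norm (F z) = norm z" if z: "norm z < 1" for z
    using ball_Schwarz(1)[OF F(1,3,2) z] ball_Schwarz(1)[OF G(1,3,2) F(3)[OF z]] GF[OF z] by simp
  from norm_preserving_cisom[OF F(1,2) this]
  obtain U where U: "cisom U" "\<And>z. norm z < 1 \<Longrightarrow> F z = U z" by blast
  show ?thesis
  proof (rule that[OF U(1)])
    fix z :: "complex ^ 'n" assume z: "norm z < 1"
    show "\<phi> z = U (moeb a z)"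
      using U(2)[OF norm_moeb_less_1[OF na z]] z by (simp add: F_def moeb_moeb[OF na])
  qed
qed

lemma ball_aut_cinner:
  assumes \<phi>: "ball_aut \<phi>" and a: "a = inv_into ballN \<phi> 0" and z: "norm z < 1" and w: "norm w < 1"
  shows "1 - cinner (\<phi> z) (\<phi> w) = of_real (1 - (norm a)\<^sup>2) * (1 - cinner z w) / ((1 - cinner z a) * (1 - cinner a w))"
proof -
  have na: "norm a < 1" using ball_aut_inv(2)[OF \<phi>, of 0] a by simp
  obtain U where "cisom U" "\<And>z. norm z < 1 \<Longrightarrow> \<phi> z = U (moeb a z)" using ball_aut_form[OF \<phi> a] by blast
  then show ?thesis using z w moeb_cinner[OF na, of z w] by (simp add: cisom_cinner)
qed

text \<open>\<phi> itself is arbitrary outside the open ball, so the boundary values belong to a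
  separate map, given by the closed form of \<phi>, which is continuous on the closed ball.\<close>

lemma ball_aut_extend:
  fixes \<phi> :: "complex ^ 'n \<Rightarrow> complex ^ 'n"
  assumes "ball_aut \<phi>"
  obtains \<Phi> where "continuous_on (cball 0 1) \<Phi>" "\<And>z. norm z < 1 \<Longrightarrow> \<Phi> z = \<phi> z" "\<And>z. norm z = 1 \<Longrightarrow> norm (\<Phi> z) = 1"
proof -
  define a where "a = inv_into ballN \<phi> 0"
  have na: "norm a < 1" using ball_aut_inv(2)[OF assms, of 0] by (simp add: a_def)
  obtain U where U: "cisom U" "\<And>z. norm z < 1 \<Longrightarrow> \<phi> z = U (moeb a z)" using ball_aut_form[OF assms a_def] by blast
  have "linear U"
  proof (rule linearI)
    show "U (x + y) = U x + U y" for x y using U(1) by (simp add: cisom_def)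
    have eq: "t *\<^sub>R w = complex_of_real t *s w" for t and w :: "complex ^ 'n"
      by (simp add: vec_eq_iff scaleR_conv_of_real[where 'a = complex])
    show "U (t *\<^sub>R x) = t *\<^sub>R U x" for t x unfolding eq using U(1) by (simp add: cisom_def)
  qed
  then have "continuous_on UNIV U" by (intro linear_continuous_on linear_linear[THEN iffD2]) 
  then have "continuous_on (cball 0 1) (\<lambda>z. U (moeb a z))"
    using continuous_on_compose2[OF _ continuous_on_moeb[OF na]] by auto
  then show ?thesis
    by (rule that) (use U norm_moeb_eq_1[OF na] in \<open>auto simp: cisom_def\<close>)
qed

text \<open>Logarithms of the transformation formula determine the kernel only up to multiples of 2
  pi i. The discrepancy h satisfies exp h = 1 and is continuous on a connected set, hence it is
  constant, and it is 0 at a.\<close>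

lemma kern_ball_aut:
  fixes \<phi> :: "complex ^ 'n \<Rightarrow> complex ^ 'n"
  assumes \<phi>: "ball_aut \<phi>" and a: "a = inv_into ballN \<phi> 0" and z: "norm z < 1" and w: "norm w < 1"
  shows "kern (\<phi> z) (\<phi> w) = kern z w - kern z a - kern a w + kern a a"
proof -
  note A = ball_aut_inv[OF \<phi>]
  have na: "norm a < 1" using A(2)[of 0] a by simp
  have \<phi>a: "\<phi> a = 0" using A(4)[of 0] a by simp
  define h where "h z = kern (\<phi> z) (\<phi> w) - kern z w + kern z a + (kern a w - kern a a)" for z
  have exp_kern: "exp (kern x y) = 1 / (1 - cinner x y)" if "norm x < 1" "norm y < 1" for x y :: "complex ^ 'n"
    using one_minus_cinner_nonzero[of x y] that by (simp add: kern_def exp_minus inverse_eq_divide)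
  have exph: "exp (h x) = 1" if x: "norm x < 1" for x
  proof -
    have "exp (h x) = (1 - cinner x w) * (1 - cinner a a) / ((1 - cinner (\<phi> x) (\<phi> w)) * (1 - cinner x a) * (1 - cinner a w))"
      unfolding h_def exp_add exp_diff using exp_kern A(1) x w na by simp
    also have "\<dots> = 1"
    proof -
      have "1 - cinner a a = of_real (1 - (norm a)\<^sup>2)" by (simp add: cinner_self)
      moreover have "complex_of_real (1 - (norm a)\<^sup>2) \<noteq> 0"
        using one_minus_norm_square_pos[OF na] by (metis less_irrefl of_real_eq_0_iff)
      moreover have "1 - cinner x w \<noteq> 0" "1 - cinner x a \<noteq> 0" "1 - cinner a w \<noteq> 0"
        using one_minus_cinner_nonzero[of x w] one_minus_cinner_nonzero[of x a] one_minus_cinner_nonzero[of a w] x w na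
        by (simp_all del: right_minus_eq)
      moreover have "q * s / (s * q / (r * t) * r * t) = 1" if "s \<noteq> 0" "q \<noteq> 0" "r \<noteq> 0" "t \<noteq> 0" for q r s t :: complex
        using that by simp
      ultimately show ?thesis
        unfolding ball_aut_cinner[OF \<phi> a x w] by simp
    qed
    finally show ?thesis .
  qed
  have "holo_fun ballN h"
    unfolding h_def[abs_def]
    by (intro holo_fun_add holo_fun_diff holo_fun_const holo_fun_kern w na holo_fun_compose[OF A(5) _ holo_fun_kern]) (use A(1) w in auto)
  then have ch: "continuous_on ballN h" by (rule holo_fun_continuous_on)
  have "h constant_on ballN"
  proof (rule continuous_discrete_range_constant[OF connected_ball ch])
    fix x :: "complex ^ 'n" assume x: "x \<in> ballN"
    have "2 * pi \<le> cmod (h y - h x)" if y: "y \<in> ballN" "h y \<noteq> h x" for y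
    proof -
      have "exp (h y - h x) = 1" using exph x y by (simp add: exp_diff)
      then obtain n :: int where n: "Re (h y - h x) = 0" "Im (h y - h x) = of_int (2 * n) * pi"
        unfolding exp_eq_1 by blast
      have "n \<noteq> 0"
      proof
        assume "n = 0"
        then have "h y - h x = 0" using n by (simp add: complex_eq_iff)
        then show False using y by simp
      qed
      then have "1 \<le> \<bar>of_int n :: real\<bar>" by linarith
      then have "2 * pi * 1 \<le> 2 * pi * \<bar>of_int n\<bar>" by (intro mult_left_mono) auto
      also have "\<dots> = \<bar>Im (h y - h x)\<bar>" unfolding n(2) by (simp add: abs_mult)
      also have "\<dots> \<le> cmod (h y - h x)" by (rule abs_Im_le_cmod)
      finally show ?thesis by simp
    qed
    then show "\<exists>e>0. \<forall>y. y \<in> ballN \<and> h y \<noteq> h x \<longrightarrow> e \<le> cmod (h y - h x)"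
      using pi_gt_zero by (intro exI[of _ "2 * pi"]) auto
  qed
  then obtain c where c: "\<And>x. norm x < 1 \<Longrightarrow> h x = c" unfolding constant_on_def by auto
  \<comment> \<open>\<open>\<phi> a = 0\<close> kills the first kernel; the remaining four terms
    cancel in pairs.\<close>
  have "h a = 0" by (simp add: h_def \<phi>a)
  with c[OF na] c[OF z] have "h z = 0" by simp
  then show ?thesis by (simp add: h_def algebra_simps)
qed

subsection \<open>Invariance of the Dirichlet seminorm\<close>

text \<open>The gain behind the later interchange of sums: on a smaller ball
  \<open>efun \<beta> (\<phi> z)\<close> decays like r^|\<beta>|.\<close>

lemma ball_aut_shrinks_cball:
  fixes \<phi> :: "complex ^ 'a \<Rightarrow> complex ^ 'a"
  assumes \<phi>: "ball_aut \<phi>" and s: "s < 1"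
  obtains r where "0 \<le> r" "r < 1" "\<And>z. norm z \<le> s \<Longrightarrow> norm (\<phi> z) \<le> r"
proof (cases "s \<ge> 0")
  case True
  obtain \<Phi> :: "complex ^ 'a \<Rightarrow> complex ^ 'a" where \<Phi>: "continuous_on (cball 0 1) \<Phi>" "\<And>z. norm z < 1 \<Longrightarrow> \<Phi> z = \<phi> z" "\<And>z. norm z = 1 \<Longrightarrow> norm (\<Phi> z) = 1"
    using ball_aut_extend[OF \<phi>] by blast
  have sub: "cball 0 s \<subseteq> cball (0 :: complex ^ 'a) 1" using s by (intro subset_cball) simp
  have "continuous_on (cball 0 s) (\<lambda>z. norm (\<Phi> z))"
    by (rule continuous_on_norm[OF continuous_on_subset[OF \<Phi>(1) sub]])
  then obtain x where x: "x \<in> cball 0 s" "\<forall>y\<in>cball 0 s. norm (\<Phi> y) \<le> norm (\<Phi> x)"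
    using continuous_attains_sup[of "cball 0 s" "\<lambda>z. norm (\<Phi> z)"] True by auto
  show ?thesis
  proof (rule that[of "norm (\<Phi> x)"])
    show "norm (\<Phi> x) < 1" using ball_aut_inv(1)[OF \<phi>, of x] \<Phi>(2)[of x] x(1) s by simp
    show "norm (\<phi> z) \<le> norm (\<Phi> x)" if "norm z \<le> s" for z
      using x(2) \<Phi>(2)[of z] that s by (metis dual_order.strict_trans2 mem_cball_0)
  qed simp
next
  case False
  then have "norm z \<le> s \<Longrightarrow> norm (\<phi> z) \<le> 0" for z using norm_ge_zero[of z] by linarith
  then show ?thesis using that[of 0] by auto
qed

text \<open>Up to constants, \<open>amat \<phi>\<close> is the matrix of composition with \<open>\<phi>\<close> in the basis of normalised monomials.
  Invariance of the kernel says that its rows are orthonormal, so Bessel's inequality makes composition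
  a contraction; applied to the inverse as well, this gives an isometry.\<close>

definition amat :: "(complex ^ 'n \<Rightarrow> complex ^ 'n) \<Rightarrow> nat ^ 'n \<Rightarrow> nat ^ 'n \<Rightarrow> complex" where
  "amat \<phi> \<beta> \<alpha> = dc (\<lambda>z. efun \<beta> (\<phi> z)) \<alpha>"

definition afun :: "(complex ^ 'n \<Rightarrow> complex ^ 'n) \<Rightarrow> nat ^ 'n \<Rightarrow> complex ^ 'n \<Rightarrow> complex" where
  "afun \<phi> \<beta> z = efun \<beta> (\<phi> z) - efun \<beta> (\<phi> 0)"

lemma holo_fun_compose_aut:
  assumes "ball_aut \<phi>" "holo_fun ballN f"
  shows "holo_fun ballN (\<lambda>z. f (\<phi> z))"
  by (rule holo_fun_compose[OF ball_aut_inv(5)[OF assms(1)] _ assms(2)])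
     (use ball_aut_inv(1)[OF assms(1)] in auto)

lemma afun_has_sum:
  assumes "ball_aut \<phi>" "norm z < 1"
  shows "((\<lambda>\<alpha>. amat \<phi> \<beta> \<alpha> * efun \<alpha> z) has_sum afun \<phi> \<beta> z) UNIV"
  unfolding amat_def afun_def
  by (rule dc_has_sum[OF holo_fun_compose_aut[OF assms(1) holo_fun_efun] assms(2)])

lemma amat_0 [simp]: "amat \<phi> \<beta> 0 = 0"
  by (simp add: amat_def)

text \<open>Decay in \<beta> comes from \<phi> mapping the half ball into a ball of radius r < 1,
  growth in \<alpha> from the Cauchy estimate on a polydisc of radius \<rho>. The series in \<alpha>
  is therefore controlled only for |z| < \<rho>.\<close>

lemma amat_bounds:
  fixes \<phi> :: "complex ^ 'n \<Rightarrow> complex ^ 'n"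
  assumes \<phi>: "ball_aut \<phi>"
  obtains r \<rho> where "0 \<le> r" "r < 1" "0 < \<rho>"
    "\<And>\<alpha> \<beta> z. cmod (amat \<phi> \<beta> \<alpha> * efun \<alpha> z) \<le> r ^ mi_abs \<beta> * (norm z / \<rho>) ^ mi_abs \<alpha>"
    "\<And>\<alpha> \<beta>. cmod (amat \<phi> \<beta> \<alpha>) \<le> r ^ mi_abs \<beta> * (sqrt (dweight \<alpha>) / \<rho> ^ mi_abs \<alpha>)"
proof -
  obtain \<rho> :: real where \<rho>: "\<rho> > 0" "norm (\<chi> (i::'n). \<rho>) \<le> 1/2" by (rule small_polyradius)
  obtain r where r: "0 \<le> r" "r < 1" "\<And>z. norm z \<le> 1/2 \<Longrightarrow> norm (\<phi> z) \<le> r"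
    using ball_aut_shrinks_cball[OF \<phi>, of "1/2"] by auto
  have d: "cmod (dcoeff (\<lambda>z. efun \<beta> (\<phi> z)) \<alpha>) \<le> r ^ mi_abs \<beta> / \<rho> ^ mi_abs \<alpha>" for \<alpha> \<beta>
  proof -
    have "cmod (dcoeff (\<lambda>z. efun \<beta> (\<phi> z)) \<alpha>) * (\<Prod>i\<in>UNIV. \<rho> ^ (\<alpha> $ i)) \<le> r ^ mi_abs \<beta>"
    proof (rule dcoeff_bound[where r = "1/2"])
      show "holo_fun ballN (\<lambda>z. efun \<beta> (\<phi> z))" by (rule holo_fun_compose_aut[OF \<phi> holo_fun_efun])
      show "cmod (efun \<beta> (\<phi> z)) \<le> r ^ mi_abs \<beta>" if "norm z \<le> 1/2" for z
        using norm_efun_le[of \<beta> "\<phi> z"] power_mono[OF r(3)[OF that] norm_ge_zero, of "mi_abs \<beta>"] by linarith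
    qed (use \<rho> in auto)
    then show ?thesis using \<rho>(1) by (simp add: prod_const_power field_simps)
  qed
  show ?thesis
  proof (rule that[OF r(1,2) \<rho>(1)])
    fix \<alpha> \<beta> :: "nat ^ 'n" and z :: "complex ^ 'n"
    show "cmod (amat \<phi> \<beta> \<alpha>) \<le> r ^ mi_abs \<beta> * (sqrt (dweight \<alpha>) / \<rho> ^ mi_abs \<alpha>)"
      using mult_right_mono[OF d[of \<beta> \<alpha>], of "sqrt (dweight \<alpha>)"] dweight_nonneg[of \<alpha>]
      by (simp add: amat_def dc_def norm_mult)
    show "cmod (amat \<phi> \<beta> \<alpha> * efun \<alpha> z) \<le> r ^ mi_abs \<beta> * (norm z / \<rho>) ^ mi_abs \<alpha>"
    proof (cases "\<alpha> = 0")
      case True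
      then show ?thesis using r by simp
    next
      case False
      have "cmod (mono_pow \<alpha> z) \<le> norm z ^ mi_abs \<alpha>"
        unfolding norm_mono_pow prod_const_power[symmetric]
        by (intro prod_mono conjI power_mono Finite_Cartesian_Product.norm_nth_le) auto
      then have "cmod (dcoeff (\<lambda>z. efun \<beta> (\<phi> z)) \<alpha>) * cmod (mono_pow \<alpha> z) \<le> (r ^ mi_abs \<beta> / \<rho> ^ mi_abs \<alpha>) * norm z ^ mi_abs \<alpha>"
        using d r \<rho> by (intro mult_mono) auto
      then show ?thesis using False by (simp add: amat_def dc_times_efun norm_mult power_divide)
    qed
  qed
qed

text \<open>Each \<open>afun\<close> is expanded and the double series interchanged. This is
  justified for |z| < \<rho>, which suffices to identify coefficients; boundedness of h is enough
  thanks to the decay in \<beta>.\<close>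

lemma dc_afun_series:
  fixes \<phi> :: "complex ^ 'n \<Rightarrow> complex ^ 'n"
  assumes \<phi>: "ball_aut \<phi>" and f: "holo_fun ballN f" and B: "\<And>\<beta>. cmod (h \<beta>) \<le> B"
    and s: "\<And>z. norm z < 1 \<Longrightarrow> ((\<lambda>\<beta>. h \<beta> * afun \<phi> \<beta> z) has_sum (f z - f 0)) UNIV"
  shows "((\<lambda>\<beta>. h \<beta> * amat \<phi> \<beta> \<alpha>) has_sum dc f \<alpha>) UNIV"
proof -
  obtain r \<rho> where r: "0 \<le> r" "r < 1" "0 < \<rho>"
    "\<And>\<alpha> \<beta> z. cmod (amat \<phi> \<beta> \<alpha> * efun \<alpha> z) \<le> r ^ mi_abs \<beta> * (norm z / \<rho>) ^ mi_abs \<alpha>"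
    "\<And>\<alpha> \<beta>. cmod (amat \<phi> \<beta> \<alpha>) \<le> r ^ mi_abs \<beta> * (sqrt (dweight \<alpha>) / \<rho> ^ mi_abs \<alpha>)"
    using amat_bounds[OF \<phi>] by blast
  have B0: "0 \<le> B" using B[of 0] norm_ge_zero[of "h 0"] by linarith
  have rs: "(\<lambda>\<beta> :: nat ^ 'n. r ^ mi_abs \<beta>) summable_on UNIV" using r by (intro summable_power_mi_abs)
  define b where "b \<alpha> = (\<Sum>\<^sub>\<infinity>\<beta>. h \<beta> * amat \<phi> \<beta> \<alpha>)" for \<alpha>
  have b: "((\<lambda>\<beta>. h \<beta> * amat \<phi> \<beta> \<alpha>) has_sum b \<alpha>) UNIV" for \<alpha>
    unfolding b_def
  proof (rule has_sum_infsum, rule abs_summable_summable, rule Infinite_Sum.abs_summable_on_comparison_test')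
    let ?C = "sqrt (dweight \<alpha>) / \<rho> ^ mi_abs \<alpha>"
    show "(\<lambda>\<beta> :: nat ^ 'n. B * (r ^ mi_abs \<beta> * ?C)) summable_on UNIV"
      by (intro summable_on_cmult_right summable_on_cmult_left rs)
    show "norm (h \<beta> * amat \<phi> \<beta> \<alpha>) \<le> B * (r ^ mi_abs \<beta> * ?C)" for \<beta>
      unfolding norm_mult by (intro mult_mono B r(5) B0) auto
  qed
  have "dc f = b"
  proof (rule dc_unique[OF f _ r(3)])
    show "b 0 = 0" by (simp add: b_def)
    fix z :: "complex ^ 'n" assume z: "norm z < 1" "norm z < \<rho>"
    define F where "F \<beta> \<alpha> = h \<beta> * (amat \<phi> \<beta> \<alpha> * efun \<alpha> z)" for \<beta> \<alpha>
    have q: "0 \<le> norm z / \<rho>" "norm z / \<rho> < 1" using z r(3) by auto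
    have "(\<lambda>(\<beta>,\<alpha>). r ^ mi_abs \<beta> * (norm z / \<rho>) ^ mi_abs \<alpha>) summable_on ((UNIV :: (nat ^ 'n) set) \<times> (UNIV :: (nat ^ 'n) set))"
    proof (rule summable_on_SigmaI[where g = "\<lambda>\<beta> :: nat ^ 'n. r ^ mi_abs \<beta> * (\<Sum>\<^sub>\<infinity>\<alpha> :: nat ^ 'n. (norm z / \<rho>) ^ mi_abs \<alpha>)"])
      show "((\<lambda>\<alpha> :: nat ^ 'n. case (\<beta>, \<alpha>) of (\<beta>, \<alpha>) \<Rightarrow> r ^ mi_abs \<beta> * (norm z / \<rho>) ^ mi_abs \<alpha>) has_sum
        r ^ mi_abs \<beta> * (\<Sum>\<^sub>\<infinity>\<alpha> :: nat ^ 'n. (norm z / \<rho>) ^ mi_abs \<alpha>)) UNIV" for \<beta> :: "nat ^ 'n"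
        unfolding prod.case by (intro has_sum_cmult_right has_sum_infsum summable_power_mi_abs q)
      show "(\<lambda>\<beta> :: nat ^ 'n. r ^ mi_abs \<beta> * (\<Sum>\<^sub>\<infinity>\<alpha> :: nat ^ 'n. (norm z / \<rho>) ^ mi_abs \<alpha>)) summable_on UNIV"
        by (intro summable_on_cmult_left rs)
    qed (use r(1,3) in auto)
    from summable_on_cmult_right[OF this, of B]
    have g: "(\<lambda>p. B * (case p of (\<beta>,\<alpha>) \<Rightarrow> r ^ mi_abs \<beta> * (norm z / \<rho>) ^ mi_abs \<alpha>)) summable_on ((UNIV :: (nat ^ 'n) set) \<times> (UNIV :: (nat ^ 'n) set))" .
    have sm: "(\<lambda>(\<beta>,\<alpha>). F \<beta> \<alpha>) summable_on (UNIV \<times> UNIV)"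
    proof (rule abs_summable_summable, rule Infinite_Sum.abs_summable_on_comparison_test'[OF g])
      show "norm (case p of (\<beta>,\<alpha>) \<Rightarrow> F \<beta> \<alpha>) \<le> B * (case p of (\<beta>,\<alpha>) \<Rightarrow> r ^ mi_abs \<beta> * (norm z / \<rho>) ^ mi_abs \<alpha>)" for p
        unfolding F_def case_prod_unfold norm_mult[of "h _"] by (intro mult_mono B r(4) B0) auto
    qed
    have "((\<lambda>(\<beta>,\<alpha>). F \<beta> \<alpha>) has_sum (f z - f 0)) (UNIV \<times> UNIV)"
    proof (rule has_sum_SigmaI[OF _ s[OF z(1)] sm])
      show "((\<lambda>\<alpha>. case (\<beta>, \<alpha>) of (\<beta>, \<alpha>) \<Rightarrow> F \<beta> \<alpha>) has_sum h \<beta> * afun \<phi> \<beta> z) UNIV" for \<beta>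
        unfolding F_def by (auto intro!: has_sum_cmult_right afun_has_sum[OF \<phi> z(1)])
    qed
    then have "((\<lambda>(\<alpha>,\<beta>). F \<beta> \<alpha>) has_sum (f z - f 0)) (UNIV \<times> UNIV)"
      by (subst (asm) has_sum_swap) (simp add: case_prod_unfold)
    then show "((\<lambda>\<alpha>. b \<alpha> * efun \<alpha> z) has_sum (f z - f 0)) UNIV"
    proof (rule has_sum_SigmaD)
      fix \<alpha>
      have "((\<lambda>\<beta>. h \<beta> * amat \<phi> \<beta> \<alpha> * efun \<alpha> z) has_sum b \<alpha> * efun \<alpha> z) UNIV"
        by (rule has_sum_cmult_left[OF b])
      then show "((\<lambda>\<beta>. case (\<alpha>, \<beta>) of (\<alpha>, \<beta>) \<Rightarrow> F \<beta> \<alpha>) has_sum b \<alpha> * efun \<alpha> z) UNIV"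
        by (simp add: F_def mult_ac)
    qed
  qed
  with b show ?thesis by simp
qed

text \<open>\<open>kern_ball_aut\<close> leaves error terms in z alone or in w alone; the
  alternating sum over the pairs from {z, 0} and {w, 0} cancels them.\<close>

lemma afun_kern_has_sum:
  assumes \<phi>: "ball_aut \<phi>" and z: "norm z < 1" and w: "norm w < 1"
  shows "((\<lambda>\<beta>. cnj (afun \<phi> \<beta> w) * afun \<phi> \<beta> z) has_sum kern z w) UNIV"
proof -
  note A = ball_aut_inv[OF \<phi>]
  have 0: "norm (0 :: complex ^ 'a) < 1" by simp
  let ?e = "\<lambda>x y \<beta>. efun \<beta> (\<phi> x) * cnj (efun \<beta> (\<phi> y))"
  have k: "(?e x y has_sum kern (\<phi> x) (\<phi> y)) UNIV" if "norm x < 1" "norm y < 1" for x y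
    by (rule kern_has_sum) (use A(1) that in auto)
  have "((\<lambda>\<beta>. (?e z w \<beta> + - ?e z 0 \<beta>) + (- ?e 0 w \<beta> + ?e 0 0 \<beta>)) has_sum
     (kern (\<phi> z) (\<phi> w) + - kern (\<phi> z) (\<phi> 0)) + (- kern (\<phi> 0) (\<phi> w) + kern (\<phi> 0) (\<phi> 0))) UNIV"
    by (intro has_sum_add has_sum_uminusI k z w 0)
  moreover have "(kern (\<phi> z) (\<phi> w) + - kern (\<phi> z) (\<phi> 0)) + (- kern (\<phi> 0) (\<phi> w) + kern (\<phi> 0) (\<phi> 0)) = kern z w"
    unfolding kern_ball_aut[OF \<phi> refl z w] kern_ball_aut[OF \<phi> refl z 0] kern_ball_aut[OF \<phi> refl 0 w]
      kern_ball_aut[OF \<phi> refl 0 0] by simp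
  moreover have "(\<lambda>\<beta>. (?e z w \<beta> + - ?e z 0 \<beta>) + (- ?e 0 w \<beta> + ?e 0 0 \<beta>)) = (\<lambda>\<beta>. cnj (afun \<phi> \<beta> w) * afun \<phi> \<beta> z)"
    by (simp add: afun_def algebra_simps)
  ultimately show ?thesis by simp
qed

lemma norm_afun_le:
  assumes "ball_aut \<phi>" "norm w < 1" shows "cmod (afun \<phi> \<beta> w) \<le> 2"
  using norm_triangle_ineq4[of "efun \<beta> (\<phi> w)" "efun \<beta> (\<phi> 0)"] norm_efun_le_1[of "\<phi> w" \<beta>] norm_efun_le_1[of "\<phi> 0" \<beta>]
    ball_aut_inv(1)[OF assms(1), of w] ball_aut_inv(1)[OF assms(1), of 0] assms(2) by (simp add: afun_def)

lemma dc_efun: "dc (efun \<alpha>) = (\<lambda>\<gamma>. if \<gamma> = \<alpha> \<and> \<alpha> \<noteq> 0 then 1 else 0)"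
proof (rule dc_unique[OF holo_fun_efun _ zero_less_one])
  fix z :: "complex ^ 'a"
  have "((\<lambda>\<gamma>. if \<gamma> = \<alpha> then efun \<alpha> z else 0) has_sum efun \<alpha> z) UNIV" by (rule has_sum_delta)
  moreover have "(\<lambda>\<gamma>. (if \<gamma> = \<alpha> \<and> \<alpha> \<noteq> 0 then 1 else 0) * efun \<gamma> z) = (\<lambda>\<gamma>. if \<gamma> = \<alpha> then efun \<alpha> z else 0)" by auto
  ultimately show "((\<lambda>\<gamma>. (if \<gamma> = \<alpha> \<and> \<alpha> \<noteq> 0 then 1 else 0) * efun \<gamma> z) has_sum efun \<alpha> z - efun \<alpha> 0) UNIV" by simp
qed auto

text \<open>Coefficients are compared twice: first in z, with the kernel written as a series of
  \<open>afun\<close>, then in w, with the resulting series for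
  \<open>efun \<alpha>\<close>.\<close>

lemma amat_orthonormal:
  fixes \<phi> :: "complex ^ 'n \<Rightarrow> complex ^ 'n"
  assumes \<phi>: "ball_aut \<phi>"
  shows "((\<lambda>\<beta>. cnj (amat \<phi> \<beta> \<alpha>) * amat \<phi> \<beta> \<gamma>) has_sum (if \<gamma> = \<alpha> \<and> \<alpha> \<noteq> 0 then 1 else 0)) UNIV"
proof -
  have 1: "((\<lambda>\<beta>. cnj (amat \<phi> \<beta> \<alpha>) * afun \<phi> \<beta> w) has_sum efun \<alpha> w) UNIV" if w: "norm w < 1" for w
  proof -
    have "((\<lambda>\<beta>. cnj (afun \<phi> \<beta> w) * amat \<phi> \<beta> \<alpha>) has_sum dc (\<lambda>z. kern z w) \<alpha>) UNIV"
      by (rule dc_afun_series[OF \<phi> holo_fun_kern[OF w], where B = 2])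
         (use norm_afun_le[OF \<phi> w] afun_kern_has_sum[OF \<phi> _ w] in auto)
    then have "((\<lambda>\<beta>. cnj (cnj (afun \<phi> \<beta> w) * amat \<phi> \<beta> \<alpha>)) has_sum cnj (dc (\<lambda>z. kern z w) \<alpha>)) UNIV"
      by (simp only: has_sum_cnj_iff)
    then show ?thesis by (simp add: dc_kern[OF w] mult.commute)
  qed
  obtain r \<rho> where r: "0 \<le> r" "r < 1" "0 < \<rho>"
    "\<And>\<alpha> \<beta> z. cmod (amat \<phi> \<beta> \<alpha> * efun \<alpha> z) \<le> r ^ mi_abs \<beta> * (norm z / \<rho>) ^ mi_abs \<alpha>"
    "\<And>\<alpha> \<beta>. cmod (amat \<phi> \<beta> \<alpha>) \<le> r ^ mi_abs \<beta> * (sqrt (dweight \<alpha>) / \<rho> ^ mi_abs \<alpha>)"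
    using amat_bounds[OF \<phi>] by blast
  let ?C = "sqrt (dweight \<alpha>) / \<rho> ^ mi_abs \<alpha>"
  have C: "cmod (amat \<phi> \<beta> \<alpha>) \<le> ?C" for \<beta>
  proof -
    have "r ^ mi_abs \<beta> * ?C \<le> 1 * ?C"
      using r by (intro mult_right_mono power_le_one) (auto simp: dweight_nonneg)
    with r(5)[of \<beta> \<alpha>] show ?thesis by simp
  qed
  have "((\<lambda>\<beta>. cnj (amat \<phi> \<beta> \<alpha>) * amat \<phi> \<beta> \<gamma>) has_sum dc (efun \<alpha>) \<gamma>) UNIV"
    by (rule dc_afun_series[OF \<phi> holo_fun_efun, where B = ?C]) (use C 1 in auto)
  then show ?thesis by (simp add: dc_efun)
qed

section \<open>Composition as an isometry of the seminorm\<close>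

lemma has_sum_finite_sum:
  assumes "finite A" "\<And>i. i \<in> A \<Longrightarrow> (f i has_sum (s i :: complex)) S"
  shows "((\<lambda>x. \<Sum>i\<in>A. f i x) has_sum (\<Sum>i\<in>A. s i)) S"
  using assms by (induction A rule: finite_induct) (auto intro!: has_sum_add)

lemma l2_le: "l2 a \<Longrightarrow> cmod (a x) \<le> l2norm a"
  using l2_partial_sum_le[of a "{x}"] by (auto intro: power2_le_imp_le)

lemma l2_sum:
  assumes "finite A" "\<And>i. i \<in> A \<Longrightarrow> l2 (a i)"
  shows "l2 (\<lambda>x. \<Sum>i\<in>A. a i x)"
  using assms by (induction A rule: finite_induct) (auto intro!: l2_add)

text \<open>Bessel's inequality over a finite S: the combination y has both its pairing with
  \<open>dc f\<close> and its squared norm equal to X, so Cauchy-Schwarz gives X \<le>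
  \<open>l2norm (dc f)\<close> sqrt X, which bounds X uniformly in S.\<close>

lemma dc_compose_aut:
  fixes \<phi> :: "complex ^ 'n \<Rightarrow> complex ^ 'n"
  assumes \<phi>: "ball_aut \<phi>" and f: "f \<in> dir_space"
  shows "l2 (dc (\<lambda>z. f (\<phi> z)))" "l2norm (dc (\<lambda>z. f (\<phi> z))) \<le> l2norm (dc f)"
proof -
  note A = ball_aut_inv[OF \<phi>]
  have hf: "holo_fun ballN f" and lf: "l2 (dc f)" using f by (auto simp: dir_space_iff)
  define x where "x = dc (\<lambda>z. f (\<phi> z))"
  have x: "((\<lambda>\<beta>. dc f \<beta> * amat \<phi> \<beta> \<alpha>) has_sum x \<alpha>) UNIV" for \<alpha>
    unfolding x_def
  proof (rule dc_afun_series[OF \<phi> holo_fun_compose_aut[OF \<phi> hf] l2_le[OF lf]])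
    fix z :: "complex ^ 'n" assume z: "norm z < 1"
    have "((\<lambda>\<beta>. dc f \<beta> * efun \<beta> (\<phi> z) + - (dc f \<beta> * efun \<beta> (\<phi> 0))) has_sum ((f (\<phi> z) - f 0) + - (f (\<phi> 0) - f 0))) UNIV"
      by (intro has_sum_add has_sum_uminusI dc_has_sum[OF hf] A(1) z) simp
    then show "((\<lambda>\<beta>. dc f \<beta> * afun \<phi> \<beta> z) has_sum (f (\<phi> z) - f (\<phi> 0))) UNIV"
      by (simp add: afun_def algebra_simps)
  qed
  have la: "l2 (\<lambda>\<beta>. amat \<phi> \<beta> \<alpha>)" for \<alpha>
  proof -
    have "((\<lambda>\<beta>. complex_of_real ((cmod (amat \<phi> \<beta> \<alpha>))\<^sup>2)) has_sum (if \<alpha> \<noteq> 0 then 1 else 0)) UNIV"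
      using amat_orthonormal[OF \<phi>, of \<alpha> \<alpha>] unfolding complex_norm_square by (simp add: mult.commute)
    then have "(\<lambda>\<beta>. Re (complex_of_real ((cmod (amat \<phi> \<beta> \<alpha>))\<^sup>2))) summable_on UNIV"
      by (intro summable_on_Re) (auto simp: summable_on_def)
    then show ?thesis by (simp add: l2_def)
  qed
  have bessel: "(\<Sum>\<alpha>\<in>S. (cmod (x \<alpha>))\<^sup>2) \<le> (l2norm (dc f))\<^sup>2" if S: "finite S" for S
  proof -
    define X where "X = (\<Sum>\<alpha>\<in>S. (cmod (x \<alpha>))\<^sup>2)"
    have X0: "X \<ge> 0" by (simp add: X_def sum_nonneg)
    define y where "y \<beta> = (\<Sum>\<alpha>\<in>S. cnj (x \<alpha>) * amat \<phi> \<beta> \<alpha>)" for \<beta>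
    have ly: "l2 y" unfolding y_def[abs_def] by (intro l2_sum S l2_cmult la)
    have "((\<lambda>\<beta>. \<Sum>\<alpha>\<in>S. cnj (x \<alpha>) * (dc f \<beta> * amat \<phi> \<beta> \<alpha>)) has_sum (\<Sum>\<alpha>\<in>S. cnj (x \<alpha>) * x \<alpha>)) UNIV"
      by (intro has_sum_finite_sum S has_sum_cmult_right x)
    also have "(\<lambda>\<beta>. \<Sum>\<alpha>\<in>S. cnj (x \<alpha>) * (dc f \<beta> * amat \<phi> \<beta> \<alpha>)) = (\<lambda>\<beta>. dc f \<beta> * y \<beta>)"
      by (simp add: y_def sum_distrib_left mult_ac)
    also have "(\<Sum>\<alpha>\<in>S. cnj (x \<alpha>) * x \<alpha>) = of_real X"
      unfolding X_def of_real_sum complex_norm_square by (simp add: mult.commute)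
    finally have X1: "(\<Sum>\<^sub>\<infinity>\<beta>. dc f \<beta> * y \<beta>) = of_real X" by (rule infsumI)
    have "X \<le> l2norm (dc f) * l2norm y"
      using l2_Cauchy_Schwarz[OF lf ly] X0 by (simp add: X1)
    moreover have "(l2norm y)\<^sup>2 = X"
    proof -
      have "((\<lambda>\<beta>. \<Sum>\<alpha>\<in>S. \<Sum>\<gamma>\<in>S. (x \<alpha> * cnj (x \<gamma>)) * (cnj (amat \<phi> \<beta> \<alpha>) * amat \<phi> \<beta> \<gamma>)) has_sum
         (\<Sum>\<alpha>\<in>S. \<Sum>\<gamma>\<in>S. (x \<alpha> * cnj (x \<gamma>)) * (if \<gamma> = \<alpha> \<and> \<alpha> \<noteq> 0 then 1 else 0))) UNIV"
        by (intro has_sum_finite_sum S has_sum_cmult_right amat_orthonormal[OF \<phi>])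
      also have "(\<lambda>\<beta>. \<Sum>\<alpha>\<in>S. \<Sum>\<gamma>\<in>S. (x \<alpha> * cnj (x \<gamma>)) * (cnj (amat \<phi> \<beta> \<alpha>) * amat \<phi> \<beta> \<gamma>)) = (\<lambda>\<beta>. y \<beta> * cnj (y \<beta>))"
        by (simp add: y_def sum_product mult_ac)
      also have "(\<Sum>\<alpha>\<in>S. \<Sum>\<gamma>\<in>S. (x \<alpha> * cnj (x \<gamma>)) * (if \<gamma> = \<alpha> \<and> \<alpha> \<noteq> 0 then 1 else 0)) = (\<Sum>\<alpha>\<in>S. x \<alpha> * cnj (x \<alpha>))"
      proof (rule sum.cong[OF refl])
        fix \<alpha> assume "\<alpha> \<in> S"
        \<comment> \<open>At \<alpha> = 0 orthonormality fails, but every \<open>dc\<close> vanishes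
          there and so does x.\<close>
        have "(\<Sum>\<gamma>\<in>S. (x \<alpha> * cnj (x \<gamma>)) * (if \<gamma> = \<alpha> \<and> \<alpha> \<noteq> 0 then 1 else 0)) = (\<Sum>\<gamma>\<in>S. if \<gamma> = \<alpha> then x \<alpha> * cnj (x \<alpha>) else 0)"
          by (rule sum.cong) (auto simp: x_def)
        then show "(\<Sum>\<gamma>\<in>S. (x \<alpha> * cnj (x \<gamma>)) * (if \<gamma> = \<alpha> \<and> \<alpha> \<noteq> 0 then 1 else 0)) = x \<alpha> * cnj (x \<alpha>)"
          using S \<open>\<alpha> \<in> S\<close> by simp
      qed
      also have "\<dots> = of_real X" unfolding X_def of_real_sum complex_norm_square ..
      finally have "(\<Sum>\<^sub>\<infinity>\<beta>. y \<beta> * cnj (y \<beta>)) = of_real X" by (rule infsumI)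
      then show ?thesis unfolding infsum_self_cnj[OF ly] by (simp only: of_real_eq_iff)
    qed
    ultimately have "X \<le> l2norm (dc f) * sqrt X" using l2norm_nonneg by (metis real_sqrt_unique)
    then have "X\<^sup>2 \<le> (l2norm (dc f))\<^sup>2 * X" using X0 power_mono[of X "l2norm (dc f) * sqrt X" 2] by (simp add: power_mult_distrib)
    then have "X * X \<le> (l2norm (dc f))\<^sup>2 * X" by (simp add: power2_eq_square)
    then have "X \<le> (l2norm (dc f))\<^sup>2" using X0 by (cases "X = 0") (auto simp: mult_le_cancel_right)
    then show ?thesis by (simp add: X_def)
  qed
  show l: "l2 (dc (\<lambda>z. f (\<phi> z)))"
    unfolding l2_def x_def[symmetric]
    by (rule nonneg_bounded_partial_sums_imp_summable_on[where C = "(l2norm (dc f))\<^sup>2"])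
       (use bessel in \<open>auto intro!: eventually_finite_subsets_at_top_weakI\<close>)
  have "(l2norm x)\<^sup>2 \<le> (l2norm (dc f))\<^sup>2"
    unfolding l2norm_square[of x] using l bessel by (intro infsum_le_finite_sums) (auto simp: l2_def x_def)
  then show "l2norm (dc (\<lambda>z. f (\<phi> z))) \<le> l2norm (dc f)"
    unfolding x_def by (rule power2_le_imp_le) simp
qed

lemma dir_space_compose_aut:
  assumes "ball_aut \<phi>" "f \<in> dir_space" shows "(\<lambda>z. f (\<phi> z)) \<in> dir_space"
  using dc_compose_aut[OF assms] holo_fun_compose_aut[OF assms(1)] assms(2) by (simp add: dir_space_iff)

text \<open>The double inverse returns \<phi> on the ball only, so holomorphy is transferred by
  congruence there.\<close>

lemma ball_aut_inverse:
  assumes \<phi>: "ball_aut \<phi>" shows "ball_aut (inv_into ballN \<phi>)"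
proof -
  note A = ball_aut_inv[OF \<phi>]
  have b: "bij_betw \<phi> ballN ballN" using \<phi> by (simp add: ball_aut_def)
  have "inv_into ballN (inv_into ballN \<phi>) z = \<phi> z" if z: "z \<in> ballN" for z
  proof -
    have "inj_on (inv_into ballN \<phi>) ballN" "\<phi> z \<in> ballN"
      using bij_betw_inv_into[OF b] A(1)[of z] z by (simp_all add: bij_betw_def)
    from inv_into_f_f[OF this] A(3)[of z] z show ?thesis by simp
  qed
  then have "holo_map ballN (inv_into ballN (inv_into ballN \<phi>))"
    using A(5) unfolding holo_map_def by (metis (no_types, lifting) holo_fun_cong_ball)
  then show ?thesis using bij_betw_inv_into[OF b] A(6) by (simp add: ball_aut_def)
qed

lemma l2norm_compose_aut:
  assumes \<phi>: "ball_aut \<phi>" and f: "f \<in> dir_space"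
  shows "l2norm (dc (\<lambda>z. f (\<phi> z))) = l2norm (dc f)"
proof (rule antisym[OF dc_compose_aut(2)[OF assms]])
  have "l2norm (dc (\<lambda>z. f (\<phi> (inv_into ballN \<phi> z)))) \<le> l2norm (dc (\<lambda>z. f (\<phi> z)))"
    by (rule dc_compose_aut(2)[OF ball_aut_inverse[OF \<phi>] dir_space_compose_aut[OF assms]])
  moreover have "dc (\<lambda>z. f (\<phi> (inv_into ballN \<phi> z))) = dc f"
    by (rule dc_cong) (simp add: ball_aut_inv(4)[OF \<phi>])
  ultimately show "l2norm (dc f) \<le> l2norm (dc (\<lambda>z. f (\<phi> z)))" by simp
qed

definition l2in :: "('a \<Rightarrow> complex) \<Rightarrow> ('a \<Rightarrow> complex) \<Rightarrow> complex" where
  "l2in a b = (\<Sum>\<^sub>\<infinity>x. a x * cnj (b x))"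

lemma l2in_has_sum: "l2 a \<Longrightarrow> l2 b \<Longrightarrow> ((\<lambda>x. a x * cnj (b x)) has_sum l2in a b) UNIV"
  unfolding l2in_def by (rule has_sum_infsum, rule l2_mult_summable) simp_all

lemma l2in_cnj: "l2 a \<Longrightarrow> l2 b \<Longrightarrow> l2in b a = cnj (l2in a b)"
  unfolding l2in_def infsum_cnj[symmetric] by (simp add: mult.commute)

lemma l2in_lin_left:
  assumes "l2 a" "l2 b" "l2 d" shows "l2in (\<lambda>x. a x + c * b x) d = l2in a d + c * l2in b d"
proof -
  have "((\<lambda>x. a x * cnj (d x) + c * (b x * cnj (d x))) has_sum (l2in a d + c * l2in b d)) UNIV"
    by (intro has_sum_add has_sum_cmult_right l2in_has_sum assms)
  then show ?thesis unfolding l2in_def by (intro infsumI) (simp add: algebra_simps)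
qed

lemma l2norm_lin_square:
  assumes "l2 a" "l2 b"
  shows "(l2norm (\<lambda>x. a x + c * b x))\<^sup>2 = (l2norm a)\<^sup>2 + (cmod c)\<^sup>2 * (l2norm b)\<^sup>2 + 2 * Re (cnj c * l2in a b)"
proof -
  let ?s = "\<lambda>x. a x + c * b x"
  have s: "l2 ?s" using assms by (intro l2_add l2_cmult)
  have n: "l2in u u = of_real ((l2norm u)\<^sup>2)" if "l2 u" for u :: "'a \<Rightarrow> complex"
    unfolding l2in_def by (rule infsum_self_cnj[OF that])
  have "l2in ?s ?s = l2in a ?s + c * l2in b ?s" by (rule l2in_lin_left[OF assms s])
  also have "l2in a ?s = cnj (l2in a a + c * l2in b a)" 
    using l2in_cnj[OF s assms(1)] l2in_lin_left[OF assms assms(1), of c] by simp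
  also have "l2in b ?s = cnj (l2in a b + c * l2in b b)" 
    using l2in_cnj[OF s assms(2)] l2in_lin_left[OF assms assms(2), of c] by simp
  also have "l2in b a = cnj (l2in a b)" by (rule l2in_cnj[OF assms])
  finally have "Re (l2in ?s ?s) = Re (cnj (l2in a a + c * cnj (l2in a b)) + c * cnj (l2in a b + c * l2in b b))" by simp
  then show ?thesis
    unfolding n[OF s] n[OF assms(1)] n[OF assms(2)] cmod_power2[of c] by (simp add: algebra_simps power2_eq_square)
qed

text \<open>Polarisation again, now of the invariant norm of f + c g with c = 1 and c = i.\<close>

lemma l2in_compose_aut:
  assumes \<phi>: "ball_aut \<phi>" and f: "f \<in> dir_space" and g: "g \<in> dir_space"
  shows "l2in (dc (\<lambda>z. f (\<phi> z))) (dc (\<lambda>z. g (\<phi> z))) = l2in (dc f) (dc g)"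
proof -
  have "Re (cnj c * l2in (dc (\<lambda>z. f (\<phi> z))) (dc (\<lambda>z. g (\<phi> z)))) = Re (cnj c * l2in (dc f) (dc g))" for c
  proof -
    have lin: "dc (\<lambda>z. u z + c * v z) = (\<lambda>\<alpha>. dc u \<alpha> + c * dc v \<alpha>)" if "u \<in> dir_space" "v \<in> dir_space" for u v :: "complex ^ 'a \<Rightarrow> complex"
      using dc_lin[of u v 1 c] that by (simp add: dir_space_holo)
    have d: "(\<lambda>z. f z + c * g z) \<in> dir_space" using dir_space_lin[OF f g, of 1 c] by simp
    have "l2norm (dc (\<lambda>z. f (\<phi> z) + c * g (\<phi> z))) = l2norm (dc (\<lambda>z. f z + c * g z))"
      using l2norm_compose_aut[OF \<phi> d] .
    then have "(l2norm (\<lambda>\<alpha>. dc (\<lambda>z. f (\<phi> z)) \<alpha> + c * dc (\<lambda>z. g (\<phi> z)) \<alpha>))\<^sup>2 = (l2norm (\<lambda>\<alpha>. dc f \<alpha> + c * dc g \<alpha>))\<^sup>2"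
      using lin[OF f g] lin[OF dir_space_compose_aut[OF \<phi> f] dir_space_compose_aut[OF \<phi> g]] by simp
    then show ?thesis
      using f g by (simp add: l2norm_lin_square dir_space_l2 dir_space_compose_aut[OF \<phi>] l2norm_compose_aut[OF \<phi>])
  qed
  from this[of 1] this[of \<i>] show ?thesis by (simp add: complex_eq_iff)
qed

subsection \<open>The adjoint of a composition operator\<close>

text \<open>Modulo constants, composition with \<open>\<psi>\<close> is unitary, so its adjoint is composition with the inverse.
  The kernel term represents the remaining functional \<open>f \<mapsto> f (\<psi> 0)\<close>.\<close>

definition adjop :: "(complex ^ 'n \<Rightarrow> complex ^ 'n) \<Rightarrow> (complex ^ 'n \<Rightarrow> complex) \<Rightarrow> complex ^ 'n \<Rightarrow> complex" where
  "adjop \<psi> h z = h (inv_into ballN \<psi> z) - h (inv_into ballN \<psi> 0) + h 0 * (1 + kern z (\<psi> 0))"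

lemma dir_space_affine:
  assumes "f \<in> dir_space" "g \<in> dir_space"
  shows "(\<lambda>z. f z + b * g z + c) \<in> dir_space" "dc (\<lambda>z. f z + b * g z + c) = (\<lambda>\<alpha>. dc f \<alpha> + b * dc g \<alpha>)"
proof -
  have h: "(\<lambda>z. f z + b * g z) \<in> dir_space" using dir_space_lin[OF assms, of 1 b] by simp
  show "(\<lambda>z. f z + b * g z + c) \<in> dir_space" using dir_space_lin[OF h dir_space_const, of 1 1 c] by simp
  show "dc (\<lambda>z. f z + b * g z + c) = (\<lambda>\<alpha>. dc f \<alpha> + b * dc g \<alpha>)"
    using dc_lin[OF dir_space_holo[OF h] holo_fun_const, of 1 1 c] dc_lin[of f g 1 b] assms by (simp add: dir_space_holo)
qed

lemma adjop_alt: "adjop \<psi> h = (\<lambda>z. h (inv_into ballN \<psi> z) + h 0 * kern z (\<psi> 0) + (h 0 - h (inv_into ballN \<psi> 0)))"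
  by (auto simp: adjop_def algebra_simps)

lemma adjop_dir_space:
  assumes "ball_aut \<psi>" "h \<in> dir_space" shows "adjop \<psi> h \<in> dir_space"
  unfolding adjop_alt
  by (intro dir_space_affine dir_space_compose_aut[OF ball_aut_inverse[OF assms(1)] assms(2)] kern_dir_space ball_aut_inv(1)[OF assms(1)]) simp

lemma dinner_l2in: "dinner f g = f 0 * cnj (g 0) + l2in (dc f) (dc g)"
  by (simp add: dinner_eq l2in_def)

lemma l2in_lin_right:
  assumes "l2 a" "l2 b" "l2 d" shows "l2in d (\<lambda>x. a x + c * b x) = l2in d a + cnj c * l2in d b"
  using l2in_lin_left[OF assms, of c] l2in_cnj[of "\<lambda>x. a x + c * b x" d] l2in_cnj[OF assms(1,3)] l2in_cnj[OF assms(2,3)] assms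
  by (simp add: l2_add l2_cmult)

lemma l2in_cnj_efun:
  assumes "f \<in> dir_space" "norm w < 1" shows "l2in (dc f) (\<lambda>\<alpha>. cnj (efun \<alpha> w)) = f w - f 0"
  by (simp add: l2in_def dir_space_eval[OF assms])

text \<open>Invariance of the seminorm moves \<psi> to the other side as its inverse. The leftover f
  (\<psi> 0) is f 0 plus a kernel pairing, and subtracting
  \<open>h (inv_into ballN \<psi> 0)\<close> gives the adjoint the value h 0 at the origin.\<close>

lemma dinner_adjop:
  assumes \<psi>: "ball_aut \<psi>" and f: "f \<in> dir_space" and h: "h \<in> dir_space"
  shows "dinner (comp_op \<psi> f) h = dinner f (adjop \<psi> h)"
proof -
  let ?\<psi>' = "inv_into ballN \<psi>"
  have p: "norm (\<psi> 0) < 1" using ball_aut_inv(1)[OF \<psi>, of 0] by simp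
  have h': "(\<lambda>z. h (?\<psi>' z)) \<in> dir_space" by (rule dir_space_compose_aut[OF ball_aut_inverse[OF \<psi>] h])
  have "dc h = dc (\<lambda>z. h (?\<psi>' (\<psi> z)))" by (rule dc_cong) (simp add: ball_aut_inv(3)[OF \<psi>])
  then have 1: "l2in (dc (\<lambda>z. f (\<psi> z))) (dc h) = l2in (dc f) (dc (\<lambda>z. h (?\<psi>' z)))"
    using l2in_compose_aut[OF \<psi> f h'] by simp
  have "dc (adjop \<psi> h) = (\<lambda>\<alpha>. dc (\<lambda>z. h (?\<psi>' z)) \<alpha> + h 0 * cnj (efun \<alpha> (\<psi> 0)))"
    unfolding adjop_alt using dir_space_affine(2)[OF h' kern_dir_space[OF p]] by (simp add: dc_kern[OF p])
  then have "l2in (dc f) (dc (adjop \<psi> h)) = l2in (dc f) (dc (\<lambda>z. h (?\<psi>' z))) + cnj (h 0) * (f (\<psi> 0) - f 0)"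
    using l2in_lin_right[of "dc (\<lambda>z. h (?\<psi>' z))" "\<lambda>\<alpha>. cnj (efun \<alpha> (\<psi> 0))" "dc f" "h 0"] f h' p
    by (simp add: dir_space_l2 efun_l2 l2in_cnj_efun)
  then show ?thesis
    by (simp add: dinner_l2in comp_op_def o_def 1 adjop_def algebra_simps)
qed

text \<open>Adding 1 makes \<open>kern\<close> reproducing for the full inner product, including the
  value at 0.\<close>

lemma dinner_kern:
  assumes "u \<in> dir_space" "norm w < 1"
  shows "dinner (\<lambda>z. 1 + kern z w) u = cnj (u w)"
proof -
  have "dc (\<lambda>z. 1 + kern z w) = (\<lambda>\<alpha>. cnj (efun \<alpha> w))"
    using dir_space_affine(2)[OF kern_dir_space[OF assms(2)] dir_space_const, of 1 1 0] by (simp add: dc_kern[OF assms(2)] add.commute)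
  moreover have "l2in (\<lambda>\<alpha>. cnj (efun \<alpha> w)) (dc u) = cnj (u w - u 0)"
    using l2in_cnj[of "dc u" "\<lambda>\<alpha>. cnj (efun \<alpha> w)"] assms by (simp add: l2in_cnj_efun dir_space_l2 efun_l2)
  ultimately show ?thesis by (simp add: dinner_l2in)
qed

lemma one_plus_kern_dir_space: "norm w < 1 \<Longrightarrow> (\<lambda>z. 1 + kern z w) \<in> dir_space"
  using dir_space_affine(1)[OF kern_dir_space dir_space_const, of w 1 1 0] by (simp add: add.commute)

text \<open>\<open>adjop\<close> witnesses that the choice in \<open>dadj\<close> succeeds; pairing
  with the reproducing kernel at z then fixes the chosen function at every point of the
  ball.\<close>

lemma dadj_comp_op:
  fixes \<psi> :: "complex ^ 'n \<Rightarrow> complex ^ 'n"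
  assumes \<psi>: "ball_aut \<psi>" and h: "h \<in> dir_space"
  shows "dadj (comp_op \<psi>) h \<in> dir_space" and "norm z < 1 \<Longrightarrow> dadj (comp_op \<psi>) h z = adjop \<psi> h z"
proof -
  let ?P = "\<lambda>S. (\<forall>g\<in>dir_space. S g \<in> dir_space) \<and>
                (\<forall>f\<in>dir_space. \<forall>g\<in>dir_space. dinner (comp_op \<psi> f) g = dinner f (S g))"
  have "?P (adjop \<psi>)" using adjop_dir_space[OF \<psi>] dinner_adjop[OF \<psi>] by blast
  then have P: "?P (dadj (comp_op \<psi>))" unfolding dadj_def by (rule someI[of ?P])
  then show d: "dadj (comp_op \<psi>) h \<in> dir_space" using h by blast
  show "dadj (comp_op \<psi>) h z = adjop \<psi> h z" if z: "norm z < 1"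
  proof -
    have "dinner (\<lambda>x. 1 + kern x z) (dadj (comp_op \<psi>) h) = dinner (\<lambda>x. 1 + kern x z) (adjop \<psi> h)"
      using P dinner_adjop[OF \<psi> one_plus_kern_dir_space[OF z] h] h one_plus_kern_dir_space[OF z] by metis
    then show ?thesis
      unfolding dinner_kern[OF d z] dinner_kern[OF adjop_dir_space[OF \<psi> h] z] by simp
  qed
qed

definition comm_op :: "(complex ^ 'n \<Rightarrow> complex ^ 'n) \<Rightarrow> (complex ^ 'n \<Rightarrow> complex ^ 'n) \<Rightarrow>
    (complex ^ 'n \<Rightarrow> complex) \<Rightarrow> complex ^ 'n \<Rightarrow> complex" where
  "comm_op \<phi> \<psi> f = dadj (comp_op \<psi>) (comp_op \<phi> f) - comp_op \<phi> (dadj (comp_op \<psi>) f)"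

lemma comm_op_dir_space:
  assumes "ball_aut \<phi>" "ball_aut \<psi>" "f \<in> dir_space"
  shows "comm_op \<phi> \<psi> f \<in> dir_space"
proof -
  have c: "comp_op \<phi> h \<in> dir_space" if "h \<in> dir_space" for h
    using dir_space_compose_aut[OF assms(1) that] by (simp add: comp_op_def o_def)
  show ?thesis
    unfolding comm_op_def by (intro dir_space_diff c dadj_comp_op(1)[OF assms(2)] assms(3))
qed

text \<open>Apart from the first two terms, f enters only through its values at four fixed points;
  this is the finite rank part.\<close>

lemma comm_op_eq:
  assumes \<phi>: "ball_aut \<phi>" and \<psi>: "ball_aut \<psi>" and f: "f \<in> dir_space" and z: "norm z < 1"
  shows "comm_op \<phi> \<psi> f z = f (\<phi> (inv_into ballN \<psi> z)) - f (inv_into ballN \<psi> (\<phi> z))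
     + (f (inv_into ballN \<psi> 0) - f (\<phi> (inv_into ballN \<psi> 0)))
     + f (\<phi> 0) * (1 + kern z (\<psi> 0)) - f 0 * (1 + kern (\<phi> z) (\<psi> 0))"
proof -
  have "comp_op \<phi> f \<in> dir_space" using dir_space_compose_aut[OF \<phi> f] by (simp add: comp_op_def o_def)
  from dadj_comp_op(2)[OF \<psi> this z] dadj_comp_op(2)[OF \<psi> f ball_aut_inv(1)[OF \<phi> z]]
  show ?thesis by (simp add: comm_op_def comp_op_def adjop_def)
qed

subsection \<open>Growth of Dirichlet functions at the boundary\<close>

lemma dnorm_eval:
  assumes "F \<in> dir_space" "norm w < 1"
  shows "cmod (F w) \<le> dnorm F * (1 + sqrt (kq w))"
proof -
  have "cmod (F 0) \<le> dnorm F" "l2norm (dc F) \<le> dnorm F"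
    unfolding dnorm_eq[OF assms(1)] by (auto intro!: real_le_rsqrt)
  moreover from this(2) have "l2norm (dc F) * sqrt (kq w) \<le> dnorm F * sqrt (kq w)"
    using kq_nonneg[OF assms(2)] by (intro mult_right_mono) auto
  moreover have "cmod (F w) \<le> cmod (F w - F 0) + cmod (F 0)" using norm_triangle_ineq[of "F w - F 0" "F 0"] by simp
  ultimately show ?thesis using dir_space_eval_bound[OF assms] by (simp add: algebra_simps)
qed

text \<open>Finitely many coefficients carry all but \<epsilon>^2 of the squared norm. They give a
  bounded function because |\<open>efun\<close>| \<le> 1 on the ball, and Cauchy-Schwarz handles the
  tail.\<close>

lemma dir_space_little_o:
  fixes g :: "complex ^ 'n \<Rightarrow> complex"
  assumes g: "g \<in> dir_space" and "\<epsilon> > 0"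
  obtains C where "\<And>w. norm w < 1 \<Longrightarrow> cmod (g w) \<le> C + \<epsilon> * sqrt (kq w)"
proof -
  define a where "a = dc g"
  have la: "l2 a" using g by (simp add: a_def dir_space_l2)
  have hs: "((\<lambda>\<alpha>. (cmod (a \<alpha>))\<^sup>2) has_sum (l2norm a)\<^sup>2) UNIV"
    unfolding l2norm_square by (rule has_sum_infsum) (use la in \<open>simp add: l2_def\<close>)
  then have "eventually (\<lambda>F. (\<Sum>\<alpha>\<in>F. (cmod (a \<alpha>))\<^sup>2) > (l2norm a)\<^sup>2 - \<epsilon>\<^sup>2) (finite_subsets_at_top UNIV)"
    unfolding has_sum_def by (rule order_tendstoD(1)) (use \<open>\<epsilon> > 0\<close> in simp)
  then obtain F where F: "finite F" "(\<Sum>\<alpha>\<in>F. (cmod (a \<alpha>))\<^sup>2) > (l2norm a)\<^sup>2 - \<epsilon>\<^sup>2"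
    unfolding eventually_finite_subsets_at_top by blast
  define b where "b \<alpha> = (if \<alpha> \<in> F then 0 else a \<alpha>)" for \<alpha>
  have "((\<lambda>\<alpha>. (cmod (a \<alpha>))\<^sup>2 + - (if \<alpha> \<in> F then (cmod (a \<alpha>))\<^sup>2 else 0)) has_sum (l2norm a)\<^sup>2 + - (\<Sum>\<alpha>\<in>F. (cmod (a \<alpha>))\<^sup>2)) UNIV"
    by (intro has_sum_add hs has_sum_uminusI has_sum_finite_neutralI[of F]) (use F in auto)
  moreover have "(\<lambda>\<alpha>. (cmod (a \<alpha>))\<^sup>2 + - (if \<alpha> \<in> F then (cmod (a \<alpha>))\<^sup>2 else 0)) = (\<lambda>\<alpha>. (cmod (b \<alpha>))\<^sup>2)"
    by (auto simp: b_def)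
  ultimately have hb: "((\<lambda>\<alpha>. (cmod (b \<alpha>))\<^sup>2) has_sum (l2norm a)\<^sup>2 - (\<Sum>\<alpha>\<in>F. (cmod (a \<alpha>))\<^sup>2)) UNIV" by simp
  then have lb: "l2 b" by (auto simp: l2_def summable_on_def)
  have "(l2norm b)\<^sup>2 \<le> \<epsilon>\<^sup>2" using F(2) infsumI[OF hb] l2norm_square[of b] by simp
  then have nb: "l2norm b \<le> \<epsilon>" using \<open>\<epsilon> > 0\<close> by (auto intro: power2_le_imp_le[where y = \<epsilon>])
  show ?thesis
  proof (rule that)
    fix w :: "complex ^ 'n" assume w: "norm w < 1"
    have "((\<lambda>\<alpha>. (if \<alpha> \<in> F then a \<alpha> * efun \<alpha> w else 0) + b \<alpha> * efun \<alpha> w) has_sum ((\<Sum>\<alpha>\<in>F. a \<alpha> * efun \<alpha> w) + (\<Sum>\<^sub>\<infinity>\<alpha>. b \<alpha> * efun \<alpha> w))) UNIV"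
      by (intro has_sum_add has_sum_finite_neutralI[of F] has_sum_infsum l2_mult_summable[OF lb efun_l2(1)[OF w]]) (use F in auto)
    moreover have "(\<lambda>\<alpha>. (if \<alpha> \<in> F then a \<alpha> * efun \<alpha> w else 0) + b \<alpha> * efun \<alpha> w) = (\<lambda>\<alpha>. a \<alpha> * efun \<alpha> w)"
      by (auto simp: b_def)
    ultimately have eq: "g w - g 0 = (\<Sum>\<alpha>\<in>F. a \<alpha> * efun \<alpha> w) + (\<Sum>\<^sub>\<infinity>\<alpha>. b \<alpha> * efun \<alpha> w)"
      unfolding dir_space_eval[OF g w] a_def[symmetric] using infsumI by fastforce
    have "cmod (\<Sum>\<alpha>\<in>F. a \<alpha> * efun \<alpha> w) \<le> (\<Sum>\<alpha>\<in>F. cmod (a \<alpha>))"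
      by (rule sum_norm_le) (use norm_efun_le_1[of w] w in \<open>auto simp: norm_mult intro!: mult_left_le\<close>)
    moreover have "cmod (\<Sum>\<^sub>\<infinity>\<alpha>. b \<alpha> * efun \<alpha> w) \<le> \<epsilon> * sqrt (kq w)"
    proof -
      have "l2norm (\<lambda>\<alpha>. efun \<alpha> w) = sqrt (kq w)" using efun_l2(2)[OF w] by (metis l2norm_nonneg real_sqrt_unique)
      then have "cmod (\<Sum>\<^sub>\<infinity>\<alpha>. b \<alpha> * efun \<alpha> w) \<le> l2norm b * sqrt (kq w)"
        using l2_Cauchy_Schwarz[OF lb efun_l2(1)[OF w]] by simp
      also have "\<dots> \<le> \<epsilon> * sqrt (kq w)" using nb kq_nonneg[OF w] by (intro mult_right_mono) auto
      finally show ?thesis .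
    qed
    moreover have "cmod (g w) \<le> cmod (g 0) + cmod (\<Sum>\<alpha>\<in>F. a \<alpha> * efun \<alpha> w) + cmod (\<Sum>\<^sub>\<infinity>\<alpha>. b \<alpha> * efun \<alpha> w)"
    proof -
      have "cmod (g w) \<le> cmod (g 0) + cmod (g w - g 0)" using norm_triangle_ineq[of "g 0" "g w - g 0"] by simp
      then show ?thesis
        using norm_triangle_ineq[of "\<Sum>\<alpha>\<in>F. a \<alpha> * efun \<alpha> w" "\<Sum>\<^sub>\<infinity>\<alpha>. b \<alpha> * efun \<alpha> w"] unfolding eq by linarith
    qed
    ultimately show "cmod (g w) \<le> (cmod (g 0) + (\<Sum>\<alpha>\<in>F. cmod (a \<alpha>))) + \<epsilon> * sqrt (kq w)" by linarith
  qed
qed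

text \<open>The argument of the logarithm has modulus between \<delta> and 2, and the imaginary part
  of the principal branch is at most pi in absolute value.\<close>

lemma kern_bound:
  assumes "norm z < 1" "norm w < 1" "\<delta> > 0" "\<delta> \<le> cmod (1 - cinner z w)"
  shows "cmod (kern z w) \<le> \<bar>ln \<delta>\<bar> + ln 2 + pi"
proof -
  let ?q = "1 - cinner z w"
  have ne: "?q \<noteq> 0" using one_minus_cinner_nonzero assms by auto
  have up: "cmod ?q \<le> 2" using norm_triangle_ineq4[of 1 "cinner z w"] norm_cinner_less_1[of z w] assms by simp
  have pos: "cmod ?q > 0" using assms by linarith
  have "Re (Ln ?q) = ln (cmod ?q)" using ne by simp
  moreover have "ln (cmod ?q) \<le> ln 2" "ln \<delta> \<le> ln (cmod ?q)" using up pos assms by auto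
  moreover have "ln 2 \<ge> (0::real)" by simp
  ultimately have "\<bar>Re (Ln ?q)\<bar> \<le> \<bar>ln \<delta>\<bar> + ln 2" by linarith
  moreover have "\<bar>Im (Ln ?q)\<bar> \<le> pi" using mpi_less_Im_Ln[OF ne] Im_Ln_le_pi[OF ne] by linarith
  ultimately show ?thesis using cmod_le[of "Ln ?q"] by (simp add: kern_def)
qed

lemma kern_bound_fixed:
  assumes "norm p < 1"
  obtains C where "\<And>z. norm z < 1 \<Longrightarrow> cmod (kern z p) \<le> C" "\<And>z. norm z < 1 \<Longrightarrow> cmod (kern p z) \<le> C" "0 \<le> C"
proof -
  have d: "1 - norm p \<le> cmod (1 - cinner z p)" "1 - norm p \<le> cmod (1 - cinner p z)" if "norm z < 1" for z
  proof -
    have "norm z * norm p \<le> 1 * norm p" using that by (intro mult_right_mono) auto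
    then have "cmod (cinner z p) \<le> norm p" "cmod (cinner p z) \<le> norm p"
      using norm_cinner_le[of z p] norm_cinner_le[of p z] by (auto simp: mult.commute)
    then show "1 - norm p \<le> cmod (1 - cinner z p)" "1 - norm p \<le> cmod (1 - cinner p z)"
      using norm_triangle_ineq2[of 1 "cinner z p"] norm_triangle_ineq2[of 1 "cinner p z"] by simp_all
  qed
  show ?thesis
  proof (rule that[of "\<bar>ln (1 - norm p)\<bar> + ln 2 + pi"])
    have "0 \<le> ln (2::real)" by simp
    then show "0 \<le> \<bar>ln (1 - norm p)\<bar> + ln 2 + pi" using pi_ge_zero by linarith
    show "cmod (kern z p) \<le> \<bar>ln (1 - norm p)\<bar> + ln 2 + pi" if "norm z < 1" for z
      by (rule kern_bound[OF that assms _ d(1)[OF that]]) (use assms in simp)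
    show "cmod (kern p z) \<le> \<bar>ln (1 - norm p)\<bar> + ln 2 + pi" if "norm z < 1" for z
      by (rule kern_bound[OF assms that _ d(2)[OF that]]) (use assms in simp)
  qed
qed

text \<open>The invariance formula on the diagonal; the terms with the interior point a stay bounded
  up to the sphere.\<close>

lemma kq_ball_aut:
  fixes \<phi> :: "complex ^ 'n \<Rightarrow> complex ^ 'n"
  assumes \<phi>: "ball_aut \<phi>"
  obtains C where "\<And>w. norm w < 1 \<Longrightarrow> kq w \<le> kq (\<phi> w) + C"
proof -
  define a where "a = inv_into ballN \<phi> 0"
  have na: "norm a < 1" using ball_aut_inv(2)[OF \<phi>, of 0] by (simp add: a_def)
  obtain C where C: "\<And>z. norm z < 1 \<Longrightarrow> cmod (kern z a) \<le> C" "\<And>z. norm z < 1 \<Longrightarrow> cmod (kern a z) \<le> C" "0 \<le> C"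
    using kern_bound_fixed[OF na] by blast
  show ?thesis
  proof (rule that[of "2 * C"])
    fix w :: "complex ^ 'n" assume w: "norm w < 1"
    have "complex_of_real (kq (\<phi> w)) = of_real (kq w) - kern w a - kern a w + of_real (kq a)"
      using kern_ball_aut[OF \<phi> a_def w w] kern_self[OF w] kern_self[OF na] kern_self[OF ball_aut_inv(1)[OF \<phi> w]] by simp
    from arg_cong[OF this, of Re] have "kq (\<phi> w) = kq w - Re (kern w a) - Re (kern a w) + kq a" by simp
    then show "kq w \<le> kq (\<phi> w) + 2 * C"
      using C(1,2)[OF w] complex_Re_le_cmod[of "kern w a"] complex_Re_le_cmod[of "kern a w"] kq_nonneg[OF na] by linarith
  qed
qed

subsection \<open>Commuting automorphisms\<close>

text \<open>The image of f is determined by four point values, which are bounded along the sequence.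
  A subsequence along which they converge in C^4 gives a limit in the span of 1, \<open>k1\<close>
  and \<open>k2\<close>.\<close>

lemma comm_op_compact:
  fixes \<phi> \<psi> :: "complex ^ 'n \<Rightarrow> complex ^ 'n"
  assumes \<phi>: "ball_aut \<phi>" and \<psi>: "ball_aut \<psi>" and comm: "\<forall>z\<in>ballN. \<phi> (\<psi> z) = \<psi> (\<phi> z)"
  shows "dcompact (comm_op \<phi> \<psi>)"
  unfolding dcompact_def
proof (intro conjI ballI allI impI)
  let ?\<psi>' = "inv_into ballN \<psi>"
  note A = ball_aut_inv[OF \<phi>] and B = ball_aut_inv[OF \<psi>]
  show "comm_op \<phi> \<psi> f \<in> dir_space" if "f \<in> dir_space" for f by (rule comm_op_dir_space[OF \<phi> \<psi> that])
  fix u :: "nat \<Rightarrow> complex ^ 'n \<Rightarrow> complex"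
  assume u: "\<forall>n. u n \<in> dir_space" and bu: "bounded (range (\<lambda>n. dnorm (u n)))"
  obtain K where K: "\<And>n. \<bar>dnorm (u n)\<bar> \<le> K" using bu by (auto simp: bounded_iff)
  define k1 k2 where "k1 z = 1 + kern z (\<psi> 0)" and "k2 z = 1 + kern (\<phi> z) (\<psi> 0)" for z
  have p: "norm (\<psi> 0) < 1" using B(1)[of 0] by simp
  have k1: "k1 \<in> dir_space" unfolding k1_def[abs_def] by (rule one_plus_kern_dir_space[OF p])
  have k2: "k2 \<in> dir_space" unfolding k2_def[abs_def] by (rule dir_space_compose_aut[OF \<phi> one_plus_kern_dir_space[OF p]])
  have eq: "comm_op \<phi> \<psi> f z = (f (?\<psi>' 0) - f (\<phi> (?\<psi>' 0))) + (f (\<phi> 0) * k1 z + (- f 0) * k2 z)"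
    if "f \<in> dir_space" "norm z < 1" for f z
  proof -
    \<comment> \<open>If \<phi> commutes with \<psi>, it also commutes with the inverse of \<psi>,
      so the first two terms of \<open>comm_op_eq\<close> cancel.\<close>
    have "\<psi> (\<phi> (?\<psi>' z)) = \<phi> z" using comm B(2,4)[OF that(2)] by (metis mem_ball_0)
    then have "\<phi> (?\<psi>' z) = ?\<psi>' (\<phi> z)" using B(3)[OF A(1)[OF B(2)[OF that(2)]]] by simp
    then show ?thesis using comm_op_eq[OF \<phi> \<psi> that] by (simp add: k1_def k2_def)
  qed
  have bd: "bounded (range (\<lambda>n. u n w))" if "norm w < 1" for w
    unfolding bounded_iff
  proof (intro exI[of _ "K * (1 + sqrt (kq w))"] ballI)
    fix y assume "y \<in> range (\<lambda>n. u n w)"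
    then obtain n where "y = u n w" by blast
    then have "cmod y \<le> dnorm (u n) * (1 + sqrt (kq w))" using dnorm_eval[of "u n" w] u that by simp
    also have "\<dots> \<le> K * (1 + sqrt (kq w))" using K[of n] kq_nonneg[OF that] by (intro mult_right_mono) auto
    finally show "norm y \<le> K * (1 + sqrt (kq w))" .
  qed
  have n0: "norm (?\<psi>' 0) < 1" "norm (\<phi> (?\<psi>' 0)) < 1" "norm (\<phi> 0) < 1"
    using A(1) B(2)[of 0] by simp_all
  define c where "c n = (u n (?\<psi>' 0), u n (\<phi> (?\<psi>' 0)), u n (\<phi> 0), u n 0)" for n
  have "bounded (range c)"
  proof (rule bounded_subset)
    show "bounded (range (\<lambda>n. u n (?\<psi>' 0)) \<times> range (\<lambda>n. u n (\<phi> (?\<psi>' 0))) \<times> range (\<lambda>n. u n (\<phi> 0)) \<times> range (\<lambda>n. u n 0))"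
      by (intro bounded_Times bd n0) simp
  qed (auto simp: c_def)
  then obtain l r where r: "strict_mono r" "(c \<circ> r) \<longlonglongrightarrow> l"
    using bounded_imp_convergent_subsequence by blast
  obtain l1 l2 l3 l4 where l: "l = (l1, l2, l3, l4)" by (cases l) auto
  have lim: "(\<lambda>n. u (r n) (?\<psi>' 0)) \<longlonglongrightarrow> l1" "(\<lambda>n. u (r n) (\<phi> (?\<psi>' 0))) \<longlonglongrightarrow> l2"
    "(\<lambda>n. u (r n) (\<phi> 0)) \<longlonglongrightarrow> l3" "(\<lambda>n. u (r n) 0) \<longlonglongrightarrow> l4"
    using tendsto_fst[OF r(2)] tendsto_fst[OF tendsto_snd[OF r(2)]]
      tendsto_fst[OF tendsto_snd[OF tendsto_snd[OF r(2)]]] tendsto_snd[OF tendsto_snd[OF tendsto_snd[OF r(2)]]]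
    by (simp_all add: c_def l o_def)
  define g where "g z = (l1 - l2) + (l3 * k1 z + (- l4) * k2 z)" for z
  have g: "g \<in> dir_space"
    using dir_space_lin[OF dir_space_const[of "l1 - l2"] dir_space_lin[OF k1 k2, of l3 "- l4"], of 1 1] by (simp add: g_def[abs_def])
  define d1 d2 d3 where "d1 n = u (r n) (?\<psi>' 0) - u (r n) (\<phi> (?\<psi>' 0)) - (l1 - l2)" and "d2 n = u (r n) (\<phi> 0) - l3"
    and "d3 n = - u (r n) 0 + l4" for n
  have d0: "d1 \<longlonglongrightarrow> 0" "d2 \<longlonglongrightarrow> 0" "d3 \<longlonglongrightarrow> 0"
    unfolding d1_def[abs_def] d2_def[abs_def] d3_def[abs_def]
    using tendsto_diff[OF tendsto_diff[OF lim(1,2)] tendsto_const[of "l1 - l2"]] tendsto_diff[OF lim(3) tendsto_const[of l3]]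
      tendsto_add[OF tendsto_minus[OF lim(4)] tendsto_const[of l4]] by simp_all
  define m where "m n = (\<lambda>z. d2 n * k1 z + d3 n * k2 z)" for n
  have m: "m n \<in> dir_space" for n unfolding m_def by (rule dir_space_lin[OF k1 k2])
  have dn: "dnorm (comm_op \<phi> \<psi> (u (r n)) - g) = dnorm (\<lambda>z. d1 n * 1 + 1 * m n z)" for n
    by (rule dnorm_cong) (use u in \<open>simp add: eq g_def d1_def d2_def d3_def m_def algebra_simps\<close>)
  have le: "(dnorm (comm_op \<phi> \<psi> (u (r n)) - g))\<^sup>2 \<le> 2 * (cmod (d1 n) * dnorm (\<lambda>z :: complex ^ 'n. 1))\<^sup>2 +
      2 * (2 * (cmod (d2 n) * dnorm k1)\<^sup>2 + 2 * (cmod (d3 n) * dnorm k2)\<^sup>2)" for n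
  proof -
    have "(dnorm (\<lambda>z. d1 n * 1 + 1 * m n z))\<^sup>2 \<le> 2 * (cmod (d1 n) * dnorm (\<lambda>z :: complex ^ 'n. 1))\<^sup>2 + 2 * (cmod 1 * dnorm (m n))\<^sup>2"
      by (rule dnorm_lin_le[OF dir_space_const m])
    moreover have "(dnorm (m n))\<^sup>2 \<le> 2 * (cmod (d2 n) * dnorm k1)\<^sup>2 + 2 * (cmod (d3 n) * dnorm k2)\<^sup>2"
      unfolding m_def by (rule dnorm_lin_le[OF k1 k2])
    ultimately show ?thesis unfolding dn by simp
  qed
  have "(\<lambda>n. 2 * (cmod (d1 n) * dnorm (\<lambda>z :: complex ^ 'n. 1))\<^sup>2 +
      2 * (2 * (cmod (d2 n) * dnorm k1)\<^sup>2 + 2 * (cmod (d3 n) * dnorm k2)\<^sup>2)) \<longlonglongrightarrow>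
      2 * (cmod 0 * dnorm (\<lambda>z :: complex ^ 'n. 1))\<^sup>2 + 2 * (2 * (cmod 0 * dnorm k1)\<^sup>2 + 2 * (cmod 0 * dnorm k2)\<^sup>2)"
    by (intro tendsto_add tendsto_mult tendsto_power tendsto_norm tendsto_const d0)
  then have b0: "(\<lambda>n. 2 * (cmod (d1 n) * dnorm (\<lambda>z :: complex ^ 'n. 1))\<^sup>2 +
      2 * (2 * (cmod (d2 n) * dnorm k1)\<^sup>2 + 2 * (cmod (d3 n) * dnorm k2)\<^sup>2)) \<longlonglongrightarrow> 0"
    by simp
  have "(\<lambda>n. (dnorm (comm_op \<phi> \<psi> (u (r n)) - g))\<^sup>2) \<longlonglongrightarrow> 0"
    by (rule real_tendsto_sandwich[OF always_eventually[OF allI] always_eventually[OF allI] tendsto_const b0])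
       (rule zero_le_power2, rule le)
  then have "(\<lambda>n. sqrt ((dnorm (comm_op \<phi> \<psi> (u (r n)) - g))\<^sup>2)) \<longlonglongrightarrow> sqrt 0" by (rule tendsto_real_sqrt)
  moreover have "sqrt ((dnorm (comm_op \<phi> \<psi> (u (r n)) - g))\<^sup>2) = dnorm (comm_op \<phi> \<psi> (u (r n)) - g)" for n
    using dnorm_nonneg[OF dir_space_diff[OF comm_op_dir_space[OF \<phi> \<psi>] g]] u by simp
  ultimately have "(\<lambda>n. dnorm (comm_op \<phi> \<psi> (u (r n)) - g)) \<longlonglongrightarrow> 0" by simp
  with r(1) g show "\<exists>r g. strict_mono r \<and> g \<in> dir_space \<and> (\<lambda>n. dnorm (comm_op \<phi> \<psi> (u (r n)) - g)) \<longlonglongrightarrow> 0"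
    by blast
qed

section \<open>Non-commuting automorphisms\<close>

lemma unit_cinner_eq_1:
  assumes "norm x = 1" "norm y = 1" "cinner x y = 1"
  shows "x = y"
proof -
  have "cinner y x = 1" using assms(3) cnj_cinner[of x y] by simp
  then have "cinner (x - y) (x - y) = 0"
    using assms by (simp add: cinner_diff_left cinner_diff_right cinner_self[of x] cinner_self[of y])
  then show ?thesis by (simp add: cinner_self)
qed

text \<open>The maximum modulus principle on the complex disc through 0 and y, applied to each
  coordinate of the difference.\<close>

lemma eq_on_sphere_imp_eq:
  fixes S T :: "complex ^ 'n \<Rightarrow> complex ^ 'n"
  assumes S: "continuous_on (cball 0 1) S" "holo_map ballN S"
    and T: "continuous_on (cball 0 1) T" "holo_map ballN T"
    and eq: "\<And>z. norm z = 1 \<Longrightarrow> S z = T z" and y: "norm y < 1"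
  shows "S y = T y"
proof -
  \<comment> \<open>For y = 0 any unit vector spans a disc through y.\<close>
  define \<zeta> where "\<zeta> = (if y = 0 then axis undefined 1 else (1 / norm y) *s y)"
  have \<zeta>: "norm \<zeta> = 1"
  proof (cases "y = 0")
    case False
    then show ?thesis by (simp add: \<zeta>_def norm_divide)
  next
    case True
    have "(\<Sum>i\<in>(UNIV :: 'n set). (cmod (axis undefined 1 $ i))\<^sup>2) = (\<Sum>i\<in>(UNIV :: 'n set). if i = undefined then 1 else 0)"
      by (intro sum.cong) (auto simp: axis_def)
    then show ?thesis using True by (simp add: \<zeta>_def norm_vec_def L2_set_def)
  qed
  have y\<zeta>: "y = of_real (norm y) *s \<zeta>" by (simp add: \<zeta>_def)
  have "S y $ i = T y $ i" for i
  proof -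
    define h where "h t = S (t *s \<zeta>) $ i - T (t *s \<zeta>) $ i" for t
    have "holo_fun ballN (\<lambda>z. S z $ i - T z $ i)"
      using S(2) T(2) by (intro holo_fun_diff) (auto simp: holo_map_def)
    from holo_fun_slice[OF this open_ball, of 0 1 0 \<zeta>] have hol: "h holomorphic_on ball 0 1"
      using \<zeta> by (simp add: h_def[abs_def])
    have c: "continuous_on (cball 0 1) (\<lambda>t :: complex. t *s \<zeta>)"
      unfolding vector_scalar_mult_def by (intro continuous_intros)
    have sub: "(\<lambda>t :: complex. t *s \<zeta>) ` cball 0 1 \<subseteq> cball 0 1" using \<zeta> by auto
    have con: "continuous_on (cball 0 1) h"
      unfolding h_def[abs_def]
      by (intro continuous_intros continuous_on_compose2[OF S(1) c sub] continuous_on_compose2[OF T(1) c sub])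
    have "cmod (h (of_real (norm y))) \<le> 0"
    proof (rule maximum_modulus_frontier[where f = h and S = "ball 0 1"])
      show "h holomorphic_on interior (ball 0 1)" using hol by simp
      show "continuous_on (closure (ball 0 1)) h" using con by simp
      show "cmod (h z) \<le> 0" if "z \<in> frontier (ball 0 1)" for z
      proof -
        have "norm (z *s \<zeta>) = 1" using that by (simp add: frontier_ball \<zeta>)
        then show ?thesis using eq by (simp add: h_def)
      qed
    qed (use y in auto)
    then show ?thesis unfolding h_def y\<zeta>[symmetric] by simp
  qed
  then show ?thesis by (simp add: vec_eq_iff)
qed

lemma holo_map_cong_ball:
  fixes F :: "complex ^ 'n \<Rightarrow> complex ^ 'm"
  assumes eq: "\<And>z. norm z < 1 \<Longrightarrow> F z = G z" and F: "holo_map ballN F"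
  shows "holo_map ballN G"
  unfolding holo_map_def
proof
  fix i
  have "holo_fun ballN (\<lambda>z. F z $ i)" using F by (simp add: holo_map_def)
  then show "holo_fun ballN (\<lambda>z. G z $ i)"
    by (rule holo_fun_cong_ball[rotated]) (simp add: eq)
qed

text \<open>Equality on the sphere would give equality inside, so some boundary point separates the
  maps. There <T,S> is not 1 by \<open>unit_cinner_eq_1\<close>, and continuity along the radius
  keeps it away from 1.\<close>

lemma boundary_separation:
  fixes S T :: "complex ^ 'n \<Rightarrow> complex ^ 'n"
  assumes S: "continuous_on (cball 0 1) S" "holo_map ballN S" "\<And>z. norm z = 1 \<Longrightarrow> norm (S z) = 1"
    and T: "continuous_on (cball 0 1) T" "holo_map ballN T" "\<And>z. norm z = 1 \<Longrightarrow> norm (T z) = 1"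
    and y: "norm y < 1" "S y \<noteq> T y"
    and t: "t \<longlonglongrightarrow> 1" "\<And>n :: nat. 0 \<le> t n \<and> t n < 1"
  obtains \<zeta> \<delta> where "norm \<zeta> = 1" "\<delta> > 0"
    "eventually (\<lambda>n. \<delta> \<le> cmod (1 - cinner (T (of_real (t n) *s \<zeta>)) (S (of_real (t n) *s \<zeta>)))) sequentially"
proof -
  obtain \<zeta> where \<zeta>: "norm \<zeta> = 1" "S \<zeta> \<noteq> T \<zeta>"
    using eq_on_sphere_imp_eq[OF S(1,2) T(1,2) _ y(1)] y(2) by blast
  \<comment> \<open>Half of the limit, so that the radial values stay above it from some index
    on.\<close>
  define \<delta> where "\<delta> = cmod (1 - cinner (T \<zeta>) (S \<zeta>)) / 2"
  have "cinner (T \<zeta>) (S \<zeta>) \<noteq> 1" using unit_cinner_eq_1[of "T \<zeta>" "S \<zeta>"] S(3) T(3) \<zeta> by auto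
  then have \<delta>: "\<delta> > 0" by (simp add: \<delta>_def)
  have c: "continuous_on {0..1} (\<lambda>s. 1 - cinner (T (complex_of_real s *s \<zeta>)) (S (complex_of_real s *s \<zeta>)))"
  proof -
    have c: "continuous_on {0..1} (\<lambda>s. complex_of_real s *s \<zeta>)"
      unfolding vector_scalar_mult_def by (intro continuous_intros)
    have sub: "(\<lambda>s. complex_of_real s *s \<zeta>) ` {0..1} \<subseteq> cball 0 1" using \<zeta> by auto
    show ?thesis
      unfolding cinner_def
      by (intro continuous_intros continuous_on_compose2[OF S(1) c sub] continuous_on_compose2[OF T(1) c sub])
  qed
  have "(\<lambda>n. 1 - cinner (T (complex_of_real (t n) *s \<zeta>)) (S (complex_of_real (t n) *s \<zeta>)))
      \<longlonglongrightarrow> 1 - cinner (T (complex_of_real 1 *s \<zeta>)) (S (complex_of_real 1 *s \<zeta>))"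
    by (rule continuous_on_tendsto_compose[OF c t(1)]) (use t(2) in \<open>auto simp: less_imp_le intro!: always_eventually\<close>)
  from tendsto_norm[OF this]
  have "(\<lambda>n. cmod (1 - cinner (T (complex_of_real (t n) *s \<zeta>)) (S (complex_of_real (t n) *s \<zeta>)))) \<longlonglongrightarrow> 2 * \<delta>"
    by (simp add: \<delta>_def)
  from order_tendstoD(1)[OF this, of \<delta>] \<delta>
  have "eventually (\<lambda>n. \<delta> \<le> cmod (1 - cinner (T (of_real (t n) *s \<zeta>)) (S (of_real (t n) *s \<zeta>)))) sequentially"
    by (auto elim: eventually_mono)
  with \<zeta>(1) \<delta> show ?thesis by (rule that)
qed

lemma dnorm_one_plus_kern:
  assumes "norm w < 1" shows "(dnorm (\<lambda>z. c * (1 + kern z w)))\<^sup>2 = (cmod c)\<^sup>2 * (1 + kq w)"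
proof -
  have k: "(\<lambda>z. 1 + kern z w) \<in> dir_space" by (rule one_plus_kern_dir_space[OF assms])
  have "dc (\<lambda>z. 1 + kern z w) = (\<lambda>\<alpha>. cnj (efun \<alpha> w))"
    using dir_space_affine(2)[OF kern_dir_space[OF assms] dir_space_const, of 1 1 0] by (simp add: dc_kern[OF assms] add.commute)
  then have "dc (\<lambda>z. c * (1 + kern z w)) = (\<lambda>\<alpha>. c * cnj (efun \<alpha> w))"
    using dc_lin[OF dir_space_holo[OF k] holo_fun_const[of _ 0], of c 0] by simp
  moreover have "(\<lambda>z. c * (1 + kern z w)) \<in> dir_space"
    using dir_space_lin[OF k dir_space_const[of 0], of c 0] by simp
  ultimately show ?thesis
    using assms by (simp add: dnorm_square l2_cmult efun_l2 power_mult_distrib algebra_simps)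
qed

lemma comm_op_compact_imp_commute:
  fixes \<phi> \<psi> :: "complex ^ 'n \<Rightarrow> complex ^ 'n"
  assumes \<phi>: "ball_aut \<phi>" and \<psi>: "ball_aut \<psi>" and comp: "dcompact (comm_op \<phi> \<psi>)"
  shows "\<forall>z\<in>ballN. \<phi> (\<psi> z) = \<psi> (\<phi> z)"
proof (rule ccontr)
  let ?\<psi>' = "inv_into ballN \<psi>"
  note A = ball_aut_inv[OF \<phi>] and B = ball_aut_inv[OF \<psi>]
  assume "\<not> ?thesis"
  then obtain z0 where z0: "norm z0 < 1" "\<phi> (\<psi> z0) \<noteq> \<psi> (\<phi> z0)" by auto
  \<comment> \<open>At this image point the failure of commutation becomes one for \<phi> and the
    inverse of \<psi>.\<close>
  define y where "y = \<psi> z0"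
  have y: "norm y < 1" "\<phi> (?\<psi>' y) \<noteq> ?\<psi>' (\<phi> y)"
    using B(1,3)[OF z0(1)] B(4)[OF A(1)[OF B(1)[OF z0(1)]]] z0(2) by (auto simp: y_def)
  obtain \<Phi> :: "complex ^ 'n \<Rightarrow> complex ^ 'n" where \<Phi>: "continuous_on (cball 0 1) \<Phi>"
    "\<And>z. norm z < 1 \<Longrightarrow> \<Phi> z = \<phi> z" "\<And>z. norm z = 1 \<Longrightarrow> norm (\<Phi> z) = 1"
    using ball_aut_extend[OF \<phi>] by blast
  obtain \<Psi> :: "complex ^ 'n \<Rightarrow> complex ^ 'n" where \<Psi>: "continuous_on (cball 0 1) \<Psi>"
    "\<And>z. norm z < 1 \<Longrightarrow> \<Psi> z = ?\<psi>' z" "\<And>z. norm z = 1 \<Longrightarrow> norm (\<Psi> z) = 1"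
    using ball_aut_extend[OF ball_aut_inverse[OF \<psi>]] by blast
  have le1: "norm (\<Phi> z) \<le> 1" "norm (\<Psi> z) \<le> 1" if "norm z \<le> 1" for z
    using that \<Phi>(2,3)[of z] \<Psi>(2,3)[of z] A(1)[of z] B(2)[of z]
    by (cases "norm z = 1", auto simp: less_imp_le order.order_iff_strict)
  define t where "t n = sqrt (1 - exp (- real n))" for n :: nat \<comment> \<open>chosen so that \<open>kq (t n *s \<zeta>) = n\<close>\<close>
  have tb: "0 \<le> t n \<and> t n < 1" for n by (simp add: t_def)
  have "(\<lambda>n. sqrt (1 - exp (- real n))) \<longlonglongrightarrow> sqrt (1 - 0)"
    by (intro tendsto_intros filterlim_compose[OF exp_at_bot] filterlim_compose[OF filterlim_uminus_at_bot_at_top] filterlim_real_sequentially)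
  then have tlim: "t \<longlonglongrightarrow> 1" by (simp add: t_def[abs_def])
  obtain \<zeta> \<delta> where \<zeta>: "norm \<zeta> = 1" and \<delta>: "\<delta> > 0" and sep:
    "eventually (\<lambda>n. \<delta> \<le> cmod (1 - cinner (\<Psi> (\<Phi> (of_real (t n) *s \<zeta>))) (\<Phi> (\<Psi> (of_real (t n) *s \<zeta>))))) sequentially"
  proof (rule boundary_separation[where S = "\<lambda>z. \<Phi> (\<Psi> z)" and T = "\<lambda>z. \<Psi> (\<Phi> z)"])
    show "continuous_on (cball 0 1) (\<lambda>z. \<Phi> (\<Psi> z))" "continuous_on (cball 0 1) (\<lambda>z. \<Psi> (\<Phi> z))"
      by (rule continuous_on_compose2[OF \<Phi>(1) \<Psi>(1)], use le1 in auto)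
         (rule continuous_on_compose2[OF \<Psi>(1) \<Phi>(1)], use le1 in auto)
    have "holo_map ballN (\<lambda>z. \<phi> (?\<psi>' z))" by (rule holo_map_compose[OF B(6) _ A(5)]) (use B(2) in auto)
    then show "holo_map ballN (\<lambda>z. \<Phi> (\<Psi> z))"
      by (rule holo_map_cong_ball[rotated]) (simp add: \<Phi>(2) \<Psi>(2) B(2))
    have "holo_map ballN (\<lambda>z. ?\<psi>' (\<phi> z))" by (rule holo_map_compose[OF A(5) _ B(6)]) (use A(1) in auto)
    then show "holo_map ballN (\<lambda>z. \<Psi> (\<Phi> z))"
      by (rule holo_map_cong_ball[rotated]) (simp add: \<Phi>(2) \<Psi>(2) A(1))
    show "\<Phi> (\<Psi> y) \<noteq> \<Psi> (\<Phi> y)" using \<Phi>(2) \<Psi>(2) y A(1) B(2) by simp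
  qed (use \<Phi>(3) \<Psi>(3) y(1) tlim tb in blast)+
  define v where "v n = complex_of_real (t n) *s \<zeta>" for n
  have nv: "norm (v n) = t n" for n using tb[of n] \<zeta> by (simp add: v_def)
  have v: "norm (v n) < 1" for n using nv tb by simp
  have kv: "kq (v n) = real n" for n by (simp add: kq_def nv t_def)
  define w where "w n = \<phi> (?\<psi>' (v n))" for n
  have w: "norm (w n) < 1" for n using A(1)[OF B(2)[OF v]] by (simp add: w_def)
  define x where "x n = ?\<psi>' (\<phi> (v n))" for n
  have x: "norm (x n) < 1" for n using B(2)[OF A(1)[OF v]] by (simp add: x_def)
  have sep': "eventually (\<lambda>n. \<delta> \<le> cmod (1 - cinner (x n) (w n))) sequentially"
    using sep \<Phi>(2) \<Psi>(2) v A(1) B(2) by (simp add: w_def x_def v_def)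
  obtain C1 where C1: "\<And>w. norm w < 1 \<Longrightarrow> kq w \<le> kq (\<phi> w) + C1" using kq_ball_aut[OF \<phi>] by blast
  obtain C2 where C2: "\<And>w. norm w < 1 \<Longrightarrow> kq w \<le> kq (?\<psi>' w) + C2" using kq_ball_aut[OF ball_aut_inverse[OF \<psi>]] by blast
  define C0 where "C0 = C1 + C2"
  have kw: "real n \<le> kq (w n) + C0" for n
    using C1[OF B(2)[OF v[of n]]] C2[OF v[of n]] by (simp add: kv w_def C0_def)
  \<comment> \<open>\<open>N n\<close> is the norm of the reproducing kernel at \<open>w n\<close>,
    so that \<open>u n\<close> below is a unit vector and takes the value \<open>N n\<close> at
    \<open>w n\<close>.\<close>
  define N where "N n = sqrt (1 + kq (w n))" for n
  have N1: "N n \<ge> 1" and N2: "(N n)\<^sup>2 = 1 + kq (w n)" for n using kq_nonneg[OF w[of n]] by (simp_all add: N_def)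
  define u where "u n = (\<lambda>z. complex_of_real (1 / N n) * (1 + kern z (w n)))" for n
  have u: "u n \<in> dir_space" for n
    using dir_space_lin[OF one_plus_kern_dir_space[OF w] dir_space_const[of 0], of "of_real (1 / N n)" n 0] by (simp add: u_def)
  have du: "dnorm (u n) = 1" for n
  proof -
    have "(dnorm (u n))\<^sup>2 = 1" using dnorm_one_plus_kern[OF w, of "of_real (1 / N n)" n] N1[of n]
      by (simp add: u_def N2[symmetric] norm_divide power_divide)
    then show ?thesis using dnorm_nonneg[OF u[of n]] by (simp add: power2_eq_1_iff)
  qed
  have "bounded (range (\<lambda>n. dnorm (u n)))" by (simp add: du)
  then obtain r g where r: "strict_mono (r :: nat \<Rightarrow> nat)" and g: "g \<in> dir_space"
    and conv: "(\<lambda>n. dnorm (comm_op \<phi> \<psi> (u (r n)) - g)) \<longlonglongrightarrow> 0"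
    using comp u unfolding dcompact_def by blast
  \<comment> \<open>At a fixed interior point the kernel is bounded uniformly in its other argument,
    and \<open>N n\<close> \<ge> 1.\<close>
  have fixed: "\<exists>C\<ge>0. \<forall>n. cmod (u n p) \<le> C" if p: "norm p < 1" for p
  proof -
    obtain C where C: "\<And>z. norm z < 1 \<Longrightarrow> cmod (kern z p) \<le> C" "\<And>z. norm z < 1 \<Longrightarrow> cmod (kern p z) \<le> C" "0 \<le> C"
      using kern_bound_fixed[OF p] by blast
    have "cmod (u n p) \<le> 1 + C" for n
    proof -
      have "cmod (u n p) \<le> cmod (1 + kern p (w n)) / 1"
        unfolding u_def norm_mult using N1[of n] by (simp add: norm_divide) (intro divide_left_mono[of 1, simplified]; simp)
      also have "\<dots> \<le> 1 + C" using norm_triangle_ineq[of 1 "kern p (w n)"] C(2)[OF w[of n]] by simp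
      finally show ?thesis .
    qed
    with C(3) show ?thesis by (intro exI[of _ "1 + C"]) auto
  qed
  have n0: "norm (?\<psi>' 0) < 1" "norm (\<phi> (?\<psi>' 0)) < 1" "norm (\<phi> 0) < 1" "norm (\<psi> 0) < 1"
    using A(1) B(1,2)[of 0] by simp_all
  obtain D1 where D1: "\<And>n. cmod (u n (?\<psi>' 0)) \<le> D1" "D1 \<ge> 0" using fixed[OF n0(1)] by blast
  obtain D2 where D2: "\<And>n. cmod (u n (\<phi> (?\<psi>' 0))) \<le> D2" "D2 \<ge> 0" using fixed[OF n0(2)] by blast
  obtain D3 where D3: "\<And>n. cmod (u n (\<phi> 0)) \<le> D3" "D3 \<ge> 0" using fixed[OF n0(3)] by blast
  obtain D4 where D4: "\<And>n. cmod (u n 0) \<le> D4" "D4 \<ge> 0" using fixed[of 0] by auto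
  obtain E where E: "\<And>z. norm z < 1 \<Longrightarrow> cmod (kern z (\<psi> 0)) \<le> E" "\<And>z. norm z < 1 \<Longrightarrow> cmod (kern (\<psi> 0) z) \<le> E" "0 \<le> E"
    using kern_bound_fixed[OF n0(4)] by blast
  \<comment> \<open>Bounds \<open>u n\<close> at \<open>x n\<close> once <x n, w n> keeps distance
    \<delta> from 1.\<close>
  define D5 where "D5 = 1 + (\<bar>ln \<delta>\<bar> + ln 2 + pi)"
  define D where "D = D5 + D1 + D2 + D3 * (1 + E) + D4 * (1 + E)"
  \<comment> \<open>At \<open>v n\<close> the term \<open>u n (w n)\<close> contributes
    \<open>N n\<close>, and D bounds the sum of all the others.\<close>
  have lower: "N n - D \<le> cmod (comm_op \<phi> \<psi> (u n) (v n))" if d: "\<delta> \<le> cmod (1 - cinner (x n) (w n))" for n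
  proof -
    have e: "comm_op \<phi> \<psi> (u n) (v n) = u n (w n) - u n (x n) + (u n (?\<psi>' 0) - u n (\<phi> (?\<psi>' 0)))
     + u n (\<phi> 0) * (1 + kern (v n) (\<psi> 0)) - u n 0 * (1 + kern (\<phi> (v n)) (\<psi> 0))"
      unfolding w_def x_def by (rule comm_op_eq[OF \<phi> \<psi> u v])
    have "u n (w n) = of_real (1 / N n) * of_real ((N n)\<^sup>2)"
      unfolding u_def kern_self[OF w] N2 by simp
    also have "\<dots> = of_real (N n)" using N1[of n] by (simp add: power2_eq_square)
    finally have uw: "cmod (u n (w n)) = N n" using N1[of n] by simp
    have ux: "cmod (u n (x n)) \<le> D5"
    proof -
      have "cmod (1 + kern (x n) (w n)) \<le> D5"
        using norm_triangle_ineq[of 1 "kern (x n) (w n)"] kern_bound[OF x w \<delta> d] by (simp add: D5_def)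
      moreover have "cmod (1 + kern (x n) (w n)) / N n \<le> cmod (1 + kern (x n) (w n)) / 1"
        using N1[of n] by (intro divide_left_mono) auto
      ultimately show ?thesis using N1[of n] unfolding u_def norm_mult by (simp add: norm_divide)
    qed
    have k: "cmod (1 + kern z (\<psi> 0)) \<le> 1 + E" if "norm z < 1" for z
      using norm_triangle_ineq[of 1 "kern z (\<psi> 0)"] E(1)[OF that] by simp
    have k1: "cmod (u n (\<phi> 0) * (1 + kern (v n) (\<psi> 0))) \<le> D3 * (1 + E)"
      unfolding norm_mult by (intro mult_mono D3 k v) auto
    have k2: "cmod (u n 0 * (1 + kern (\<phi> (v n)) (\<psi> 0))) \<le> D4 * (1 + E)"
      unfolding norm_mult by (intro mult_mono D4 k A(1) v) auto
    have "u n (w n) = comm_op \<phi> \<psi> (u n) (v n) + u n (x n) - u n (?\<psi>' 0) + u n (\<phi> (?\<psi>' 0))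
     - u n (\<phi> 0) * (1 + kern (v n) (\<psi> 0)) + u n 0 * (1 + kern (\<phi> (v n)) (\<psi> 0))" unfolding e by simp
    then have "N n \<le> cmod (comm_op \<phi> \<psi> (u n) (v n)) + cmod (u n (x n)) + cmod (u n (?\<psi>' 0)) + cmod (u n (\<phi> (?\<psi>' 0)))
     + cmod (u n (\<phi> 0) * (1 + kern (v n) (\<psi> 0))) + cmod (u n 0 * (1 + kern (\<phi> (v n)) (\<psi> 0)))"
      unfolding uw[symmetric]
      by (smt (verit, ccfv_threshold) norm_triangle_ineq norm_triangle_ineq4)
    then show ?thesis using ux D1(1)[of n] D2(1)[of n] k1 k2 unfolding D_def by linarith
  qed
  \<comment> \<open>With s the square root of \<open>r n\<close>, the lower bound is s / 2 - D,
    while the two tolerances of 1/8 allow at most s / 4 plus a constant.\<close>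
  obtain G where G: "\<And>w. norm w < 1 \<Longrightarrow> cmod (g w) \<le> G + 1/8 * sqrt (kq w)"
    using dir_space_little_o[OF g, of "1/8"] by auto
  have ev1: "eventually (\<lambda>n. dnorm (comm_op \<phi> \<psi> (u (r n)) - g) < 1/8) sequentially"
    using order_tendstoD(2)[OF conv, of "1/8"] by simp
  have ev2: "eventually (\<lambda>n. \<delta> \<le> cmod (1 - cinner (x (r n)) (w (r n)))) sequentially"
    using eventually_compose_filterlim[OF sep' filterlim_subseq[OF r]] .
  have lr: "filterlim (\<lambda>n. real (r n)) at_top sequentially"
    by (rule filterlim_compose[OF filterlim_real_sequentially filterlim_subseq[OF r]])
  \<comment> \<open>Beyond this index the loss \<open>C0\<close> costs at most half of
    \<open>r n\<close>.\<close>
  have ev3: "eventually (\<lambda>n. real (r n) \<ge> 2 * \<bar>C0\<bar>) sequentially"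
    using lr by (simp add: filterlim_at_top)
  \<comment> \<open>The inequalities will leave s / 4 \<le> D + G + 1/8, which this
    excludes.\<close>
  have ev4: "eventually (\<lambda>n. sqrt (real (r n)) \<ge> 4 * (D + G + 1) + 1) sequentially"
    using filterlim_compose[OF sqrt_at_top lr] by (simp add: filterlim_at_top)
  from eventually_conj[OF ev1 eventually_conj[OF ev2 eventually_conj[OF ev3 ev4]]]
  obtain n where n: "dnorm (comm_op \<phi> \<psi> (u (r n)) - g) < 1/8" "\<delta> \<le> cmod (1 - cinner (x (r n)) (w (r n)))"
    "real (r n) \<ge> 2 * \<bar>C0\<bar>" "sqrt (real (r n)) \<ge> 4 * (D + G + 1) + 1"
    using eventually_happens'[OF sequentially_bot] by blast
  define m s where "m = r n" and "s = sqrt (real m)"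
  have s0: "s \<ge> 0" by (simp add: s_def)
  have "s / 2 \<le> N m"
  proof -
    have "s\<^sup>2 / 4 \<le> 1 + kq (w m)" using kw[of m] n(3) by (simp add: s_def m_def)
    then show ?thesis unfolding N_def by (intro real_le_rsqrt) (simp add: power_divide)
  qed
  moreover have "N m - D \<le> cmod (comm_op \<phi> \<psi> (u m) (v m))" using lower n(2) by (simp add: m_def)
  moreover have "cmod ((comm_op \<phi> \<psi> (u m) - g) (v m)) \<le> 1/8 * (1 + s)"
  proof -
    have "cmod ((comm_op \<phi> \<psi> (u m) - g) (v m)) \<le> dnorm (comm_op \<phi> \<psi> (u m) - g) * (1 + sqrt (kq (v m)))"
      by (rule dnorm_eval[OF dir_space_diff[OF comm_op_dir_space[OF \<phi> \<psi> u] g] v])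
    also have "\<dots> \<le> 1/8 * (1 + sqrt (kq (v m)))"
      using n(1) kq_nonneg[OF v[of m]] by (intro mult_right_mono) (auto simp: m_def)
    finally show ?thesis by (simp add: kv s_def)
  qed
  moreover have "cmod (g (v m)) \<le> G + 1/8 * s" using G[OF v[of m]] by (simp add: kv s_def)
  moreover have "cmod (comm_op \<phi> \<psi> (u m) (v m)) \<le> cmod ((comm_op \<phi> \<psi> (u m) - g) (v m)) + cmod (g (v m))"
    using norm_triangle_ineq[of "(comm_op \<phi> \<psi> (u m) - g) (v m)" "g (v m)"] by simp
  moreover have "s \<ge> 4 * (D + G + 1) + 1" using n(4) by (simp add: s_def m_def)
  ultimately show False by simp
qed

theorem theorem4p3:
  fixes \<phi> \<psi> :: "complex ^ 'n \<Rightarrow> complex ^ 'n"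
  assumes "ball_aut \<phi>" and "ball_aut \<psi>"
  shows "dcompact (\<lambda>f. dadj (comp_op \<psi>) (comp_op \<phi> f) - comp_op \<phi> (dadj (comp_op \<psi>) f))
         \<longleftrightarrow> (\<forall>z\<in>ballN. \<phi> (\<psi> z) = \<psi> (\<phi> z))"
  using comm_op_compact[OF assms] comm_op_compact_imp_commute[OF assms]
  unfolding comm_op_def[abs_def] by blast

end
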